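(* The categorification--nerve adjunction $$c\colon\mathrm{sSet}^{\Delta^{\mathrm{op}}}_{\mathrm{Cat}}\rightleftarrows\mathrm{Cat}\,{:}\,N$$ with left adjoint $c$ and right adjoint $N$ is a Quillen pair, whose derived counit is (at every category) an equivalence of categories.
   Context: (Here "$c\colon\cdots\rightleftarrows\cdots\,{:}\,N$" denotes an adjunction $c\dashv N$.) $\mathrm{Cat}$ is the category of small categories with its categorical model structure, in which the weak equivalences are the equivalences of categories and the fibrations are the isofibrations. The nerve $N\mathcal C$ of a category $\mathcal C$ is the simplicial space with $(N\mathcal C)_m$ the discrete simplicial set on $\mathrm{Cat}([m],\mathcal C)$; $c\colon\mathrm{sSet}^{\Delta^{\mathrm{op}}}\to\mathrm{Cat}$ is the left adjoint of $N$. The category $\mathrm{sSet}$ carries the Kan--Quillen model structure; sets are regarded as discrete simplicial sets. A simplicial space is a functor $X\colon\Delta^{\mathrm{op}}\to\mathrm{sSet}$; $X_m=X([m])$ and $X_{m,n}=(X_m)_n$. $F[m]$ is the simplicial space with $F[m]_k=\Delta([k],[m])$ (discrete), with boundary $\partial F[m]$ and spine $\mathrm{Sp}[m]$; $\Delta[n]$ also denotes the constant simplicial space at the standard $n$-simplex; $\mathrm{Map}(X,Y)\in\mathrm{sSet}$ has $n$-simplices the maps $X\times\Delta[n]\to Y$. A map $X\to Y$ is a Reedy fibration if for all $m\ge0$ the map $X_m\to Y_m\times_{\mathrm{Map}(\partial F[m],Y)}\mathrm{Map}(\partial F[m],X)$ is a Kan fibration. A Segal space is a Reedy fibrant $X$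 whose Segal maps $X_m\to\mathrm{Map}(\mathrm{Sp}[m],X)\cong X_1\times_{X_0}\cdots\times_{X_0}X_1$, $m\ge2$, are weak equivalences. For a Segal space $X$ and $x,y\in X_{0,0}$, $\mathrm{map}_X(x,y)$ is the fiber at $(x,y)$ of $(d_1,d_0)\colon X_1\to X_0\times X_0$; $\mathrm{ho}\,X$ is the category with objects $X_{0,0}$ and hom sets $\pi_0\mathrm{map}_X(x,y)$, with composition induced by the Segal condition. A map $f\colon X\to Y$ of Segal spaces is a Dwyer--Kan equivalence if all maps $\mathrm{map}_X(x,y)\to\mathrm{map}_Y(fx,fy)$ are weak equivalences and $\mathrm{ho}\,X\to\mathrm{ho}\,Y$ is essentially surjective; it is an isofibration if it is a Reedy fibration and $\mathrm{ho}\,X\to\mathrm{ho}\,Y$ is an isofibration of categories. $\mathrm{sSet}^{\Delta^{\mathrm{op}}}_{\mathrm{Cat}}$ is the cofibrantly generated model structure on $\mathrm{sSet}^{\Delta^{\mathrm{op}}}$ in which the cofibrations are the monomorphisms $f\colon X\to Y$ such that there are a set $S$ and a weak equivalence $X_0\amalg S\to Y_0$ in $\mathrm{sSet}$ restricting to $f_0$ on $X_0$; the fibrant objects are the Segal spaces; the weak equivalences (resp. fibrations) between Segal spaces are the Dwyer--Kan equivalences (resp. isofibrations). (A model structure is determined by its cofibrations and fibrant objects.) *)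

theory Defs
  imports "HOL-Homology.Homology"
begin

section \<open>Categories, functors, adjunctions\<close>

record ('o, 'a) category =
  Obj :: "'o set"
  Arr :: "'a set"
  Dom :: "'a \<Rightarrow> 'o"
  Cod :: "'a \<Rightarrow> 'o"
  Ident :: "'o \<Rightarrow> 'a"
  Comp :: "'a \<Rightarrow> 'a \<Rightarrow> 'a"  \<comment> \<open>\<open>Comp C g f\<close> is \<open>g\<close> after \<open>f\<close>\<close>

definition Hom :: "('o, 'a) category \<Rightarrow> 'o \<Rightarrow> 'o \<Rightarrow> 'a set" where
  "Hom C x y = {f \<in> Arr C. Dom C f = x \<and> Cod C f = y}"

definition is_category :: "('o, 'a) category \<Rightarrow> bool" where
  "is_category C \<longleftrightarrow>
     (\<forall>f\<in>Arr C. Dom C f \<in> Obj C \<and> Cod C f \<in> Obj C) \<and>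
     (\<forall>x\<in>Obj C. Ident C x \<in> Hom C x x) \<and>
     (\<forall>f\<in>Arr C. \<forall>g\<in>Arr C. Cod C f = Dom C g \<longrightarrow> Comp C g f \<in> Hom C (Dom C f) (Cod C g)) \<and>
     (\<forall>f\<in>Arr C. Comp C f (Ident C (Dom C f)) = f \<and> Comp C (Ident C (Cod C f)) f = f) \<and>
     (\<forall>f\<in>Arr C. \<forall>g\<in>Arr C. \<forall>h\<in>Arr C. Cod C f = Dom C g \<longrightarrow> Cod C g = Dom C h \<longrightarrow>
        Comp C h (Comp C g f) = Comp C (Comp C h g) f)"

definition is_iso :: "('o, 'a) category \<Rightarrow> 'a \<Rightarrow> bool" where
  "is_iso C f \<longleftrightarrow> f \<in> Arr C \<and> (\<exists>g\<in>Hom C (Cod C f) (Dom C f).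
     Comp C g f = Ident C (Dom C f) \<and> Comp C f g = Ident C (Cod C f))"

definition monic :: "('o, 'a) category \<Rightarrow> 'a \<Rightarrow> bool" where
  "monic C f \<longleftrightarrow> f \<in> Arr C \<and> (\<forall>g\<in>Arr C. \<forall>h\<in>Arr C.
     Cod C g = Dom C f \<longrightarrow> Cod C h = Dom C f \<longrightarrow> Dom C g = Dom C h \<longrightarrow>
     Comp C f g = Comp C f h \<longrightarrow> g = h)"

definition initial :: "('o, 'a) category \<Rightarrow> 'o \<Rightarrow> bool" where
  "initial C i \<longleftrightarrow> i \<in> Obj C \<and> (\<forall>x\<in>Obj C. \<exists>!f. f \<in> Hom C i x)"

definition terminal :: "('o, 'a) category \<Rightarrow> 'o \<Rightarrow> bool" where
  "terminal C t \<longleftrightarrow> t \<in> Obj C \<and> (\<forall>x\<in>Obj C. \<exists>!f. f \<in> Hom C x t)"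

text \<open>Functors carry their source and target, so that they can serve as arrows of a category;
  for the same reason the two component functions are extensional.\<close>

record ('o, 'a, 'p, 'b) fctr =
  FDom :: "('o, 'a) category"
  FCod :: "('p, 'b) category"
  FObj :: "'o \<Rightarrow> 'p"
  FArr :: "'a \<Rightarrow> 'b"

definition is_functor :: "('o, 'a, 'p, 'b) fctr \<Rightarrow> bool" where
  "is_functor F \<longleftrightarrow>
     is_category (FDom F) \<and> is_category (FCod F) \<and>
     FObj F \<in> Obj (FDom F) \<rightarrow>\<^sub>E Obj (FCod F) \<and>
     FArr F \<in> Arr (FDom F) \<rightarrow>\<^sub>E Arr (FCod F) \<and>
     (\<forall>f\<in>Arr (FDom F). Dom (FCod F) (FArr F f) = FObj F (Dom (FDom F) f) \<and>
                       Cod (FCod F) (FArr F f) = FObj F (Cod (FDom F) f)) \<and>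
     (\<forall>x\<in>Obj (FDom F). FArr F (Ident (FDom F) x) = Ident (FCod F) (FObj F x)) \<and>
     (\<forall>f\<in>Arr (FDom F). \<forall>g\<in>Arr (FDom F). Cod (FDom F) f = Dom (FDom F) g \<longrightarrow>
        FArr F (Comp (FDom F) g f) = Comp (FCod F) (FArr F g) (FArr F f))"

definition functors :: "('o, 'a) category \<Rightarrow> ('p, 'b) category \<Rightarrow> ('o, 'a, 'p, 'b) fctr set" where
  "functors C D = {F. is_functor F \<and> FDom F = C \<and> FCod F = D}"

definition fid :: "('o, 'a) category \<Rightarrow> ('o, 'a, 'o, 'a) fctr" where
  "fid C = \<lparr>FDom = C, FCod = C, FObj = (\<lambda>x\<in>Obj C. x), FArr = (\<lambda>f\<in>Arr C. f)\<rparr>"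

definition functor_comp ::
    "('p, 'b, 'q, 'c) fctr \<Rightarrow> ('o, 'a, 'p, 'b) fctr \<Rightarrow> ('o, 'a, 'q, 'c) fctr" where
  "functor_comp G F = \<lparr>FDom = FDom F, FCod = FCod G,
     FObj = compose (Obj (FDom F)) (FObj G) (FObj F),
     FArr = compose (Arr (FDom F)) (FArr G) (FArr F)\<rparr>"

definition nat_trans ::
    "('o, 'a, 'p, 'b) fctr \<Rightarrow> ('o, 'a, 'p, 'b) fctr \<Rightarrow> ('o \<Rightarrow> 'b) \<Rightarrow> bool" where
  "nat_trans F G t \<longleftrightarrow>
     is_functor F \<and> is_functor G \<and> FDom F = FDom G \<and> FCod F = FCod G \<and>
     (\<forall>x\<in>Obj (FDom F). t x \<in> Hom (FCod F) (FObj F x) (FObj G x)) \<and>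
     (\<forall>f\<in>Arr (FDom F). Comp (FCod F) (t (Cod (FDom F) f)) (FArr F f) =
                       Comp (FCod F) (FArr G f) (t (Dom (FDom F) f)))"

definition nat_iso ::
    "('o, 'a, 'p, 'b) fctr \<Rightarrow> ('o, 'a, 'p, 'b) fctr \<Rightarrow> ('o \<Rightarrow> 'b) \<Rightarrow> bool" where
  "nat_iso F G t \<longleftrightarrow> nat_trans F G t \<and> (\<forall>x\<in>Obj (FDom F). is_iso (FCod F) (t x))"

definition adjunction ::
    "('o, 'a, 'p, 'b) fctr \<Rightarrow> ('p, 'b, 'o, 'a) fctr \<Rightarrow> ('o \<Rightarrow> 'a) \<Rightarrow> ('p \<Rightarrow> 'b) \<Rightarrow> bool" where
  "adjunction L R \<eta> \<epsilon> \<longleftrightarrow>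
     is_functor L \<and> is_functor R \<and> FDom R = FCod L \<and> FCod R = FDom L \<and>
     nat_trans (fid (FDom L)) (functor_comp R L) \<eta> \<and>
     nat_trans (functor_comp L R) (fid (FCod L)) \<epsilon> \<and>
     (\<forall>a\<in>Obj (FDom L).
        Comp (FCod L) (\<epsilon> (FObj L a)) (FArr L (\<eta> a)) = Ident (FCod L) (FObj L a)) \<and>
     (\<forall>b\<in>Obj (FCod L).
        Comp (FDom L) (FArr R (\<epsilon> b)) (\<eta> (FObj R b)) = Ident (FDom L) (FObj R b))"

definition is_equivalence :: "('o, 'a, 'p, 'b) fctr \<Rightarrow> bool" where
  "is_equivalence F \<longleftrightarrow> is_functor F \<and>
     (\<exists>G \<alpha> \<beta>. G \<in> functors (FCod F) (FDom F) \<and>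
        nat_iso (fid (FDom F)) (functor_comp G F) \<alpha> \<and> nat_iso (functor_comp F G) (fid (FCod F)) \<beta>)"

definition is_isofibration :: "('o, 'a, 'p, 'b) fctr \<Rightarrow> bool" where
  "is_isofibration F \<longleftrightarrow> is_functor F \<and>
     (\<forall>x\<in>Obj (FDom F). \<forall>b. is_iso (FCod F) b \<and> Dom (FCod F) b = FObj F x \<longrightarrow>
        (\<exists>a. is_iso (FDom F) a \<and> Dom (FDom F) a = x \<and> FArr F a = b))"

definition essentially_surjective :: "('o, 'a, 'p, 'b) fctr \<Rightarrow> bool" where
  "essentially_surjective F \<longleftrightarrow> is_functor F \<and>
     (\<forall>y\<in>Obj (FCod F). \<exists>x\<in>Obj (FDom F). \<exists>b\<in>Hom (FCod F) (FObj F x) y. is_iso (FCod F) b)"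


section \<open>Model structures and Quillen pairs\<close>

record 'a model =
  Cof :: "'a set"
  Weq :: "'a set"
  Fib :: "'a set"

definition has_lifts :: "('o, 'a) category \<Rightarrow> 'a \<Rightarrow> 'a \<Rightarrow> bool" where
  "has_lifts C i p \<longleftrightarrow>
     (\<forall>u\<in>Hom C (Dom C i) (Dom C p). \<forall>v\<in>Hom C (Cod C i) (Cod C p).
        Comp C p u = Comp C v i \<longrightarrow>
        (\<exists>h\<in>Hom C (Cod C i) (Dom C p). Comp C h i = u \<and> Comp C p h = v))"

definition is_retract :: "('o, 'a) category \<Rightarrow> 'a \<Rightarrow> 'a \<Rightarrow> bool" where
  "is_retract C f g \<longleftrightarrow> f \<in> Arr C \<and> g \<in> Arr C \<and>
     (\<exists>i\<in>Hom C (Dom C f) (Dom C g). \<exists>r\<in>Hom C (Dom C g) (Dom C f).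
      \<exists>j\<in>Hom C (Cod C f) (Cod C g). \<exists>s\<in>Hom C (Cod C g) (Cod C f).
        Comp C r i = Ident C (Dom C f) \<and> Comp C s j = Ident C (Cod C f) \<and>
        Comp C g i = Comp C j f \<and> Comp C f r = Comp C s g)"

definition model_structure :: "('o, 'a) category \<Rightarrow> 'a model \<Rightarrow> bool" where
  "model_structure C M \<longleftrightarrow>
     is_category C \<and> Cof M \<subseteq> Arr C \<and> Weq M \<subseteq> Arr C \<and> Fib M \<subseteq> Arr C \<and>
     \<comment> \<open>two out of three\<close>
     (\<forall>f\<in>Arr C. \<forall>g\<in>Arr C. Cod C f = Dom C g \<longrightarrow>
        (f \<in> Weq M \<longrightarrow> g \<in> Weq M \<longrightarrow> Comp C g f \<in> Weq M) \<and>
        (f \<in> Weq M \<longrightarrow> Comp C g f \<in> Weq M \<longrightarrow> g \<in> Weq M) \<and>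
        (g \<in> Weq M \<longrightarrow> Comp C g f \<in> Weq M \<longrightarrow> f \<in> Weq M)) \<and>
     \<comment> \<open>retracts\<close>
     (\<forall>f g. is_retract C f g \<longrightarrow>
        (g \<in> Cof M \<longrightarrow> f \<in> Cof M) \<and> (g \<in> Weq M \<longrightarrow> f \<in> Weq M) \<and> (g \<in> Fib M \<longrightarrow> f \<in> Fib M)) \<and>
     \<comment> \<open>lifting\<close>
     (\<forall>i\<in>Cof M. \<forall>p\<in>Fib M. i \<in> Weq M \<or> p \<in> Weq M \<longrightarrow> has_lifts C i p) \<and>
     \<comment> \<open>factorisation\<close>
     (\<forall>f\<in>Arr C.
        (\<exists>i\<in>Cof M \<inter> Weq M. \<exists>p\<in>Fib M. Cod C i = Dom C p \<and> f = Comp C p i) \<and>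
        (\<exists>i\<in>Cof M. \<exists>p\<in>Fib M \<inter> Weq M. Cod C i = Dom C p \<and> f = Comp C p i))"

definition cofibrant :: "('o, 'a) category \<Rightarrow> 'a model \<Rightarrow> 'o \<Rightarrow> bool" where
  "cofibrant C M x \<longleftrightarrow> (\<exists>i f. initial C i \<and> f \<in> Hom C i x \<and> f \<in> Cof M)"

definition fibrant :: "('o, 'a) category \<Rightarrow> 'a model \<Rightarrow> 'o \<Rightarrow> bool" where
  "fibrant C M x \<longleftrightarrow> (\<exists>t f. terminal C t \<and> f \<in> Hom C x t \<and> f \<in> Fib M)"

definition quillen_pair ::
    "'a model \<Rightarrow> 'b model \<Rightarrow> ('o, 'a, 'p, 'b) fctr \<Rightarrow> ('p, 'b, 'o, 'a) fctr
       \<Rightarrow> ('o \<Rightarrow> 'a) \<Rightarrow> ('p \<Rightarrow> 'b) \<Rightarrow> bool" where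
  "quillen_pair M M' L R \<eta> \<epsilon> \<longleftrightarrow>
     model_structure (FDom L) M \<and> model_structure (FCod L) M' \<and> adjunction L R \<eta> \<epsilon> \<and>
     (\<forall>f\<in>Cof M. FArr L f \<in> Cof M') \<and>
     (\<forall>f\<in>Cof M \<inter> Weq M. FArr L f \<in> Cof M' \<inter> Weq M')"

text \<open>The derived counit at \<open>b\<close> is represented by \<open>L Q \<rightarrow> L (R b') \<rightarrow> b'\<close>, for a fibrant
  replacement \<open>r: b \<rightarrow> b'\<close> (which may be the identity if \<open>b\<close> is fibrant) and a cofibrant
  replacement \<open>q: Q \<rightarrow> R b'\<close>.\<close>

definition represents_derived_counit ::
    "'a model \<Rightarrow> 'b model \<Rightarrow> ('o, 'a, 'p, 'b) fctr \<Rightarrow> ('p, 'b, 'o, 'a) fctr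
       \<Rightarrow> ('p \<Rightarrow> 'b) \<Rightarrow> 'p \<Rightarrow> 'b \<Rightarrow> bool" where
  "represents_derived_counit M M' L R \<epsilon> b k \<longleftrightarrow>
     (\<exists>b' r Q q.
        r \<in> Hom (FCod L) b b' \<and> r \<in> Weq M' \<and> fibrant (FCod L) M' b' \<and>
        q \<in> Hom (FDom L) Q (FObj R b') \<and> q \<in> Weq M \<and> cofibrant (FDom L) M Q \<and>
        k = Comp (FCod L) (\<epsilon> b') (FArr L q))"


section \<open>Simplicial sets\<close>

text \<open>\<open>Delta n m\<close> is the set of morphisms \<open>[n] \<rightarrow> [m]\<close> of the simplex category, and
  \<open>act X n m \<theta>\<close> is the map \<open>X\<^sub>m \<rightarrow> X\<^sub>n\<close> induced by such a morphism \<open>\<theta>\<close>.\<close>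

definition Delta :: "nat \<Rightarrow> nat \<Rightarrow> (nat \<Rightarrow> nat) set" where
  "Delta n m = {\<theta> \<in> {..n} \<rightarrow>\<^sub>E {..m}. mono_on {..n} \<theta>}"

definition coface :: "nat \<Rightarrow> nat \<Rightarrow> nat \<Rightarrow> nat" where
  "coface n i = (\<lambda>j\<in>{..n}. if j < i then j else Suc j)"

definition const0 :: "nat \<Rightarrow> nat \<Rightarrow> nat" where
  "const0 n = (\<lambda>j\<in>{..n}. 0)"

record 'a sset =
  simp :: "nat \<Rightarrow> 'a set"
  act :: "nat \<Rightarrow> nat \<Rightarrow> (nat \<Rightarrow> nat) \<Rightarrow> 'a \<Rightarrow> 'a"

definition is_sset :: "'a sset \<Rightarrow> bool" where
  "is_sset X \<longleftrightarrow>
     (\<forall>n m. \<forall>\<theta>\<in>Delta n m. act X n m \<theta> \<in> simp X m \<rightarrow> simp X n) \<and>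
     (\<forall>n. \<forall>x\<in>simp X n. act X n n (\<lambda>j\<in>{..n}. j) x = x) \<and>
     (\<forall>l n m. \<forall>\<phi>\<in>Delta l n. \<forall>\<theta>\<in>Delta n m. \<forall>x\<in>simp X m.
        act X l m (compose {..l} \<theta> \<phi>) x = act X l n \<phi> (act X n m \<theta> x))"

definition sset_map :: "'a sset \<Rightarrow> 'b sset \<Rightarrow> (nat \<Rightarrow> 'a \<Rightarrow> 'b) \<Rightarrow> bool" where
  "sset_map X Y f \<longleftrightarrow> is_sset X \<and> is_sset Y \<and>
     (\<forall>n. f n \<in> simp X n \<rightarrow>\<^sub>E simp Y n) \<and>
     (\<forall>n m. \<forall>\<theta>\<in>Delta n m. \<forall>x\<in>simp X m. f n (act X n m \<theta> x) = act Y n m \<theta> (f m x))"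

definition disc_sset :: "'a set \<Rightarrow> 'a sset" where
  "disc_sset S = \<lparr>simp = (\<lambda>n. S), act = (\<lambda>n m \<theta> x. x)\<rparr>"

definition sset_coprod :: "'a sset \<Rightarrow> 'b sset \<Rightarrow> ('a + 'b) sset" where
  "sset_coprod X Y = \<lparr>simp = (\<lambda>n. simp X n <+> simp Y n),
     act = (\<lambda>n m \<theta>. map_sum (act X n m \<theta>) (act Y n m \<theta>))\<rparr>"

definition sset_prod :: "'a sset \<Rightarrow> 'b sset \<Rightarrow> ('a \<times> 'b) sset" where
  "sset_prod X Y = \<lparr>simp = (\<lambda>n. simp X n \<times> simp Y n),
     act = (\<lambda>n m \<theta>. map_prod (act X n m \<theta>) (act Y n m \<theta>))\<rparr>"

definition sset_pullback ::
    "'a sset \<Rightarrow> 'b sset \<Rightarrow> (nat \<Rightarrow> 'a \<Rightarrow> 'c) \<Rightarrow> (nat \<Rightarrow> 'b \<Rightarrow> 'c) \<Rightarrow> ('a \<times> 'b) sset" where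
  "sset_pullback X Y f g =
     \<lparr>simp = (\<lambda>n. {(x, y) \<in> simp X n \<times> simp Y n. f n x = g n y}), act = act (sset_prod X Y)\<rparr>"

definition std :: "nat \<Rightarrow> (nat \<Rightarrow> nat) sset" where
  "std m = \<lparr>simp = (\<lambda>n. Delta n m), act = (\<lambda>l n \<phi> \<theta>. compose {..l} \<theta> \<phi>)\<rparr>"

definition bdry :: "nat \<Rightarrow> (nat \<Rightarrow> nat) sset" where
  "bdry m = \<lparr>simp = (\<lambda>n. {\<theta> \<in> Delta n m. \<theta> ` {..n} \<noteq> {..m}}), act = act (std m)\<rparr>"

definition horn :: "nat \<Rightarrow> nat \<Rightarrow> (nat \<Rightarrow> nat) sset" where
  "horn m k =
     \<lparr>simp = (\<lambda>n. {\<theta> \<in> Delta n m. \<theta> ` {..n} \<union> {k} \<noteq> {..m}}), act = act (std m)\<rparr>"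

definition spine :: "nat \<Rightarrow> (nat \<Rightarrow> nat) sset" where
  "spine m =
     \<lparr>simp = (\<lambda>n. {\<theta> \<in> Delta n m. \<exists>i<m. \<theta> ` {..n} \<subseteq> {i, Suc i}}), act = act (std m)\<rparr>"

definition kan_fibration :: "'a sset \<Rightarrow> 'b sset \<Rightarrow> (nat \<Rightarrow> 'a \<Rightarrow> 'b) \<Rightarrow> bool" where
  "kan_fibration X Y p \<longleftrightarrow> sset_map X Y p \<and>
     (\<forall>m\<ge>1. \<forall>k\<le>m. \<forall>u v. sset_map (horn m k) X u \<and> sset_map (std m) Y v \<and>
        (\<forall>n. \<forall>\<theta>\<in>simp (horn m k) n. p n (u n \<theta>) = v n \<theta>) \<longrightarrow>
        (\<exists>w. sset_map (std m) X w \<and>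
             (\<forall>n. \<forall>\<theta>\<in>simp (horn m k) n. w n \<theta> = u n \<theta>) \<and>
             (\<forall>n. \<forall>\<theta>\<in>simp (std m) n. p n (w n \<theta>) = v n \<theta>)))"

definition pi0_rel :: "'a sset \<Rightarrow> ('a \<times> 'a) set" where
  "pi0_rel X =
     (let R = {(act X 0 1 (coface 0 1) e, act X 0 1 (coface 0 0) e) | e. e \<in> simp X 1}
      in (R \<union> R\<inverse>)\<^sup>*)"

definition pi0 :: "'a sset \<Rightarrow> 'a set set" where
  "pi0 X = simp X 0 // pi0_rel X"


subsection \<open>Weak equivalences via geometric realisation\<close>

definition simplex_push :: "nat \<Rightarrow> (nat \<Rightarrow> nat) \<Rightarrow> (nat \<Rightarrow> real) \<Rightarrow> nat \<Rightarrow> real" where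
  "simplex_push n \<theta> t = (\<lambda>i. \<Sum>j\<in>{j. j \<le> n \<and> \<theta> j = i}. t j)"

definition cells :: "'a sset \<Rightarrow> (nat \<times> 'a \<times> (nat \<Rightarrow> real)) topology" where
  "cells X = sum_topology
     (\<lambda>n. prod_topology (discrete_topology (simp X n))
                        (subtopology (powertop_real UNIV) (standard_simplex n))) UNIV"

definition glue ::
    "'a sset \<Rightarrow> ((nat \<times> 'a \<times> (nat \<Rightarrow> real)) \<times> (nat \<times> 'a \<times> (nat \<Rightarrow> real))) set" where
  "glue X =
     (let R = {((n, act X n m \<theta> x, t), (m, x, simplex_push n \<theta> t)) | n m \<theta> x t.
                 \<theta> \<in> Delta n m \<and> x \<in> simp X m \<and> t \<in> standard_simplex n}
      in (R \<union> R\<inverse>)\<^sup>*)"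

definition realisation :: "'a sset \<Rightarrow> (nat \<times> 'a \<times> (nat \<Rightarrow> real)) set topology" where
  "realisation X =
     topology (\<lambda>U. U \<subseteq> topspace (cells X) // glue X \<and> openin (cells X) (\<Union>U))"

definition realisation_map ::
    "'b sset \<Rightarrow> (nat \<Rightarrow> 'a \<Rightarrow> 'b) \<Rightarrow> (nat \<times> 'a \<times> (nat \<Rightarrow> real)) set
       \<Rightarrow> (nat \<times> 'b \<times> (nat \<Rightarrow> real)) set" where
  "realisation_map Y f c = glue Y `` ((\<lambda>(n, x, t). (n, f n x, t)) ` c)"

text \<open>\<open>pi_set n X x\<close> is the pointed set underlying \<open>\<pi>\<^sub>n(X, x)\<close>; for \<open>n = 0\<close> the source is the
  pointed \<open>0\<close>-sphere and one gets the path components. A group homomorphism is an isomorphism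
  iff it is bijective, so the group structures need not be mentioned.\<close>

definition sphere_base :: "nat \<Rightarrow> real" where
  "sphere_base = (\<lambda>i. if i = 0 then 1 else 0)"

definition pointed_maps :: "nat \<Rightarrow> 'x topology \<Rightarrow> 'x \<Rightarrow> ((nat \<Rightarrow> real) \<Rightarrow> 'x) set" where
  "pointed_maps n X x = {g. continuous_map (nsphere n) X g \<and> g sphere_base = x}"

definition pointed_homotopic ::
    "nat \<Rightarrow> 'x topology \<Rightarrow> 'x \<Rightarrow> (((nat \<Rightarrow> real) \<Rightarrow> 'x) \<times> ((nat \<Rightarrow> real) \<Rightarrow> 'x)) set" where
  "pointed_homotopic n X x =
     {(g, h). homotopic_with (\<lambda>k. k sphere_base = x) (nsphere n) X g h}"

definition pi_set :: "nat \<Rightarrow> 'x topology \<Rightarrow> 'x \<Rightarrow> ((nat \<Rightarrow> real) \<Rightarrow> 'x) set set" where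
  "pi_set n X x = pointed_maps n X x // pointed_homotopic n X x"

definition weak_homotopy_equivalence :: "'x topology \<Rightarrow> 'y topology \<Rightarrow> ('x \<Rightarrow> 'y) \<Rightarrow> bool" where
  "weak_homotopy_equivalence X Y f \<longleftrightarrow>
     continuous_map X Y f \<and> (topspace X = {} \<longrightarrow> topspace Y = {}) \<and>
     (\<forall>x\<in>topspace X. \<forall>n.
        bij_betw (\<lambda>c. pointed_homotopic n Y (f x) `` ((\<lambda>g. f \<circ> g) ` c))
                 (pi_set n X x) (pi_set n Y (f x)))"

definition weak_equivalence :: "'a sset \<Rightarrow> 'b sset \<Rightarrow> (nat \<Rightarrow> 'a \<Rightarrow> 'b) \<Rightarrow> bool" where
  "weak_equivalence X Y f \<longleftrightarrow> sset_map X Y f \<and>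
     weak_homotopy_equivalence (realisation X) (realisation Y) (realisation_map Y f)"


section \<open>Simplicial spaces\<close>

text \<open>\<open>level X m\<close> is \<open>X\<^sub>m\<close>, and \<open>hact X n m \<theta>\<close> is the map \<open>X\<^sub>m \<rightarrow> X\<^sub>n\<close> of simplicial sets induced
  by \<open>\<theta>: [n] \<rightarrow> [m]\<close>.\<close>

record 'a sspace =
  level :: "nat \<Rightarrow> 'a sset"
  hact :: "nat \<Rightarrow> nat \<Rightarrow> (nat \<Rightarrow> nat) \<Rightarrow> nat \<Rightarrow> 'a \<Rightarrow> 'a"

definition pts :: "'a sspace \<Rightarrow> nat \<Rightarrow> nat \<Rightarrow> 'a set" where
  "pts X m n = simp (level X m) n"

definition is_sspace :: "'a sspace \<Rightarrow> bool" where
  "is_sspace X \<longleftrightarrow>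
     (\<forall>n m. \<forall>\<theta>\<in>Delta n m.
        sset_map (level X m) (level X n) (\<lambda>k. restrict (hact X n m \<theta> k) (pts X m k))) \<and>
     (\<forall>n k. \<forall>x\<in>pts X n k. hact X n n (\<lambda>j\<in>{..n}. j) k x = x) \<and>
     (\<forall>l n m k. \<forall>\<phi>\<in>Delta l n. \<forall>\<theta>\<in>Delta n m. \<forall>x\<in>pts X m k.
        hact X l m (compose {..l} \<theta> \<phi>) k x = hact X l n \<phi> k (hact X n m \<theta> k x))"

definition sspace_map :: "'a sspace \<Rightarrow> 'b sspace \<Rightarrow> (nat \<Rightarrow> nat \<Rightarrow> 'a \<Rightarrow> 'b) \<Rightarrow> bool" where
  "sspace_map X Y f \<longleftrightarrow> is_sspace X \<and> is_sspace Y \<and>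
     (\<forall>m. sset_map (level X m) (level Y m) (f m)) \<and>
     (\<forall>n m k. \<forall>\<theta>\<in>Delta n m. \<forall>x\<in>pts X m k. f n k (hact X n m \<theta> k x) = hact Y n m \<theta> k (f m k x))"

definition sspace_comp ::
    "'a sspace \<Rightarrow> (nat \<Rightarrow> nat \<Rightarrow> 'b \<Rightarrow> 'c) \<Rightarrow> (nat \<Rightarrow> nat \<Rightarrow> 'a \<Rightarrow> 'b) \<Rightarrow> nat \<Rightarrow> nat \<Rightarrow> 'a \<Rightarrow> 'c" where
  "sspace_comp X g f = (\<lambda>m n. compose (pts X m n) (g m n) (f m n))"

text \<open>A simplicial set gives two simplicial spaces: \<open>hdisc A\<close> is levelwise discrete, with
  \<open>(hdisc A)\<^sub>m\<close> the set \<open>A\<^sub>m\<close>, and \<open>const_sspace A\<close> is constant at the space \<open>A\<close>.\<close>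

definition hdisc :: "'a sset \<Rightarrow> 'a sspace" where
  "hdisc A = \<lparr>level = (\<lambda>m. disc_sset (simp A m)), hact = (\<lambda>n m \<theta> k. act A n m \<theta>)\<rparr>"

definition const_sspace :: "'a sset \<Rightarrow> 'a sspace" where
  "const_sspace A = \<lparr>level = (\<lambda>m. A), hact = (\<lambda>n m \<theta> k x. x)\<rparr>"

definition sspace_prod :: "'a sspace \<Rightarrow> 'b sspace \<Rightarrow> ('a \<times> 'b) sspace" where
  "sspace_prod X Y = \<lparr>level = (\<lambda>m. sset_prod (level X m) (level Y m)),
     hact = (\<lambda>n m \<theta> k. map_prod (hact X n m \<theta> k) (hact Y n m \<theta> k))\<rparr>"

definition point :: "unit sspace" where
  "point = const_sspace (disc_sset {()})"

definition MapS ::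
    "'k sspace \<Rightarrow> 'a sspace \<Rightarrow> (nat \<Rightarrow> nat \<Rightarrow> 'k \<times> (nat \<Rightarrow> nat) \<Rightarrow> 'a) sset" where
  "MapS K X =
     \<lparr>simp = (\<lambda>n. {\<phi>. sspace_map (sspace_prod K (const_sspace (std n))) X \<phi>}),
      act = (\<lambda>n m \<theta> \<phi> k l. \<lambda>(x, \<tau>)\<in>pts K k l \<times> Delta l n. \<phi> k l (x, compose {..l} \<theta> \<tau>))\<rparr>"

text \<open>For \<open>K \<subseteq> F[m]\<close>, the map \<open>X\<^sub>m \<cong> Map(F[m], X) \<rightarrow> Map(K, X)\<close> given by restriction.\<close>

definition restr_to ::
    "(nat \<Rightarrow> nat) sspace \<Rightarrow> 'a sspace \<Rightarrow> nat \<Rightarrow> nat \<Rightarrow> 'a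
       \<Rightarrow> nat \<Rightarrow> nat \<Rightarrow> (nat \<Rightarrow> nat) \<times> (nat \<Rightarrow> nat) \<Rightarrow> 'a" where
  "restr_to K X m n = (\<lambda>x\<in>pts X m n. \<lambda>k l. \<lambda>(\<theta>, \<tau>)\<in>pts K k l \<times> Delta l n.
     hact X k m \<theta> l (act (level X m) l n \<tau> x))"

definition reedy_fibration :: "'a sspace \<Rightarrow> 'b sspace \<Rightarrow> (nat \<Rightarrow> nat \<Rightarrow> 'a \<Rightarrow> 'b) \<Rightarrow> bool" where
  "reedy_fibration X Y f \<longleftrightarrow> sspace_map X Y f \<and>
     (\<forall>m. let dF = hdisc (bdry m) in
        kan_fibration (level X m)
          (sset_pullback (level Y m) (MapS dF X) (restr_to dF Y m)
             (\<lambda>n. sspace_comp (sspace_prod dF (const_sspace (std n))) f))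
          (\<lambda>n. \<lambda>x\<in>pts X m n. (f m n x, restr_to dF X m n x)))"

definition segal_space :: "'a sspace \<Rightarrow> bool" where
  "segal_space X \<longleftrightarrow> is_sspace X \<and>
     reedy_fibration X point (\<lambda>m n. \<lambda>x\<in>pts X m n. ()) \<and>
     (\<forall>m\<ge>2. weak_equivalence (level X m) (MapS (hdisc (spine m)) X)
                (restr_to (hdisc (spine m)) X m))"

definition map_space :: "'a sspace \<Rightarrow> 'a \<Rightarrow> 'a \<Rightarrow> 'a sset" where
  "map_space X x y =
     \<lparr>simp = (\<lambda>n. {f \<in> pts X 1 n.
                 hact X 0 1 (coface 0 1) n f = act (level X 0) n 0 (const0 n) x \<and>
                 hact X 0 1 (coface 0 0) n f = act (level X 0) n 0 (const0 n) y}),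
      act = act (level X 1)\<rparr>"

text \<open>An arrow \<open>x \<rightarrow> y\<close> of \<open>ho X\<close> is a triple \<open>(x, y, a)\<close> with \<open>a\<close> a component of \<open>map\<^sub>X(x, y)\<close>.
  The composite of \<open>a\<close> and \<open>b\<close> is the component of \<open>d\<^sub>1 \<sigma>\<close> for any \<open>\<sigma> \<in> X\<^sub>2\<^sub>,\<^sub>0\<close> with
  \<open>d\<^sub>2 \<sigma> \<in> a\<close> and \<open>d\<^sub>0 \<sigma> \<in> b\<close>; for a Segal space such \<open>\<sigma>\<close> exist and all give the same component.\<close>

definition ho :: "'a sspace \<Rightarrow> ('a, 'a \<times> 'a \<times> 'a set) category" where
  "ho X = \<lparr>Obj = pts X 0 0,
     Arr = {(x, y, a). x \<in> pts X 0 0 \<and> y \<in> pts X 0 0 \<and> a \<in> pi0 (map_space X x y)},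
     Dom = (\<lambda>(x, y, a). x), Cod = (\<lambda>(x, y, a). y),
     Ident = (\<lambda>x. (x, x, pi0_rel (map_space X x x) `` {hact X 1 0 (const0 1) 0 x})),
     Comp = (\<lambda>(y', z, b) (x, y, a).
       (x, z, pi0_rel (map_space X x z) ``
          {hact X 1 2 (coface 1 1) 0 \<sigma> | \<sigma>. \<sigma> \<in> pts X 2 0 \<and>
             hact X 1 2 (coface 1 2) 0 \<sigma> \<in> a \<and> hact X 1 2 (coface 1 0) 0 \<sigma> \<in> b}))\<rparr>"

definition ho_map :: "'a sspace \<Rightarrow> 'b sspace \<Rightarrow> (nat \<Rightarrow> nat \<Rightarrow> 'a \<Rightarrow> 'b)
    \<Rightarrow> ('a, 'a \<times> 'a \<times> 'a set, 'b, 'b \<times> 'b \<times> 'b set) fctr" where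
  "ho_map X Y f = \<lparr>FDom = ho X, FCod = ho Y, FObj = f 0 0,
     FArr = (\<lambda>(x, y, a)\<in>Arr (ho X).
       (f 0 0 x, f 0 0 y, pi0_rel (map_space Y (f 0 0 x) (f 0 0 y)) `` (f 1 0 ` a)))\<rparr>"

definition dk_equivalence :: "'a sspace \<Rightarrow> 'b sspace \<Rightarrow> (nat \<Rightarrow> nat \<Rightarrow> 'a \<Rightarrow> 'b) \<Rightarrow> bool" where
  "dk_equivalence X Y f \<longleftrightarrow>
     segal_space X \<and> segal_space Y \<and> sspace_map X Y f \<and>
     (\<forall>x\<in>pts X 0 0. \<forall>y\<in>pts X 0 0.
        weak_equivalence (map_space X x y) (map_space Y (f 0 0 x) (f 0 0 y))
          (\<lambda>n. restrict (f 1 n) (simp (map_space X x y) n))) \<and>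
     essentially_surjective (ho_map X Y f)"

definition segal_isofibration ::
    "'a sspace \<Rightarrow> 'b sspace \<Rightarrow> (nat \<Rightarrow> nat \<Rightarrow> 'a \<Rightarrow> 'b) \<Rightarrow> bool" where
  "segal_isofibration X Y f \<longleftrightarrow>
     segal_space X \<and> segal_space Y \<and> reedy_fibration X Y f \<and> is_isofibration (ho_map X Y f)"


section \<open>The categories \<open>SSp\<close> of simplicial spaces and \<open>CAT\<close> of small categories\<close>

text \<open>The type \<open>'u\<close> is the universe: a set is small if it is (in bijection with) a subset of \<open>'u\<close>.
  A map of simplicial spaces is tagged with its source and target.\<close>

type_synonym 'u sspace_arr = "'u sspace \<times> 'u sspace \<times> (nat \<Rightarrow> nat \<Rightarrow> 'u \<Rightarrow> 'u)"

definition SSp :: "('u sspace, 'u sspace_arr) category" where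
  "SSp = \<lparr>Obj = {X. is_sspace X}, Arr = {(X, Y, f). sspace_map X Y f},
     Dom = (\<lambda>(X, Y, f). X), Cod = (\<lambda>(X, Y, f). Y),
     Ident = (\<lambda>X. (X, X, \<lambda>m n. \<lambda>x\<in>pts X m n. x)),
     Comp = (\<lambda>(Y', Z, g) (X, Y, f). (X, Z, sspace_comp X g f))\<rparr>"

type_synonym 'u cat = "('u, 'u) category"
type_synonym 'u cat_arr = "('u, 'u, 'u, 'u) fctr"

definition CAT :: "('u cat, 'u cat_arr) category" where
  "CAT = \<lparr>Obj = {C. is_category C}, Arr = {F. is_functor F},
     Dom = FDom, Cod = FCod, Ident = fid, Comp = functor_comp\<rparr>"

definition categorical_model_structure :: "'u cat_arr model \<Rightarrow> bool" where
  "categorical_model_structure M \<longleftrightarrow> model_structure CAT M \<and>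
     Weq M = {F \<in> Arr CAT. is_equivalence F} \<and> Fib M = {F \<in> Arr CAT. is_isofibration F}"

text \<open>The set \<open>S\<close> below injects into \<open>\<pi>\<^sub>0(Y\<^sub>0)\<close>, hence can be taken in the same universe.\<close>

definition cat_cofibration :: "'u sspace_arr \<Rightarrow> bool" where
  "cat_cofibration = (\<lambda>(X, Y, f). monic SSp (X, Y, f) \<and>
     (\<exists>(S :: 'u set) g.
        weak_equivalence (sset_coprod (level X 0) (disc_sset S)) (level Y 0) g \<and>
        (\<forall>n. \<forall>x\<in>pts X 0 n. g n (Inl x) = f 0 n x)))"

definition sspace_Cat_model_structure :: "'u sspace_arr model \<Rightarrow> bool" where
  "sspace_Cat_model_structure M \<longleftrightarrow> model_structure SSp M \<and>
     Cof M = {f \<in> Arr SSp. cat_cofibration f} \<and>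
     (\<forall>X\<in>Obj SSp. fibrant SSp M X \<longleftrightarrow> segal_space X) \<and>
     (\<forall>X Y f. (X, Y, f) \<in> Arr SSp \<and> segal_space X \<and> segal_space Y \<longrightarrow>
        ((X, Y, f) \<in> Weq M \<longleftrightarrow> dk_equivalence X Y f) \<and>
        ((X, Y, f) \<in> Fib M \<longleftrightarrow> segal_isofibration X Y f))"


section \<open>The nerve\<close>

definition ord_cat :: "nat \<Rightarrow> (nat, nat \<times> nat) category" where
  "ord_cat m = \<lparr>Obj = {..m}, Arr = {(i, j). i \<le> j \<and> j \<le> m}, Dom = fst, Cod = snd,
     Ident = (\<lambda>i. (i, i)), Comp = (\<lambda>g f. (fst f, snd g))\<rparr>"

definition ord_fctr :: "nat \<Rightarrow> nat \<Rightarrow> (nat \<Rightarrow> nat) \<Rightarrow> (nat, nat \<times> nat, nat, nat \<times> nat) fctr" where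
  "ord_fctr n m \<theta> = \<lparr>FDom = ord_cat n, FCod = ord_cat m, FObj = \<theta>,
     FArr = (\<lambda>(i, j)\<in>Arr (ord_cat n). (\<theta> i, \<theta> j))\<rparr>"

definition nerve :: "('o, 'a) category \<Rightarrow> (nat, nat \<times> nat, 'o, 'a) fctr sspace" where
  "nerve C = hdisc \<lparr>simp = (\<lambda>m. functors (ord_cat m) C),
                    act = (\<lambda>n m \<theta> x. functor_comp x (ord_fctr n m \<theta>))\<rparr>"

definition nerve_map :: "('o, 'a, 'p, 'b) fctr \<Rightarrow> nat \<Rightarrow> nat
    \<Rightarrow> (nat, nat \<times> nat, 'o, 'a) fctr \<Rightarrow> (nat, nat \<times> nat, 'p, 'b) fctr" where
  "nerve_map F = (\<lambda>m n. \<lambda>x\<in>pts (nerve (FDom F)) m n. functor_comp F x)"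

text \<open>For a category \<open>C\<close> carried by an infinite type \<open>'u\<close>, each set \<open>Cat([m], C)\<close> has at most as
  many elements as \<open>'u\<close>, but they are not elements of \<open>'u\<close>. To obtain an object of \<open>SSp\<close> we
  transport the nerve along arbitrary (chosen) injections into \<open>'u\<close>.\<close>

definition encode :: "'b sspace \<Rightarrow> nat \<Rightarrow> nat \<Rightarrow> 'b \<Rightarrow> 'u" where
  "encode X = (SOME e. \<forall>m n. inj_on (e m n) (pts X m n))"

definition decode :: "'b sspace \<Rightarrow> nat \<Rightarrow> nat \<Rightarrow> 'u \<Rightarrow> 'b" where
  "decode X m n = inv_into (pts X m n) (encode X m n)"

definition small_copy :: "'b sspace \<Rightarrow> 'u sspace" where
  "small_copy X = \<lparr>
     level = (\<lambda>m. \<lparr>simp = (\<lambda>n. encode X m n ` pts X m n),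
                    act = (\<lambda>k n \<tau> u. encode X m k (act (level X m) k n \<tau> (decode X m n u)))\<rparr>),
     hact = (\<lambda>l m \<theta> n u. encode X l n (hact X l m \<theta> n (decode X m n u)))\<rparr>"

definition small_copy_map ::
    "'b sspace \<Rightarrow> 'c sspace \<Rightarrow> (nat \<Rightarrow> nat \<Rightarrow> 'b \<Rightarrow> 'c) \<Rightarrow> nat \<Rightarrow> nat \<Rightarrow> 'u \<Rightarrow> 'u" where
  "small_copy_map X Y f = (\<lambda>m n. \<lambda>u\<in>pts (small_copy X :: 'u sspace) m n.
     encode Y m n (f m n (decode X m n u)))"

definition Nerve :: "('u cat, 'u cat_arr, 'u sspace, 'u sspace_arr) fctr" where
  "Nerve = \<lparr>FDom = CAT, FCod = SSp,
     FObj = (\<lambda>C\<in>Obj CAT. small_copy (nerve C)),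
     FArr = (\<lambda>F\<in>Arr CAT. (small_copy (nerve (FDom F)), small_copy (nerve (FCod F)),
               small_copy_map (nerve (FDom F)) (nerve (FCod F)) (nerve_map F)))\<rparr>"

end

theory Submission
  imports Defs
begin

text \<open>Left adjoints preserve (trivial) cofibrations as soon as their right adjoints preserve (trivial)
  fibrations, because in a model category these classes are determined by lifting properties. All
  spaces in a nerve are discrete, so every map between nerves is a Reedy fibration, and since
  \<open>ho (N C) \<cong> C\<close> and \<open>map\<^bsub>N C\<^esub>(x, y) \<cong> C(x, y)\<close>, the nerve of an isofibration is an isofibration and
  the nerve of an equivalence is a Dwyer--Kan equivalence.

  As \<open>(N C)\<^sub>0\<close> is a set, \<open>N C\<close> is cofibrant. Hence, by Ken Brown's lemma, \<open>c\<close> sends a cofibrant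
  replacement \<open>Q \<rightarrow> N C\<close> to an equivalence, and the derived counit at \<open>C\<close> is the composite of this
  equivalence with the counit \<open>c (N C) \<rightarrow> C\<close>, which is invertible since \<open>N\<close> is fully faithful.\<close>


section \<open>Elementary category theory\<close>

text \<open>The adjunction is given abstractly, so \<open>c\<close> is never computed: only its
  functoriality, the naturality of unit and counit and the triangle identities are used. What shapes
  the proof is that objects of \<open>SSp\<close> live in the universe \<open>'u\<close>. The codes
  chosen by \<open>encode\<close> may change with the space degree, so the space direction of an
  encoded nerve acts by bijections that need not be identities. Discreteness is therefore replaced
  by \<open>constant_sset\<close>, and the locale \<open>nerve_like\<close> records what survives
  the encoding. Defining weak equivalences through realisations then costs little: a map of constant
  simplicial sets that is bijective on vertices is bijective in every degree and realises to a
  homeomorphism. Infinity of \<open>'u\<close> enters twice: finite strings of objects and arrows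
  must be encoded injectively, and the coproduct of \<open>Q\<close> and \<open>N C\<close> that Ken
  Brown's lemma calls for must again fit into \<open>'u\<close>.\<close>

lemma HomD:
  assumes "f \<in> Hom C x y"
  shows "f \<in> Arr C" "Dom C f = x" "Cod C f = y"
  using assms by (auto simp: Hom_def)

lemma Hom_Obj:
  assumes "is_category C" "f \<in> Hom C x y"
  shows "x \<in> Obj C" "y \<in> Obj C"
  using assms by (auto simp: Hom_def is_category_def)

lemma ident_Hom: "is_category C \<Longrightarrow> x \<in> Obj C \<Longrightarrow> Ident C x \<in> Hom C x x"
  by (simp add: is_category_def)

lemma comp_Hom:
  "is_category C \<Longrightarrow> f \<in> Hom C x y \<Longrightarrow> g \<in> Hom C y z \<Longrightarrow> Comp C g f \<in> Hom C x z"
  unfolding is_category_def Hom_def by auto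

lemma comp_assoc:
  "is_category C \<Longrightarrow> f \<in> Hom C w x \<Longrightarrow> g \<in> Hom C x y \<Longrightarrow> h \<in> Hom C y z \<Longrightarrow>
     Comp C h (Comp C g f) = Comp C (Comp C h g) f"
  unfolding is_category_def Hom_def by auto

lemma comp_ident_right: "is_category C \<Longrightarrow> f \<in> Hom C x y \<Longrightarrow> Comp C f (Ident C x) = f"
  unfolding is_category_def Hom_def by auto

lemma comp_ident_left: "is_category C \<Longrightarrow> f \<in> Hom C x y \<Longrightarrow> Comp C (Ident C y) f = f"
  unfolding is_category_def Hom_def by auto

lemma is_isoE:
  assumes "is_iso C f" "f \<in> Hom C x y"
  obtains g where "g \<in> Hom C y x" "Comp C g f = Ident C x" "Comp C f g = Ident C y"
  using assms unfolding is_iso_def Hom_def by blast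

lemma is_isoI:
  assumes "f \<in> Hom C x y" "g \<in> Hom C y x" "Comp C g f = Ident C x" "Comp C f g = Ident C y"
  shows "is_iso C f"
  using assms unfolding is_iso_def Hom_def by auto

lemma iso_cancel_left:
  assumes C: "is_category C" and i: "is_iso C i" "i \<in> Hom C y z"
    and f: "f \<in> Hom C x y" and g: "g \<in> Hom C x y" and eq: "Comp C i f = Comp C i g"
  shows "f = g"
proof -
  obtain j where j: "j \<in> Hom C z y" "Comp C j i = Ident C y" using i by (rule is_isoE)
  have "Comp C j (Comp C i f) = f" "Comp C j (Comp C i g) = g"
    using comp_assoc[OF C f i(2) j(1)] comp_assoc[OF C g i(2) j(1)] j(2)
      comp_ident_left[OF C f] comp_ident_left[OF C g] by auto
  with eq show ?thesis by metis
qed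

lemma iso_cancel_right:
  assumes C: "is_category C" and i: "is_iso C i" "i \<in> Hom C w x"
    and f: "f \<in> Hom C x y" and g: "g \<in> Hom C x y" and eq: "Comp C f i = Comp C g i"
  shows "f = g"
proof -
  obtain j where j: "j \<in> Hom C x w" "Comp C i j = Ident C x" using i by (rule is_isoE)
  have "Comp C (Comp C f i) j = f" "Comp C (Comp C g i) j = g"
    using comp_assoc[OF C j(1) i(2) f] comp_assoc[OF C j(1) i(2) g] j(2)
      comp_ident_right[OF C f] comp_ident_right[OF C g] by auto
  with eq show ?thesis by metis
qed

lemma functor_Hom:
  assumes "is_functor F" "f \<in> Hom (FDom F) x y"
  shows "FArr F f \<in> Hom (FCod F) (FObj F x) (FObj F y)"
  using assms unfolding is_functor_def Hom_def by auto

lemma functor_Obj: "is_functor F \<Longrightarrow> x \<in> Obj (FDom F) \<Longrightarrow> FObj F x \<in> Obj (FCod F)"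
  unfolding is_functor_def by auto

lemma functor_pres_comp:
  assumes "is_functor F" "f \<in> Hom (FDom F) x y" "g \<in> Hom (FDom F) y z"
  shows "FArr F (Comp (FDom F) g f) = Comp (FCod F) (FArr F g) (FArr F f)"
  using assms unfolding is_functor_def Hom_def by auto

lemma functor_pres_ident:
  "is_functor F \<Longrightarrow> x \<in> Obj (FDom F) \<Longrightarrow> FArr F (Ident (FDom F) x) = Ident (FCod F) (FObj F x)"
  unfolding is_functor_def by auto

lemma functor_cats: "is_functor F \<Longrightarrow> is_category (FDom F)" "is_functor F \<Longrightarrow> is_category (FCod F)"
  unfolding is_functor_def by auto


section \<open>Lifting properties in model categories\<close>

lemma has_liftsI:
  assumes "i \<in> Hom C a b" "p \<in> Hom C x y"
    and "\<And>u v. u \<in> Hom C a x \<Longrightarrow> v \<in> Hom C b y \<Longrightarrow> Comp C p u = Comp C v i \<Longrightarrow>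
      \<exists>h\<in>Hom C b x. Comp C h i = u \<and> Comp C p h = v"
  shows "has_lifts C i p"
  using assms unfolding has_lifts_def Hom_def by auto

lemma has_liftsE:
  assumes "has_lifts C i p" "i \<in> Hom C a b" "p \<in> Hom C x y"
    and "u \<in> Hom C a x" "v \<in> Hom C b y" "Comp C p u = Comp C v i"
  obtains h where "h \<in> Hom C b x" "Comp C h i = u" "Comp C p h = v"
  using assms unfolding has_lifts_def Hom_def by auto

text \<open>Lifting in the square with top \<open>i\<close> and bottom the identity gives a section
  \<open>h\<close> of \<open>p\<close> with \<open>Comp C h (Comp C p i) = i\<close>. The identity
  of \<open>a\<close> together with \<open>h\<close>, followed by the identity together with
  \<open>p\<close>, is the required retraction.\<close>

lemma retract_argument:
  assumes C: "is_category C" and i: "i \<in> Hom C a e" and p: "p \<in> Hom C e b"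
    and lift: "has_lifts C (Comp C p i) p"
  shows "is_retract C (Comp C p i) i"
proof -
  let ?f = "Comp C p i"
  have f: "?f \<in> Hom C a b" using C i p by (rule comp_Hom)
  have ob: "a \<in> Obj C" "b \<in> Obj C" using Hom_Obj[OF C f] by auto
  have "Comp C p i = Comp C (Ident C b) ?f" using comp_ident_left[OF C f] by simp
  then obtain h where h: "h \<in> Hom C b e" "Comp C h ?f = i" "Comp C p h = Ident C b"
    using has_liftsE[OF lift f p i ident_Hom[OF C ob(2)]] by blast
  have da: "Ident C a \<in> Hom C a a" using ident_Hom[OF C ob(1)] .
  show ?thesis
    unfolding is_retract_def HomD(2,3)[OF f] HomD(2,3)[OF i]
  proof (intro conjI bexI)
    show "Comp C (Ident C a) (Ident C a) = Ident C a" using comp_ident_right[OF C da] .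
    show "Comp C i (Ident C a) = Comp C h ?f" using h(2) comp_ident_right[OF C i] by simp
    show "Comp C ?f (Ident C a) = Comp C p i" by (rule comp_ident_right[OF C f])
  qed (use f i h p da in \<open>auto dest: HomD(1)\<close>)
qed

lemma model_category: "model_structure C M \<Longrightarrow> is_category C"
  unfolding model_structure_def by blast

lemma model_lifts:
  "model_structure C M \<Longrightarrow> i \<in> Cof M \<Longrightarrow> p \<in> Fib M \<Longrightarrow> i \<in> Weq M \<or> p \<in> Weq M \<Longrightarrow> has_lifts C i p"
  unfolding model_structure_def by blast

lemma model_Arr:
  assumes "model_structure C M"
  shows "Cof M \<subseteq> Arr C" "Weq M \<subseteq> Arr C" "Fib M \<subseteq> Arr C"
  using assms unfolding model_structure_def by blast+

lemma model_two_of_three: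
  assumes "model_structure C M" "f \<in> Hom C x y" "g \<in> Hom C y z"
  shows "f \<in> Weq M \<Longrightarrow> g \<in> Weq M \<Longrightarrow> Comp C g f \<in> Weq M"
    and "f \<in> Weq M \<Longrightarrow> Comp C g f \<in> Weq M \<Longrightarrow> g \<in> Weq M"
    and "g \<in> Weq M \<Longrightarrow> Comp C g f \<in> Weq M \<Longrightarrow> f \<in> Weq M"
proof -
  have "f \<in> Arr C" "g \<in> Arr C" "Cod C f = Dom C g"
    using assms(2,3) by (auto simp: Hom_def)
  then show "f \<in> Weq M \<Longrightarrow> g \<in> Weq M \<Longrightarrow> Comp C g f \<in> Weq M"
    and "f \<in> Weq M \<Longrightarrow> Comp C g f \<in> Weq M \<Longrightarrow> g \<in> Weq M"
    and "g \<in> Weq M \<Longrightarrow> Comp C g f \<in> Weq M \<Longrightarrow> f \<in> Weq M"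
    using assms(1) unfolding model_structure_def by blast+
qed

lemma model_retract:
  assumes "model_structure C M" "is_retract C f g"
  shows "g \<in> Cof M \<Longrightarrow> f \<in> Cof M" "g \<in> Weq M \<Longrightarrow> f \<in> Weq M"
  using assms unfolding model_structure_def by blast+

lemma factor_Hom:
  assumes C: "is_category C" and "i \<in> Arr C" "p \<in> Arr C" "Cod C i = Dom C p" "Comp C p i \<in> Hom C x y"
  shows "i \<in> Hom C x (Cod C i)" "p \<in> Hom C (Cod C i) y"
  using comp_Hom[OF C, of i "Dom C i" "Cod C i" p "Cod C p"] assms by (auto simp: Hom_def)

lemma model_factor_cof:
  assumes M: "model_structure C M" and f: "f \<in> Hom C x y"
  obtains i p e where "i \<in> Hom C x e" "p \<in> Hom C e y" "f = Comp C p i"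
    "i \<in> Cof M" "p \<in> Fib M" "p \<in> Weq M"
proof -
  obtain i p where ip: "i \<in> Cof M" "p \<in> Fib M \<inter> Weq M" "Cod C i = Dom C p" "f = Comp C p i"
    using M HomD(1)[OF f] unfolding model_structure_def by meson
  then show thesis using that[of i "Cod C i" p] factor_Hom[OF model_category[OF M], of i p x y] f model_Arr[OF M] by auto
qed

lemma model_factor_triv_cof:
  assumes M: "model_structure C M" and f: "f \<in> Hom C x y"
  obtains i p e where "i \<in> Hom C x e" "p \<in> Hom C e y" "f = Comp C p i"
    "i \<in> Cof M" "i \<in> Weq M" "p \<in> Fib M"
proof -
  obtain i p where ip: "i \<in> Cof M \<inter> Weq M" "p \<in> Fib M" "Cod C i = Dom C p" "f = Comp C p i"
    using M HomD(1)[OF f] unfolding model_structure_def by meson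
  then show thesis using that[of i "Cod C i" p] factor_Hom[OF model_category[OF M], of i p x y] f model_Arr[OF M] by auto
qed

text \<open>Factor \<open>f\<close> as a cofibration followed by a trivial fibration and apply the
  retract argument. Characterising cofibrations by lifting is a consequence, not an axiom, of
  \<open>model_structure\<close>.\<close>

lemma cof_by_lifts:
  assumes M: "model_structure C M" and f: "f \<in> Hom C x y"
    and lifts: "\<And>p. p \<in> Fib M \<Longrightarrow> p \<in> Weq M \<Longrightarrow> has_lifts C f p"
  shows "f \<in> Cof M"
proof -
  obtain i p e where ip: "i \<in> Hom C x e" "p \<in> Hom C e y" "f = Comp C p i"
    "i \<in> Cof M" "p \<in> Fib M" "p \<in> Weq M"
    using M f by (rule model_factor_cof)
  then show ?thesis
    using model_retract(1)[OF M retract_argument[OF model_category[OF M] ip(1,2)]] lifts by auto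
qed

text \<open>The same argument with the other factorisation: \<open>f\<close> becomes a retract of a
  trivial cofibration, and both classes are closed under retracts.\<close>

lemma triv_cof_by_lifts:
  assumes M: "model_structure C M" and f: "f \<in> Hom C x y"
    and lifts: "\<And>p. p \<in> Fib M \<Longrightarrow> has_lifts C f p"
  shows "f \<in> Cof M" "f \<in> Weq M"
proof -
  obtain i p e where ip: "i \<in> Hom C x e" "p \<in> Hom C e y" "f = Comp C p i"
    "i \<in> Cof M" "i \<in> Weq M" "p \<in> Fib M"
    using M f by (rule model_factor_triv_cof)
  then have "is_retract C f i"
    using retract_argument[OF model_category[OF M] ip(1,2)] lifts by auto
  from model_retract[OF M this] ip show "f \<in> Cof M" "f \<in> Weq M" by auto
qed

lemma iso_has_lifts:
  assumes C: "is_category C" and f: "is_iso C f" "f \<in> Hom C a b" and p: "p \<in> Hom C x y"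
  shows "has_lifts C f p"
proof (rule has_liftsI[OF f(2) p])
  fix u v assume u: "u \<in> Hom C a x" and v: "v \<in> Hom C b y" and eq: "Comp C p u = Comp C v f"
  obtain g where g: "g \<in> Hom C b a" "Comp C g f = Ident C a" "Comp C f g = Ident C b"
    using f by (rule is_isoE)
  have "Comp C (Comp C u g) f = u"
    using comp_assoc[OF C f(2) g(1) u] g(2) comp_ident_right[OF C u] by simp
  moreover have "Comp C p (Comp C u g) = v"
    using comp_assoc[OF C g(1) u p] comp_assoc[OF C g(1) f(2) v] eq g(3) comp_ident_right[OF C v]
    by simp
  ultimately show "\<exists>h\<in>Hom C b x. Comp C h f = u \<and> Comp C p h = v"
    using comp_Hom[OF C g(1) u] by blast
qed

text \<open>Not postulated in \<open>model_structure\<close>. An isomorphism lifts against every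
  arrow, in particular against every fibration, so it is a trivial cofibration.\<close>

lemma iso_Weq:
  assumes M: "model_structure C M" and f: "is_iso C f"
  shows "f \<in> Weq M"
proof -
  have h: "f \<in> Hom C (Dom C f) (Cod C f)" using f by (auto simp: is_iso_def Hom_def)
  show ?thesis
  proof (rule triv_cof_by_lifts(2)[OF M h])
    fix p assume "p \<in> Fib M"
    then have "p \<in> Hom C (Dom C p) (Cod C p)" using model_Arr[OF M] by (auto simp: Hom_def)
    then show "has_lifts C f p" by (rule iso_has_lifts[OF model_category[OF M] f h])
  qed
qed

lemma ident_Weq:
  assumes M: "model_structure C M" and x: "x \<in> Obj C"
  shows "Ident C x \<in> Weq M"
proof (rule iso_Weq[OF M])
  have "Ident C x \<in> Hom C x x" "Comp C (Ident C x) (Ident C x) = Ident C x"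
    using ident_Hom[OF model_category[OF M] x] comp_ident_left[OF model_category[OF M]] by blast+
  then show "is_iso C (Ident C x)" by (intro is_isoI) auto
qed

lemma comp_has_lifts:
  assumes C: "is_category C" and i: "i \<in> Hom C a b" and j: "j \<in> Hom C b c" and p: "p \<in> Hom C x y"
    and li: "has_lifts C i p" and lj: "has_lifts C j p"
  shows "has_lifts C (Comp C j i) p"
proof (rule has_liftsI[OF comp_Hom[OF C i j] p])
  fix u v assume u: "u \<in> Hom C a x" and v: "v \<in> Hom C c y"
    and eq: "Comp C p u = Comp C v (Comp C j i)"
  obtain h where h: "h \<in> Hom C b x" "Comp C h i = u" "Comp C p h = Comp C v j"
    using has_liftsE[OF li i p u comp_Hom[OF C j v]] eq comp_assoc[OF C i j v] by metis
  obtain k where k: "k \<in> Hom C c x" "Comp C k j = h" "Comp C p k = v"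
    using has_liftsE[OF lj j p h(1) v h(3)] by blast
  have "Comp C k (Comp C j i) = u" using comp_assoc[OF C i j k(1)] k(2) h(2) by simp
  with k show "\<exists>h\<in>Hom C c x. Comp C h (Comp C j i) = u \<and> Comp C p h = v" by blast
qed

text \<open>Closure under composition is no axiom either; it follows because lifting problems for a
  composite can be solved in two stages.\<close>

lemma comp_Cof:
  assumes M: "model_structure C M" and i: "i \<in> Hom C a b" and j: "j \<in> Hom C b c"
    and cof: "i \<in> Cof M" "j \<in> Cof M"
  shows "Comp C j i \<in> Cof M"
proof (rule cof_by_lifts[OF M comp_Hom[OF model_category[OF M] i j]])
  fix p assume p: "p \<in> Fib M" "p \<in> Weq M"
  then have "p \<in> Hom C (Dom C p) (Cod C p)" using model_Arr[OF M] by (auto simp: Hom_def)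
  then show "has_lifts C (Comp C j i) p"
    using comp_has_lifts[OF model_category[OF M] i j] model_lifts[OF M] cof p by blast
qed


section \<open>Binary coproducts and Ken Brown's lemma\<close>

definition coproduct :: "('o, 'a) category \<Rightarrow> 'a \<Rightarrow> 'a \<Rightarrow> bool" where
  "coproduct C i j \<longleftrightarrow> i \<in> Arr C \<and> j \<in> Arr C \<and> Cod C i = Cod C j \<and>
     (\<forall>z\<in>Obj C. \<forall>u\<in>Hom C (Dom C i) z. \<forall>v\<in>Hom C (Dom C j) z.
        \<exists>!h. h \<in> Hom C (Cod C i) z \<and> Comp C h i = u \<and> Comp C h j = v)"

lemma coproductE:
  assumes "coproduct C i j" "is_category C" "i \<in> Hom C a s" "j \<in> Hom C b s"
    "u \<in> Hom C a z" "v \<in> Hom C b z"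
  obtains h where "h \<in> Hom C s z" "Comp C h i = u" "Comp C h j = v"
    "\<And>k. k \<in> Hom C s z \<Longrightarrow> Comp C k i = u \<Longrightarrow> Comp C k j = v \<Longrightarrow> k = h"
proof -
  have "z \<in> Obj C" using Hom_Obj assms by metis
  moreover have "u \<in> Hom C (Dom C i) z" "v \<in> Hom C (Dom C j) z" "Cod C i = s"
    using HomD[OF assms(3)] HomD[OF assms(4)] assms(5,6) by simp_all
  ultimately have "\<exists>!h. h \<in> Hom C s z \<and> Comp C h i = u \<and> Comp C h j = v"
    using assms(1) unfolding coproduct_def by blast
  then show thesis using that by blast
qed

lemma coproduct_commute: "coproduct C i j \<Longrightarrow> coproduct C j i"
  unfolding coproduct_def by metis

lemma initial_Hom_unique:
  "initial C i \<Longrightarrow> is_category C \<Longrightarrow> f \<in> Hom C i x \<Longrightarrow> g \<in> Hom C i x \<Longrightarrow> f = g"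
  unfolding initial_def using Hom_Obj by metis

text \<open>The inclusion \<open>i\<close> is the pushout of the cofibration \<open>t\<close> from
  the initial object to \<open>b\<close>. Concretely, a lifting problem for \<open>i\<close>
  prescribes the lift on \<open>a\<close>; on \<open>b\<close> it is found by lifting against
  \<open>t\<close>, and the two pieces are glued by the coproduct.\<close>

lemma coproduct_inclusion_Cof:
  assumes M: "model_structure C M" and cop: "coproduct C i j"
    and i: "i \<in> Hom C a s" and j: "j \<in> Hom C b s" and b: "cofibrant C M b"
  shows "i \<in> Cof M"
proof (rule cof_by_lifts[OF M i])
  have C: "is_category C" by (rule model_category[OF M])
  fix p assume p: "p \<in> Fib M" "p \<in> Weq M"
  define x y where "x = Dom C p" "y = Cod C p"
  have ph: "p \<in> Hom C x y" using model_Arr[OF M] p by (auto simp: Hom_def x_y_def)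
  show "has_lifts C i p"
  proof (rule has_liftsI[OF i ph])
    fix u v assume u: "u \<in> Hom C a x" and v: "v \<in> Hom C s y" and eq: "Comp C p u = Comp C v i"
    obtain e t where e: "initial C e" and t: "t \<in> Hom C e b" "t \<in> Cof M"
      using b unfolding cofibrant_def by blast
    have vj: "Comp C v j \<in> Hom C b y" using C j v by (rule comp_Hom)
    obtain w where w: "w \<in> Hom C e x"
      using e Hom_Obj(1)[OF C ph] unfolding initial_def by blast
    have "Comp C p w = Comp C (Comp C v j) t"
      using initial_Hom_unique[OF e C comp_Hom[OF C w ph] comp_Hom[OF C t(1) vj]] .
    then obtain k where k: "k \<in> Hom C b x" "Comp C p k = Comp C v j"
      using has_liftsE[OF model_lifts[OF M t(2) p(1)] t(1) ph w vj] p by blast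
    obtain h where h: "h \<in> Hom C s x" "Comp C h i = u" "Comp C h j = k"
      using coproductE[OF cop C i j u k(1)] by blast
    obtain g where g: "\<And>k. k \<in> Hom C s y \<Longrightarrow> Comp C k i = Comp C v i \<Longrightarrow> Comp C k j = Comp C v j \<Longrightarrow> k = g"
      using coproductE[OF cop C i j comp_Hom[OF C i v] comp_Hom[OF C j v]] by metis
    \<comment> \<open>Uniqueness of maps out of the coproduct: \<open>Comp C p h\<close> and
      \<open>v\<close> have the same restrictions to both summands, so both equal
      \<open>g\<close>.\<close>
    have "Comp C p h = g"
      using g[OF comp_Hom[OF C h(1) ph]] comp_assoc[OF C i h(1) ph] comp_assoc[OF C j h(1) ph] h eq k
      by simp
    moreover have "v = g" using g[OF v] by simp
    ultimately show "\<exists>h\<in>Hom C s x. Comp C h i = u \<and> Comp C p h = v" using h by blast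
  qed
qed

text \<open>The arrow \<open>q\<close> and the identity of \<open>b\<close> define a map from the
  coproduct to \<open>b\<close>; factor it as a cofibration \<open>k\<close> followed by a trivial
  fibration \<open>p\<close>. By two out of three the restrictions \<open>ki\<close> and
  \<open>kj\<close> are trivial cofibrations, so \<open>L\<close> makes them weak equivalences. As
  \<open>kj\<close> is a section of \<open>p\<close>, also \<open>L\<close> of \<open>p\<close> is
  one, and \<open>q\<close> is the composite of \<open>ki\<close> and \<open>p\<close>. The
  coproduct is passed in because \<open>model_structure\<close> provides no colimits.\<close>

lemma Ken_Brown:
  assumes M: "model_structure (FDom L) M" and M': "model_structure (FCod L) M'"
    and L: "is_functor L" and triv: "\<And>f. f \<in> Cof M \<Longrightarrow> f \<in> Weq M \<Longrightarrow> FArr L f \<in> Weq M'"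
    and q: "q \<in> Hom (FDom L) a b" "q \<in> Weq M"
    and a: "cofibrant (FDom L) M a" and b: "cofibrant (FDom L) M b"
    and cop: "coproduct (FDom L) i j" and i: "i \<in> Hom (FDom L) a s" and j: "j \<in> Hom (FDom L) b s"
  shows "FArr L q \<in> Weq M'"
proof -
  let ?C = "FDom L" and ?D = "FCod L"
  note C = model_category[OF M]
  have ob: "b \<in> Obj ?C" using Hom_Obj[OF C q(1)] by simp
  obtain h where h: "h \<in> Hom ?C s b" "Comp ?C h i = q" "Comp ?C h j = Ident ?C b"
    using coproductE[OF cop C i j q(1) ident_Hom[OF C ob]] by blast
  obtain k p z where kp: "k \<in> Hom ?C s z" "p \<in> Hom ?C z b" "h = Comp ?C p k"
      "k \<in> Cof M" "p \<in> Fib M" "p \<in> Weq M"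
    using M h(1) by (rule model_factor_cof)
  define ki kj where "ki = Comp ?C k i" and "kj = Comp ?C k j"
  have ki: "ki \<in> Hom ?C a z" and kj: "kj \<in> Hom ?C b z"
    unfolding ki_def kj_def using comp_Hom[OF C] i j kp(1) by blast+
  have pki: "Comp ?C p ki = q" and pkj: "Comp ?C p kj = Ident ?C b"
    unfolding ki_def kj_def using comp_assoc[OF C i kp(1,2)] comp_assoc[OF C j kp(1,2)] h kp(3) by auto
  have "ki \<in> Cof M"
    unfolding ki_def by (rule comp_Cof[OF M i kp(1) coproduct_inclusion_Cof[OF M cop i j b] kp(4)])
  moreover have "kj \<in> Cof M" unfolding kj_def
    by (rule comp_Cof[OF M j kp(1) coproduct_inclusion_Cof[OF M coproduct_commute[OF cop] j i a] kp(4)])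
  moreover have "ki \<in> Weq M" using model_two_of_three(3)[OF M ki kp(2) kp(6)] pki q(2) by simp
  moreover have "kj \<in> Weq M"
    using model_two_of_three(3)[OF M kj kp(2) kp(6)] pkj ident_Weq[OF M ob] by simp
  ultimately have W: "FArr L ki \<in> Weq M'" "FArr L kj \<in> Weq M'" using triv by auto
  have "Comp ?D (FArr L p) (FArr L kj) = Ident ?D (FObj L b)"
    using functor_pres_comp[OF L kj kp(2)] functor_pres_ident[OF L ob] pkj by simp
  then have "Comp ?D (FArr L p) (FArr L kj) \<in> Weq M'"
    using ident_Weq[OF M' functor_Obj[OF L ob]] by simp
  then have "FArr L p \<in> Weq M'"
    by (rule model_two_of_three(2)[OF M' functor_Hom[OF L kj] functor_Hom[OF L kp(2)] W(2)])
  then have "Comp ?D (FArr L p) (FArr L ki) \<in> Weq M'"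
    by (rule model_two_of_three(1)[OF M' functor_Hom[OF L ki] functor_Hom[OF L kp(2)] W(1)])
  then show ?thesis using functor_pres_comp[OF L ki kp(2)] pki by simp
qed


section \<open>Adjunctions\<close>

lemma nat_transD:
  assumes "nat_trans F G t"
  shows "x \<in> Obj (FDom F) \<Longrightarrow> t x \<in> Hom (FCod F) (FObj F x) (FObj G x)"
    and "f \<in> Hom (FDom F) x y \<Longrightarrow>
      Comp (FCod F) (t y) (FArr F f) = Comp (FCod F) (FArr G f) (t x)"
  using assms unfolding nat_trans_def Hom_def by blast+

lemma fid_simps [simp]:
  "FDom (fid C) = C" "FCod (fid C) = C"
  "x \<in> Obj C \<Longrightarrow> FObj (fid C) x = x" "f \<in> Arr C \<Longrightarrow> FArr (fid C) f = f"
  by (auto simp: fid_def)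

lemma functor_comp_simps [simp]:
  "FDom (functor_comp G F) = FDom F" "FCod (functor_comp G F) = FCod G"
  "x \<in> Obj (FDom F) \<Longrightarrow> FObj (functor_comp G F) x = FObj G (FObj F x)"
  "f \<in> Arr (FDom F) \<Longrightarrow> FArr (functor_comp G F) f = FArr G (FArr F f)"
  by (auto simp: functor_comp_def compose_def)

context
  fixes L :: "('o, 'a, 'p, 'b) fctr" and R :: "('p, 'b, 'o, 'a) fctr" and \<eta> \<epsilon>
  assumes adj: "adjunction L R \<eta> \<epsilon>"
begin

lemma adjunction_functors:
  shows "is_functor L" "is_functor R" "FDom R = FCod L" "FCod R = FDom L"
  using adj unfolding adjunction_def by auto

lemma unit_nat_trans: "nat_trans (fid (FDom L)) (functor_comp R L) \<eta>"
  using adj unfolding adjunction_def by blast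

lemma counit_nat_trans: "nat_trans (functor_comp L R) (fid (FCod L)) \<epsilon>"
  using adj unfolding adjunction_def by blast

lemma unit_Hom: "a \<in> Obj (FDom L) \<Longrightarrow> \<eta> a \<in> Hom (FDom L) a (FObj R (FObj L a))"
  using nat_transD(1)[OF unit_nat_trans, of a] by simp

lemma counit_Hom: "b \<in> Obj (FCod L) \<Longrightarrow> \<epsilon> b \<in> Hom (FCod L) (FObj L (FObj R b)) b"
  using nat_transD(1)[OF counit_nat_trans, of b] adjunction_functors(3) by simp

lemma unit_natural:
  assumes f: "f \<in> Hom (FDom L) a b"
  shows "Comp (FDom L) (\<eta> b) f = Comp (FDom L) (FArr R (FArr L f)) (\<eta> a)"
  using nat_transD(2)[OF unit_nat_trans, of f a b] f HomD(1)[OF f] by simp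

lemma counit_natural:
  assumes f: "f \<in> Hom (FCod L) a b"
  shows "Comp (FCod L) (\<epsilon> b) (FArr L (FArr R f)) = Comp (FCod L) f (\<epsilon> a)"
  using nat_transD(2)[OF counit_nat_trans, of f a b] f HomD(1)[OF f] adjunction_functors(3) by simp

lemma triangle_left:
  "a \<in> Obj (FDom L) \<Longrightarrow> Comp (FCod L) (\<epsilon> (FObj L a)) (FArr L (\<eta> a)) = Ident (FCod L) (FObj L a)"
  using adj unfolding adjunction_def by auto

lemma triangle_right:
  "b \<in> Obj (FCod L) \<Longrightarrow> Comp (FDom L) (FArr R (\<epsilon> b)) (\<eta> (FObj R b)) = Ident (FDom L) (FObj R b)"
  using adj unfolding adjunction_def by auto

lemma R_Hom: "f \<in> Hom (FCod L) x y \<Longrightarrow> FArr R f \<in> Hom (FDom L) (FObj R x) (FObj R y)"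
  using functor_Hom[OF adjunction_functors(2)] adjunction_functors(3,4) by metis

lemma R_comp:
  assumes "f \<in> Hom (FCod L) x y" "g \<in> Hom (FCod L) y z"
  shows "FArr R (Comp (FCod L) g f) = Comp (FDom L) (FArr R g) (FArr R f)"
  using functor_pres_comp[OF adjunction_functors(2)] adjunction_functors(3,4) assms by metis

text \<open>The argument of \<open>FArr L\<close> is the transpose of \<open>u\<close>. Transposing
  back gives \<open>u\<close> by naturality of the counit at \<open>u\<close> and the triangle
  identity at \<open>a\<close>.\<close>

lemma transpose_transpose:
  assumes u: "u \<in> Hom (FCod L) (FObj L a) x" and a: "a \<in> Obj (FDom L)"
  shows "Comp (FCod L) (\<epsilon> x) (FArr L (Comp (FDom L) (FArr R u) (\<eta> a))) = u"
proof -
  let ?C = "FDom L" and ?D = "FCod L"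
  note fL = adjunction_functors(1) and D = functor_cats(2)[OF adjunction_functors(1)]
  have x: "x \<in> Obj ?D" using Hom_Obj(2)[OF D u] .
  have La: "FObj L a \<in> Obj ?D" using Hom_Obj(1)[OF D u] .
  have "FArr L (Comp ?C (FArr R u) (\<eta> a)) = Comp ?D (FArr L (FArr R u)) (FArr L (\<eta> a))"
    using functor_pres_comp[OF fL unit_Hom[OF a] R_Hom[OF u]] .
  then have "Comp ?D (\<epsilon> x) (FArr L (Comp ?C (FArr R u) (\<eta> a)))
      = Comp ?D (Comp ?D (\<epsilon> x) (FArr L (FArr R u))) (FArr L (\<eta> a))"
    using comp_assoc[OF D functor_Hom[OF fL unit_Hom[OF a]] functor_Hom[OF fL R_Hom[OF u]] counit_Hom[OF x]]
    by simp
  also have "\<dots> = Comp ?D u (Comp ?D (\<epsilon> (FObj L a)) (FArr L (\<eta> a)))"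
    using comp_assoc[OF D functor_Hom[OF fL unit_Hom[OF a]] counit_Hom[OF La] u] counit_natural[OF u]
    by simp
  also have "\<dots> = u" using triangle_left[OF a] comp_ident_right[OF D u] by simp
  finally show ?thesis .
qed

text \<open>Transpose the square to one from \<open>i\<close> to \<open>FArr R p\<close>, lift
  there, and transpose the lift back along the counit; naturality of unit and counit keeps the
  squares commutative.\<close>

lemma left_adjoint_has_lifts:
  assumes i: "i \<in> Hom (FDom L) a b" and p: "p \<in> Hom (FCod L) x y"
    and lifts: "has_lifts (FDom L) i (FArr R p)"
  shows "has_lifts (FCod L) (FArr L i) p"
proof (rule has_liftsI[OF functor_Hom[OF adjunction_functors(1) i] p])
  let ?C = "FDom L" and ?D = "FCod L"
  note fL = adjunction_functors(1)
  note C = functor_cats(1)[OF fL] and D = functor_cats(2)[OF fL]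
  fix u v assume u: "u \<in> Hom ?D (FObj L a) x" and v: "v \<in> Hom ?D (FObj L b) y"
    and eq: "Comp ?D p u = Comp ?D v (FArr L i)"
  have a: "a \<in> Obj ?C" and b: "b \<in> Obj ?C" using Hom_Obj[OF C i] by auto
  have x: "x \<in> Obj ?D" and y: "y \<in> Obj ?D" using Hom_Obj[OF D p] by auto
  define u' v' where "u' = Comp ?C (FArr R u) (\<eta> a)" and "v' = Comp ?C (FArr R v) (\<eta> b)"
  have u': "u' \<in> Hom ?C a (FObj R x)" and v': "v' \<in> Hom ?C b (FObj R y)"
    unfolding u'_def v'_def using comp_Hom[OF C] unit_Hom R_Hom u v a b by blast+
  have "Comp ?C (FArr R p) u' = Comp ?C (FArr R (Comp ?D p u)) (\<eta> a)"
    unfolding u'_def using comp_assoc[OF C unit_Hom[OF a] R_Hom[OF u] R_Hom[OF p]] R_comp[OF u p] by simp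
  also have "\<dots> = Comp ?C (FArr R v) (Comp ?C (FArr R (FArr L i)) (\<eta> a))"
    using comp_assoc[OF C unit_Hom[OF a] R_Hom[OF functor_Hom[OF fL i]] R_Hom[OF v]]
      R_comp[OF functor_Hom[OF fL i] v] eq by simp
  also have "\<dots> = Comp ?C v' i"
    unfolding v'_def using unit_natural[OF i] comp_assoc[OF C i unit_Hom[OF b] R_Hom[OF v]] by simp
  finally have "Comp ?C (FArr R p) u' = Comp ?C v' i" .
  then obtain k where k: "k \<in> Hom ?C b (FObj R x)" "Comp ?C k i = u'" "Comp ?C (FArr R p) k = v'"
    using has_liftsE[OF lifts i R_Hom[OF p] u' v'] by blast
  define h where "h = Comp ?D (\<epsilon> x) (FArr L k)"
  have h: "h \<in> Hom ?D (FObj L b) x"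
    unfolding h_def using comp_Hom[OF D functor_Hom[OF fL k(1)] counit_Hom[OF x]] .
  have "Comp ?D h (FArr L i) = Comp ?D (\<epsilon> x) (FArr L u')"
    unfolding h_def
    using comp_assoc[OF D functor_Hom[OF fL i] functor_Hom[OF fL k(1)] counit_Hom[OF x]]
      functor_pres_comp[OF fL i k(1)] k(2) by simp
  also have "\<dots> = u" unfolding u'_def by (rule transpose_transpose[OF u a])
  finally have 1: "Comp ?D h (FArr L i) = u" .
  have "Comp ?D p h = Comp ?D (Comp ?D (\<epsilon> y) (FArr L (FArr R p))) (FArr L k)"
    unfolding h_def counit_natural[OF p]
    using comp_assoc[OF D functor_Hom[OF fL k(1)] counit_Hom[OF x] p] by simp
  also have "\<dots> = Comp ?D (\<epsilon> y) (FArr L v')"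
    using comp_assoc[OF D functor_Hom[OF fL k(1)] functor_Hom[OF fL R_Hom[OF p]] counit_Hom[OF y]]
      functor_pres_comp[OF fL k(1) R_Hom[OF p]] k(3) by simp
  also have "\<dots> = v" unfolding v'_def by (rule transpose_transpose[OF v b])
  finally show "\<exists>h\<in>Hom ?D (FObj L b) x. Comp ?D h (FArr L i) = u \<and> Comp ?D p h = v"
    using 1 h by blast
qed

text \<open>The inverse is the preimage \<open>s\<close> under \<open>R\<close> of the unit at
  \<open>FObj R y\<close>. That \<open>s\<close> is a section of the counit is tested after applying
  \<open>R\<close>, where it is a triangle identity; for the other composite, it and the identity
  have the same transpose, namely the unit.\<close>

lemma counit_iso:
  assumes y: "y \<in> Obj (FCod L)"
    and full: "\<And>x g. x \<in> Obj (FCod L) \<Longrightarrow> g \<in> Hom (FDom L) (FObj R y) (FObj R x) \<Longrightarrow>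
      \<exists>f\<in>Hom (FCod L) y x. FArr R f = g"
    and faithful: "\<And>f g. f \<in> Hom (FCod L) y y \<Longrightarrow> g \<in> Hom (FCod L) y y \<Longrightarrow>
      FArr R f = FArr R g \<Longrightarrow> f = g"
  shows "is_iso (FCod L) (\<epsilon> y)"
proof -
  let ?C = "FDom L" and ?D = "FCod L"
  note fL = adjunction_functors(1) and fR = adjunction_functors(2)
  note C = functor_cats(1)[OF fL] and D = functor_cats(2)[OF fL]
  have Ry: "FObj R y \<in> Obj ?C" using functor_Obj[OF fR] adjunction_functors(3,4) y by metis
  let ?z = "FObj L (FObj R y)"
  have z: "?z \<in> Obj ?D" using functor_Obj[OF fL Ry] .
  obtain s where s: "s \<in> Hom ?D y ?z" "FArr R s = \<eta> (FObj R y)"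
    using full[OF z unit_Hom[OF Ry]] by blast
  note e = counit_Hom[OF y]
  have "FArr R (Comp ?D (\<epsilon> y) s) = FArr R (Ident ?D y)"
    using R_comp[OF s(1) e] s(2) triangle_right[OF y] functor_pres_ident[OF fR] adjunction_functors(3,4) y
    by metis
  then have 1: "Comp ?D (\<epsilon> y) s = Ident ?D y"
    using faithful[OF comp_Hom[OF D s(1) e] ident_Hom[OF D y]] by blast
  have se: "Comp ?D s (\<epsilon> y) \<in> Hom ?D ?z ?z" using comp_Hom[OF D e s(1)] .
  have "Comp ?C (FArr R (Comp ?D s (\<epsilon> y))) (\<eta> (FObj R y)) = \<eta> (FObj R y)"
    using R_comp[OF e s(1)] comp_assoc[OF C unit_Hom[OF Ry] R_Hom[OF e] R_Hom[OF s(1)]]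
      triangle_right[OF y] comp_ident_right[OF C R_Hom[OF s(1)]] s(2) by simp
  then have "Comp ?D s (\<epsilon> y) = Ident ?D ?z"
    using transpose_transpose[OF se Ry] triangle_left[OF Ry] by simp
  then show ?thesis using 1 by (intro is_isoI[OF e s(1)])
qed

end

section \<open>Isomorphisms of simplicial sets are weak equivalences\<close>

lemma sset_act_closed:
  "is_sset X \<Longrightarrow> \<theta> \<in> Delta n m \<Longrightarrow> x \<in> simp X m \<Longrightarrow> act X n m \<theta> x \<in> simp X n"
  unfolding is_sset_def by blast

lemma sset_act_id: "is_sset X \<Longrightarrow> x \<in> simp X n \<Longrightarrow> act X n n (\<lambda>j\<in>{..n}. j) x = x"
  unfolding is_sset_def by blast

lemma sset_act_comp:
  "is_sset X \<Longrightarrow> \<phi> \<in> Delta l n \<Longrightarrow> \<theta> \<in> Delta n m \<Longrightarrow> x \<in> simp X m \<Longrightarrow>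
     act X l n \<phi> (act X n m \<theta> x) = act X l m (compose {..l} \<theta> \<phi>) x"
  unfolding is_sset_def by metis

lemma sset_map_ssets: "sset_map X Y f \<Longrightarrow> is_sset X" "sset_map X Y f \<Longrightarrow> is_sset Y"
  unfolding sset_map_def by auto

lemma sset_map_ext: "sset_map X Y f \<Longrightarrow> f n \<in> simp X n \<rightarrow>\<^sub>E simp Y n"
  unfolding sset_map_def by auto

lemma sset_map_closed: "sset_map X Y f \<Longrightarrow> x \<in> simp X n \<Longrightarrow> f n x \<in> simp Y n"
  using sset_map_ext by blast

lemma sset_map_act:
  "sset_map X Y f \<Longrightarrow> \<theta> \<in> Delta n m \<Longrightarrow> x \<in> simp X m \<Longrightarrow> f n (act X n m \<theta> x) = act Y n m \<theta> (f m x)"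
  unfolding sset_map_def by auto

lemma sset_mapI:
  assumes "is_sset X" "is_sset Y" "\<And>n. f n \<in> simp X n \<rightarrow>\<^sub>E simp Y n"
    "\<And>n m \<theta> x. \<theta> \<in> Delta n m \<Longrightarrow> x \<in> simp X m \<Longrightarrow> f n (act X n m \<theta> x) = act Y n m \<theta> (f m x)"
  shows "sset_map X Y f"
  using assms unfolding sset_map_def by auto

section \<open>Gluing of cells and the topology of the realisation\<close>

lemma simplex_push_simplex:
  assumes "\<theta> \<in> Delta n m" "t \<in> standard_simplex n"
  shows "simplex_push n \<theta> t \<in> standard_simplex m"
proof -
  have t: "\<And>i. 0 \<le> t i" "(\<Sum>i\<le>n. t i) = 1"
    using assms(2) by (auto simp: standard_simplex_def)
  have \<theta>: "\<theta> ` {..n} \<subseteq> {..m}" using assms(1) by (auto simp: Delta_def)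
  have le: "simplex_push n \<theta> t i \<le> 1" for i
    unfolding simplex_push_def t(2)[symmetric] using t(1) by (intro sum_mono2) auto
  have z: "simplex_push n \<theta> t i = 0" if "i > m" for i
  proof -
    have "{j. j \<le> n \<and> \<theta> j = i} = {}" using \<theta> that by auto
    then show ?thesis by (simp only: simplex_push_def sum.empty)
  qed
  have "(\<Sum>i\<le>m. simplex_push n \<theta> t i) = 1"
    using sum.group[of "{..n}" "{..m}" \<theta> t] \<theta> t(2) by (simp add: simplex_push_def)
  then show ?thesis
    using le z t(1) by (auto simp: standard_simplex_def simplex_push_def intro: sum_nonneg)
qed

text \<open>The generating relation inside the \<open>let\<close> of \<open>glue\<close>, named for
  inductions over its closure.\<close>

definition glue_step ::
    "'a sset \<Rightarrow> ((nat \<times> 'a \<times> (nat \<Rightarrow> real)) \<times> (nat \<times> 'a \<times> (nat \<Rightarrow> real))) set" where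
  "glue_step X = {((n, act X n m \<theta> x, t), (m, x, simplex_push n \<theta> t)) | n m \<theta> x t.
                 \<theta> \<in> Delta n m \<and> x \<in> simp X m \<and> t \<in> standard_simplex n}"

lemma glue_eq: "glue X = (glue_step X \<union> (glue_step X)\<inverse>)\<^sup>*"
  by (simp add: glue_def glue_step_def Let_def)

lemma glue_refl [simp]: "(p, p) \<in> glue X"
  by (simp add: glue_eq)

lemma glue_sym: "(p, q) \<in> glue X \<Longrightarrow> (q, p) \<in> glue X"
proof -
  have "sym ((glue_step X \<union> (glue_step X)\<inverse>)\<^sup>*)" by (intro sym_rtrancl sym_Un_converse)
  then show "(p, q) \<in> glue X \<Longrightarrow> (q, p) \<in> glue X" unfolding glue_eq by (rule symD)
qed

lemma glue_trans: "(p, q) \<in> glue X \<Longrightarrow> (q, r) \<in> glue X \<Longrightarrow> (p, r) \<in> glue X"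
  unfolding glue_eq by (rule rtrancl_trans)

lemma glue_class_eq: "(p, q) \<in> glue X \<Longrightarrow> glue X `` {p} = glue X `` {q}"
  by (auto intro: glue_trans glue_sym)

lemma cells_point:
  "(n, x, t) \<in> topspace (cells X) \<longleftrightarrow> x \<in> simp X n \<and> t \<in> standard_simplex n"
  by (auto simp: cells_def)

text \<open>As a reflexive closure \<open>glue X\<close> relates every element of the type to
  itself, cell or not. The generating steps have both ends among the cells, so a class that starts
  at a cell point stays there.\<close>

lemma glue_cells:
  assumes X: "is_sset X" and pq: "(p, q) \<in> glue X" and p: "p \<in> topspace (cells X)"
  shows "q \<in> topspace (cells X)"
proof -
  have s: "fst e \<in> topspace (cells X) \<and> snd e \<in> topspace (cells X)" if "e \<in> glue_step X" for e
    using that sset_act_closed[OF X] simplex_push_simplex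
    by (fastforce simp: glue_step_def cells_point)
  show ?thesis
    using pq[unfolded glue_eq] p
    by (induction rule: rtrancl_induct) (use s in \<open>fastforce+\<close>)
qed

lemma glue_class_cells:
  "is_sset X \<Longrightarrow> c \<in> topspace (cells X) // glue X \<Longrightarrow> c \<subseteq> topspace (cells X)"
  using glue_cells by (fastforce simp: quotient_def)

lemma glue_classE:
  assumes "c \<in> topspace (cells X) // glue X"
  obtains p where "p \<in> topspace (cells X)" "c = glue X `` {p}"
  using assms by (auto simp: quotient_def)

lemma glue_class_inter:
  assumes "c \<in> A // glue X" "d \<in> B // glue X" "p \<in> c" "p \<in> d"
  shows "c = d"
  using assms glue_class_eq unfolding quotient_def by blast

text \<open>Classes that meet are equal, so taking unions commutes with the intersection of two
  families of classes. For arbitrary unions nothing about classes is involved.\<close>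

lemma istopology_realisation:
  assumes "is_sset X"
  shows "istopology (\<lambda>U. U \<subseteq> topspace (cells X) // glue X \<and> openin (cells X) (\<Union>U))"
  unfolding istopology_def
proof (intro conjI allI impI)
  let ?Q = "topspace (cells X) // glue X"
  fix S T assume S: "S \<subseteq> ?Q \<and> openin (cells X) (\<Union>S)" and T: "T \<subseteq> ?Q \<and> openin (cells X) (\<Union>T)"
  have "\<Union>(S \<inter> T) = \<Union>S \<inter> \<Union>T" using S T by (blast dest: glue_class_inter)
  then show "openin (cells X) (\<Union>(S \<inter> T))" using S T by auto
  show "S \<inter> T \<subseteq> ?Q" using S by blast
next
  let ?Q = "topspace (cells X) // glue X"
  fix K assume K: "\<forall>k\<in>K. k \<subseteq> ?Q \<and> openin (cells X) (\<Union>k)"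
  then show "\<Union>K \<subseteq> ?Q" by blast
  have "\<Union>(\<Union>K) = \<Union>(Union ` K)" by blast
  then show "openin (cells X) (\<Union>(\<Union>K))" using K by auto
qed

lemma openin_realisation:
  "is_sset X \<Longrightarrow>
     openin (realisation X) U \<longleftrightarrow> U \<subseteq> topspace (cells X) // glue X \<and> openin (cells X) (\<Union>U)"
  unfolding realisation_def by (simp add: topology_inverse' istopology_realisation)

lemma topspace_realisation:
  assumes "is_sset X"
  shows "topspace (realisation X) = topspace (cells X) // glue X"
proof -
  have "p \<in> \<Union>(topspace (cells X) // glue X)" if "p \<in> topspace (cells X)" for p
    using quotientI[OF that, of "glue X"] glue_refl[of p X] by blast
  then have "\<Union>(topspace (cells X) // glue X) = topspace (cells X)"
    using glue_class_cells[OF assms] by blast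
  then have "openin (realisation X) (topspace (cells X) // glue X)"
    by (simp add: openin_realisation[OF assms])
  then show ?thesis
    using openin_realisation[OF assms] openin_subset openin_topspace by (metis subset_antisym)
qed

section \<open>Maps induced on realisations\<close>

definition cell_map where "cell_map f = (\<lambda>(n, x, t). (n, f n x, t))"

lemma cell_map_glue:
  assumes f: "sset_map X Y f" and pq: "(p, q) \<in> glue X"
  shows "(cell_map f p, cell_map f q) \<in> glue Y"
proof -
  have s: "(cell_map f (fst e), cell_map f (snd e)) \<in> glue Y" if es: "e \<in> glue_step X" for e
  proof -
    obtain n m \<theta> x t where e: "e = ((n, act X n m \<theta> x, t), (m, x, simplex_push n \<theta> t))"
      and h: "\<theta> \<in> Delta n m" "x \<in> simp X m" "t \<in> standard_simplex n"
      using es unfolding glue_step_def by auto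
    then have "((n, act Y n m \<theta> (f m x), t), (m, f m x, simplex_push n \<theta> t)) \<in> glue_step Y"
      unfolding glue_step_def using sset_map_closed[OF f] by blast
    then have "((n, act Y n m \<theta> (f m x), t), (m, f m x, simplex_push n \<theta> t)) \<in> glue Y"
      unfolding glue_eq by (rule r_into_rtrancl[OF UnI1])
    then show ?thesis by (simp only: e fst_conv snd_conv cell_map_def case_prod_conv sset_map_act[OF f h(1,2)])
  qed
  show ?thesis using pq[unfolded glue_eq]
  proof (induction rule: rtrancl_induct)
    case (step y z)
    then have "(y, z) \<in> glue_step X \<or> (z, y) \<in> glue_step X" by blast
    then have "(cell_map f y, cell_map f z) \<in> glue Y"
      using s[of "(y, z)"] s[of "(z, y)"] glue_sym by (metis fst_conv snd_conv)
    then show ?case using step.IH glue_trans by metis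
  qed simp
qed

lemma realisation_map_class:
  assumes f: "sset_map X Y f"
  shows "realisation_map Y f (glue X `` {p}) = glue Y `` {cell_map f p}"
proof -
  have "realisation_map Y f (glue X `` {p}) = glue Y `` (cell_map f ` (glue X `` {p}))"
    by (simp add: realisation_map_def cell_map_def)
  also have "\<dots> = glue Y `` {cell_map f p}"
  proof
    show "glue Y `` (cell_map f ` (glue X `` {p})) \<subseteq> glue Y `` {cell_map f p}"
      using cell_map_glue[OF f] glue_trans by blast
    have "p \<in> glue X `` {p}" by simp
    then show "glue Y `` {cell_map f p} \<subseteq> glue Y `` (cell_map f ` (glue X `` {p}))" by blast
  qed
  finally show ?thesis .
qed

lemma cell_map_cells:
  "sset_map X Y f \<Longrightarrow> p \<in> topspace (cells X) \<Longrightarrow> cell_map f p \<in> topspace (cells Y)"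
  by (cases p) (auto simp: cell_map_def cells_point sset_map_closed)

text \<open>Openness in a sum is tested on each summand, where the map is \<open>f n\<close> times
  the identity; the first factor is discrete, so any function there is continuous.\<close>

lemma continuous_map_cells:
  assumes f: "sset_map X Y f"
  shows "continuous_map (cells X) (cells Y) (cell_map f)"
  unfolding continuous_map_def
proof (intro conjI allI impI)
  show "cell_map f \<in> topspace (cells X) \<rightarrow> topspace (cells Y)" using cell_map_cells[OF f] by auto
  fix U assume U: "openin (cells Y) U"
  let ?S = "\<lambda>n. subtopology (powertop_real UNIV) (standard_simplex n)"
  have c: "continuous_map (prod_topology (discrete_topology (simp X n)) (?S n))
      (prod_topology (discrete_topology (simp Y n)) (?S n)) (\<lambda>(x, t). (f n x, t))" for n
    using sset_map_closed[OF f] by (auto simp: continuous_map_prod_top)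
  have o: "openin (prod_topology (discrete_topology (simp X n)) (?S n))
      {z \<in> topspace (prod_topology (discrete_topology (simp X n)) (?S n)).
        (\<lambda>(x, t). (f n x, t)) z \<in> {z. (n, z) \<in> U}}" for n
    by (rule openin_continuous_map_preimage[OF c])
      (use U in \<open>simp add: cells_def openin_sum_topology\<close>)
  have "{z. (n, z) \<in> {p \<in> topspace (cells X). cell_map f p \<in> U}}
      = {z \<in> topspace (prod_topology (discrete_topology (simp X n)) (?S n)).
        (\<lambda>(x, t). (f n x, t)) z \<in> {z. (n, z) \<in> U}}" for n
    by (auto simp: cells_def cell_map_def)
  then have "openin (prod_topology (discrete_topology (simp X n)) (?S n))
      {z. (n, z) \<in> {p \<in> topspace (cells X). cell_map f p \<in> U}}" for n
    using o[of n] by simp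
  then show "openin (cells X) {p \<in> topspace (cells X). cell_map f p \<in> U}"
    unfolding cells_def openin_sum_topology by auto
qed

text \<open>The class of \<open>p\<close> goes to the class of \<open>cell_map f p\<close>. Hence
  the union of the preimage of an open family \<open>U\<close> is the preimage of the union of
  \<open>U\<close> under the continuous \<open>cell_map f\<close>.\<close>

lemma continuous_map_realisation:
  assumes f: "sset_map X Y f"
  shows "continuous_map (realisation X) (realisation Y) (realisation_map Y f)"
  unfolding continuous_map_def
proof (intro conjI allI impI)
  note X = sset_map_ssets(1)[OF f] and Y = sset_map_ssets(2)[OF f]
  show "realisation_map Y f \<in> topspace (realisation X) \<rightarrow> topspace (realisation Y)"
    unfolding topspace_realisation[OF X] topspace_realisation[OF Y]
    using cell_map_cells[OF f]
    by (auto elim!: glue_classE simp: realisation_map_class[OF f] intro!: quotientI)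
  fix U assume U: "openin (realisation Y) U"
  let ?V = "{c \<in> topspace (realisation X). realisation_map Y f c \<in> U}"
  have UQ: "U \<subseteq> topspace (cells Y) // glue Y" and Uo: "openin (cells Y) (\<Union>U)"
    using U openin_realisation[OF Y] by auto
  have "\<Union>?V = {p \<in> topspace (cells X). cell_map f p \<in> \<Union>U}"
  proof (intro equalityI subsetI)
    fix p assume "p \<in> \<Union>?V"
    then obtain c where c: "p \<in> c" "c \<in> topspace (cells X) // glue X" "realisation_map Y f c \<in> U"
      using topspace_realisation[OF X] by auto
    have p: "p \<in> topspace (cells X)" using glue_class_cells[OF X c(2)] c(1) by auto
    have "c = glue X `` {p}" using c(1,2) glue_class_eq unfolding quotient_def by blast
    then have "glue Y `` {cell_map f p} \<in> U" using realisation_map_class[OF f] c(3) by simp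
    then have "cell_map f p \<in> \<Union>U" using glue_refl[of "cell_map f p" Y] by blast
    then show "p \<in> {p \<in> topspace (cells X). cell_map f p \<in> \<Union>U}" using p by blast
  next
    fix p assume "p \<in> {p \<in> topspace (cells X). cell_map f p \<in> \<Union>U}"
    then obtain u where p: "p \<in> topspace (cells X)" and u: "u \<in> U" "cell_map f p \<in> u" by auto
    have "u = glue Y `` {cell_map f p}"
      using u UQ glue_class_eq unfolding quotient_def by blast
    then have "realisation_map Y f (glue X `` {p}) \<in> U"
      using realisation_map_class[OF f] u(1) by simp
    then have "glue X `` {p} \<in> ?V" using p topspace_realisation[OF X] by (auto intro: quotientI)
    then show "p \<in> \<Union>?V" by (auto intro: exI[of _ "glue X `` {p}"])
  qed
  then have "openin (cells X) (\<Union>?V)"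
    using openin_continuous_map_preimage[OF continuous_map_cells[OF f] Uo] by simp
  then show "openin (realisation X) ?V"
    unfolding openin_realisation[OF X] using topspace_realisation[OF X] by auto
qed

section \<open>Homotopy sets and homeomorphisms\<close>

lemma pointed_homotopic_equiv: "equiv (pointed_maps n X x) (pointed_homotopic n X x)"
proof (rule equivI)
  show "pointed_homotopic n X x \<subseteq> pointed_maps n X x \<times> pointed_maps n X x"
    unfolding pointed_homotopic_def pointed_maps_def
    by (auto dest: homotopic_with_imp_continuous_maps homotopic_with_imp_property)
  show "refl_on (pointed_maps n X x) (pointed_homotopic n X x)"
    by (rule refl_onI) (auto simp: pointed_homotopic_def pointed_maps_def)
  show "sym (pointed_homotopic n X x)"
    by (rule symI) (auto simp: pointed_homotopic_def intro: homotopic_with_symD)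
  show "trans (pointed_homotopic n X x)"
    by (rule transI) (auto simp: pointed_homotopic_def intro: homotopic_with_trans)
qed

text \<open>Composition with \<open>f\<close> respects pointed homotopy. This evaluates on
  representatives the map of homotopy sets that occurs in
  \<open>weak_homotopy_equivalence\<close>.\<close>

lemma pi_map_class:
  assumes f: "continuous_map X Y f" and g: "g \<in> pointed_maps n X x"
  shows "pointed_homotopic n Y (f x) `` ((\<lambda>g. f \<circ> g) ` (pointed_homotopic n X x `` {g}))
    = pointed_homotopic n Y (f x) `` {f \<circ> g}"
proof -
  have "(f \<circ> g, f \<circ> h) \<in> pointed_homotopic n Y (f x)" if "(g, h) \<in> pointed_homotopic n X x" for h
    using that f unfolding pointed_homotopic_def
    by (auto intro: homotopic_with_compose_continuous_map_left)
  moreover have "g \<in> pointed_homotopic n X x `` {g}"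
    using equiv_class_self[OF pointed_homotopic_equiv g] .
  ultimately show ?thesis
    using pointed_homotopic_equiv[of n Y "f x"] unfolding equiv_def by (auto dest: transD)
qed

lemma homotopy_inverse_on_pi:
  assumes f: "continuous_map X Y f" and f': "continuous_map Y X f'"
    and inv: "\<And>z. z \<in> topspace X \<Longrightarrow> f' (f z) = z" and x: "x \<in> topspace X"
    and c: "c \<in> pi_set n X x"
  shows "pointed_homotopic n X x `` ((\<lambda>g. f' \<circ> g) `
    (pointed_homotopic n Y (f x) `` ((\<lambda>g. f \<circ> g) ` c))) = c"
    and "pointed_homotopic n Y (f x) `` ((\<lambda>g. f \<circ> g) ` c) \<in> pi_set n Y (f x)"
proof -
  obtain g where g: "g \<in> pointed_maps n X x" "c = pointed_homotopic n X x `` {g}"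
    using c unfolding pi_set_def by (auto elim: quotientE)
  have fg: "f \<circ> g \<in> pointed_maps n Y (f x)"
    using g(1) f by (auto simp: pointed_maps_def intro: continuous_map_compose)
  have eq: "f' (f x) = x" using inv x .
  have gc: "continuous_map (nsphere n) X g" "g sphere_base = x" using g(1) by (auto simp: pointed_maps_def)
  \<comment> \<open>Since \<open>f'\<close> inverts \<open>f\<close> only on
    \<open>topspace X\<close>, the two maps agree on the sphere but need not be equal as functions;
    they are still homotopic.\<close>
  have "homotopic_with (\<lambda>k. k sphere_base = x) (nsphere n) X g (f' \<circ> (f \<circ> g))"
  proof (rule homotopic_with_equal[OF _ _ gc(1)])
    fix z assume "z \<in> topspace (nsphere n)"
    then have "g z \<in> topspace X" using gc(1) by (auto simp: continuous_map_def)
    then show "g z = (f' \<circ> (f \<circ> g)) z" using inv by simp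
  qed (use gc(2) eq in auto)
  then have "(g, f' \<circ> (f \<circ> g)) \<in> pointed_homotopic n X x" by (simp add: pointed_homotopic_def)
  then have "pointed_homotopic n X x `` {f' \<circ> (f \<circ> g)} = pointed_homotopic n X x `` {g}"
    using equiv_class_eq[OF pointed_homotopic_equiv] by metis
  then show "pointed_homotopic n X x `` ((\<lambda>g. f' \<circ> g) `
    (pointed_homotopic n Y (f x) `` ((\<lambda>g. f \<circ> g) ` c))) = c"
    using pi_map_class[OF f g(1)] pi_map_class[OF f' fg] g(2) eq by simp
  show "pointed_homotopic n Y (f x) `` ((\<lambda>g. f \<circ> g) ` c) \<in> pi_set n Y (f x)"
    unfolding g(2) pi_map_class[OF f g(1)] pi_set_def using fg by (rule quotientI)
qed

lemma homeomorphism_weak_homotopy_equivalence: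
  assumes f: "continuous_map X Y f" and f': "continuous_map Y X f'"
    and inv: "\<And>z. z \<in> topspace X \<Longrightarrow> f' (f z) = z" "\<And>z. z \<in> topspace Y \<Longrightarrow> f (f' z) = z"
  shows "weak_homotopy_equivalence X Y f"
  unfolding weak_homotopy_equivalence_def
proof (intro conjI ballI allI impI f)
  show "topspace Y = {}" if "topspace X = {}"
    using that continuous_map_image_subset_topspace[OF f'] by blast
  fix x n assume x: "x \<in> topspace X"
  have fx: "f x \<in> topspace Y" "f' (f x) = x" "f (f' (f x)) = f x"
    using x f inv(1) by (auto simp: continuous_map_def)
  show "bij_betw (\<lambda>c. pointed_homotopic n Y (f x) `` ((\<lambda>g. f \<circ> g) ` c)) (pi_set n X x) (pi_set n Y (f x))"
  proof (rule bij_betw_byWitness[where f' = "\<lambda>c. pointed_homotopic n X x `` ((\<lambda>g. f' \<circ> g) ` c)"])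
    show "\<forall>c\<in>pi_set n X x. pointed_homotopic n X x `` ((\<lambda>g. f' \<circ> g) `
        (pointed_homotopic n Y (f x) `` ((\<lambda>g. f \<circ> g) ` c))) = c"
      using homotopy_inverse_on_pi(1)[OF f f' inv(1) x] by blast
    show "(\<lambda>c. pointed_homotopic n Y (f x) `` ((\<lambda>g. f \<circ> g) ` c)) ` pi_set n X x \<subseteq> pi_set n Y (f x)"
      using homotopy_inverse_on_pi(2)[OF f f' inv(1) x] by blast
    show "\<forall>c\<in>pi_set n Y (f x). pointed_homotopic n Y (f x) `` ((\<lambda>g. f \<circ> g) `
        (pointed_homotopic n X x `` ((\<lambda>g. f' \<circ> g) ` c))) = c"
      using homotopy_inverse_on_pi(1)[OF f' f inv(2) fx(1)] fx by auto
    show "(\<lambda>c. pointed_homotopic n X x `` ((\<lambda>g. f' \<circ> g) ` c)) ` pi_set n Y (f x) \<subseteq> pi_set n X x"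
      using homotopy_inverse_on_pi(2)[OF f' f inv(2) fx(1)] fx by auto
  qed
qed

section \<open>Levelwise bijective maps of simplicial sets\<close>

lemma sset_map_inverse:
  assumes f: "sset_map X Y f" and bij: "\<And>n. bij_betw (f n) (simp X n) (simp Y n)"
  shows "sset_map Y X (\<lambda>n. restrict (inv_into (simp X n) (f n)) (simp Y n))"
proof (rule sset_mapI[OF sset_map_ssets(2)[OF f] sset_map_ssets(1)[OF f]])
  let ?g = "\<lambda>n. restrict (inv_into (simp X n) (f n)) (simp Y n)"
  show "?g n \<in> simp Y n \<rightarrow>\<^sub>E simp X n" for n
    using bij_betw_inv_into[OF bij[of n]] bij_betwE by fastforce
  fix n m \<theta> y assume \<theta>: "\<theta> \<in> Delta n m" and y: "y \<in> simp Y m"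
  obtain x where x: "x \<in> simp X m" "y = f m x" using bij[of m] y by (auto simp: bij_betw_def)
  have inj: "inj_on (f k) (simp X k)" for k using bij[of k] by (simp add: bij_betw_def)
  have "act X n m \<theta> x \<in> simp X n" using sset_act_closed[OF sset_map_ssets(1)[OF f] \<theta> x(1)] .
  moreover have "act Y n m \<theta> y = f n (act X n m \<theta> x)" using sset_map_act[OF f \<theta> x(1)] x(2) by simp
  ultimately show "?g n (act Y n m \<theta> y) = act X n m \<theta> (?g m y)"
    using x inj y sset_map_closed[OF f] by (simp add: inv_into_f_f)
qed

text \<open>The levelwise inverse is again simplicial, and its realisation is inverse to that of
  \<open>f\<close>. All weak equivalences of simplicial sets in the sequel are obtained in this
  way.\<close>

lemma bijective_weak_equivalence:
  assumes f: "sset_map X Y f" and bij: "\<And>n. bij_betw (f n) (simp X n) (simp Y n)"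
  shows "weak_equivalence X Y f"
proof -
  let ?g = "\<lambda>n. restrict (inv_into (simp X n) (f n)) (simp Y n)"
  have g: "sset_map Y X ?g" using sset_map_inverse[OF f bij] .
  note X = sset_map_ssets(1)[OF f] and Y = sset_map_ssets(2)[OF f]
  have gf: "cell_map ?g (cell_map f p) = p" if "p \<in> topspace (cells X)" for p
    using that bij sset_map_closed[OF f]
    by (cases p) (auto simp: cell_map_def cells_point bij_betw_def inv_into_f_f)
  have fg: "cell_map f (cell_map ?g p) = p" if "p \<in> topspace (cells Y)" for p
    using that bij by (cases p) (auto simp: cell_map_def cells_point bij_betw_def f_inv_into_f)
  have "weak_homotopy_equivalence (realisation X) (realisation Y) (realisation_map Y f)"
  proof (rule homeomorphism_weak_homotopy_equivalence[OF continuous_map_realisation[OF f]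
        continuous_map_realisation[OF g]])
    show "realisation_map X ?g (realisation_map Y f z) = z" if "z \<in> topspace (realisation X)" for z
      using that gf unfolding topspace_realisation[OF X]
      by (auto elim!: glue_classE simp: realisation_map_class[OF f] realisation_map_class[OF g])
    show "realisation_map Y f (realisation_map X ?g z) = z" if "z \<in> topspace (realisation Y)" for z
      using that fg unfolding topspace_realisation[OF Y]
      by (auto elim!: glue_classE simp: realisation_map_class[OF f] realisation_map_class[OF g])
  qed
  then show ?thesis using f by (simp add: weak_equivalence_def)
qed

section \<open>Constant simplicial sets\<close>

text \<open>\<open>cst 0 i\<close> is the inclusion of the vertex \<open>i\<close>, and
  \<open>cst n 0\<close> is the unique operator to the terminal ordinal; thus
  \<open>act X n 0 (cst n 0)\<close> is the total degeneracy of a vertex.\<close>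

definition cst :: "nat \<Rightarrow> nat \<Rightarrow> nat \<Rightarrow> nat" where
  "cst l i = (\<lambda>j\<in>{..l}. i)"

definition edge :: "nat \<Rightarrow> nat \<Rightarrow> nat \<Rightarrow> nat" where
  "edge i j = (\<lambda>k\<in>{..1}. if k = 0 then i else j)"

lemma DeltaI: "\<theta> \<in> {..n} \<rightarrow>\<^sub>E {..m} \<Longrightarrow> mono_on {..n} \<theta> \<Longrightarrow> \<theta> \<in> Delta n m"
  by (simp add: Delta_def)

lemma Delta_ext: "\<theta> \<in> Delta n m \<Longrightarrow> \<theta> \<in> extensional {..n}"
  by (auto simp: Delta_def PiE_def)

lemma Delta_le: "\<theta> \<in> Delta n m \<Longrightarrow> i \<le> n \<Longrightarrow> \<theta> i \<le> m"
  by (auto simp: Delta_def)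

lemma Delta_mono: "\<theta> \<in> Delta n m \<Longrightarrow> i \<le> j \<Longrightarrow> j \<le> n \<Longrightarrow> \<theta> i \<le> \<theta> j"
  by (auto simp: Delta_def mono_on_def)

lemma Delta_comp: "\<phi> \<in> Delta l n \<Longrightarrow> \<theta> \<in> Delta n m \<Longrightarrow> compose {..l} \<theta> \<phi> \<in> Delta l m"
  by (auto simp: Delta_def compose_def mono_on_def PiE_def Pi_def)

lemma Delta_id [simp]: "(\<lambda>j\<in>{..n}. j) \<in> Delta n n"
  by (auto intro!: DeltaI simp: mono_on_def split: if_splits)

lemma cst_Delta [simp]: "i \<le> m \<Longrightarrow> cst l i \<in> Delta l m"
  by (auto intro!: DeltaI simp: mono_on_def cst_def split: if_splits)

lemma edge_Delta: "i \<le> j \<Longrightarrow> j \<le> m \<Longrightarrow> edge i j \<in> Delta 1 m"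
  by (auto intro!: DeltaI simp: mono_on_def edge_def split: if_splits)

lemma const0_cst: "const0 n = cst n 0"
  by (simp add: const0_def cst_def)

lemma coface_0 [simp]: "coface 0 0 = cst 0 1" "coface 0 (Suc 0) = cst 0 0"
  by (auto simp: coface_def cst_def fun_eq_iff)

lemma Delta_to_0: "\<theta> \<in> Delta n 0 \<Longrightarrow> \<theta> = cst n 0"
  using Delta_ext[of \<theta> n 0] Delta_le[of \<theta> n 0] by (auto simp: cst_def fun_eq_iff extensional_def)

lemma id_0: "(\<lambda>j\<in>{..0}. j) = cst 0 0"
  by (auto simp: cst_def fun_eq_iff)

lemma compose_cst_right: "i \<le> n \<Longrightarrow> compose {..l} \<theta> (cst l i) = cst l (\<theta> i)"
  by (auto simp: compose_def cst_def fun_eq_iff)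

lemma compose_cst_left: "\<phi> \<in> Delta l n \<Longrightarrow> compose {..l} (cst n i) \<phi> = cst l i"
  by (auto simp: compose_def cst_def fun_eq_iff Delta_le)

lemma cst_apply [simp]: "j \<le> l \<Longrightarrow> cst l i j = i"
  by (simp add: cst_def)

lemma compose_point [simp]: "compose {0} \<theta> (cst 0 i) = cst 0 (\<theta> i)"
  by (auto simp: compose_def cst_def fun_eq_iff)

lemma compose_edge: "compose {..0} (edge i j) (cst 0 0) = cst 0 i" "compose {..0} (edge i j) (cst 0 1) = cst 0 j"
  by (auto simp: compose_def cst_def edge_def fun_eq_iff)

lemma compose_id_left: "\<tau> \<in> Delta l n \<Longrightarrow> compose {..l} (\<lambda>j\<in>{..n}. j) \<tau> = \<tau>"
  using Delta_ext[of \<tau> l n] by (auto simp: compose_def fun_eq_iff extensional_def Delta_le)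

lemma compose_id_right: "\<tau> \<in> Delta l n \<Longrightarrow> compose {..l} \<tau> (\<lambda>j\<in>{..l}. j) = \<tau>"
  using Delta_ext[of \<tau> l n] by (auto simp: compose_def fun_eq_iff extensional_def)

lemma compose_compose:
  "\<sigma> \<in> Delta l p \<Longrightarrow> compose {..l} (compose {..p} \<theta> \<tau>) \<sigma> = compose {..l} \<theta> (compose {..l} \<tau> \<sigma>)"
  by (auto simp: compose_def fun_eq_iff Delta_le)

lemma is_ssetI:
  assumes "\<And>n m \<theta> x. \<theta> \<in> Delta n m \<Longrightarrow> x \<in> simp X m \<Longrightarrow> act X n m \<theta> x \<in> simp X n"
    and "\<And>n x. x \<in> simp X n \<Longrightarrow> act X n n (\<lambda>j\<in>{..n}. j) x = x"
    and "\<And>l n m \<phi> \<theta> x. \<phi> \<in> Delta l n \<Longrightarrow> \<theta> \<in> Delta n m \<Longrightarrow> x \<in> simp X m \<Longrightarrow>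
      act X l m (compose {..l} \<theta> \<phi>) x = act X l n \<phi> (act X n m \<theta> x)"
  shows "is_sset X"
  using assms unfolding is_sset_def by auto

lemma simp_std [simp]: "simp (std m) n = Delta n m"
  by (simp add: std_def)

lemma std_sset: "is_sset (std m)"
  by (rule is_ssetI) (auto simp: std_def Delta_comp compose_id_right compose_compose)

lemma disc_sset_sset: "is_sset (disc_sset S)"
  by (rule is_ssetI) (auto simp: disc_sset_def)

lemma sset_prod_sset: "is_sset X \<Longrightarrow> is_sset Y \<Longrightarrow> is_sset (sset_prod X Y)"
  by (rule is_ssetI) (auto simp: sset_prod_def sset_act_closed sset_act_id sset_act_comp)

lemma sset_pullback_sset:
  assumes "sset_map X Z f" "sset_map Y Z g"
  shows "is_sset (sset_pullback X Y f g)"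
  using sset_map_ssets(1)[OF assms(1)] sset_map_ssets(1)[OF assms(2)]
  by (intro is_ssetI) (auto simp: sset_pullback_def sset_prod_def sset_act_closed sset_act_id
      sset_act_comp sset_map_act[OF assms(1)] sset_map_act[OF assms(2)])

text \<open>Up to isomorphism these are the discrete simplicial sets.\<close>

definition constant_sset :: "'a sset \<Rightarrow> bool" where
  "constant_sset X \<longleftrightarrow> is_sset X \<and>
     (\<forall>n. \<forall>i\<le>n. \<forall>x\<in>simp X n. act X n 0 (cst n 0) (act X 0 n (cst 0 i) x) = x)"

lemma constant_sset_sset: "constant_sset X \<Longrightarrow> is_sset X"
  by (simp add: constant_sset_def)

lemma constant_degenerate:
  "constant_sset X \<Longrightarrow> i \<le> n \<Longrightarrow> x \<in> simp X n \<Longrightarrow> act X n 0 (cst n 0) (act X 0 n (cst 0 i) x) = x"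
  by (simp add: constant_sset_def)

lemma vertex_degenerate:
  assumes "is_sset X" "x \<in> simp X 0" "i \<le> n"
  shows "act X 0 n (cst 0 i) (act X n 0 (cst n 0) x) = x"
proof -
  have "act X 0 n (cst 0 i) (act X n 0 (cst n 0) x) = act X 0 0 (cst 0 0) x"
    using sset_act_comp[OF assms(1), of "cst 0 i" 0 n "cst n 0" 0 x] assms
    by simp
  then show ?thesis using sset_act_id[OF assms(1,2)] unfolding id_0 by simp
qed

lemma act_degenerate:
  assumes "is_sset X" "x \<in> simp X 0" "\<theta> \<in> Delta n m"
  shows "act X n m \<theta> (act X m 0 (cst m 0) x) = act X n 0 (cst n 0) x"
  using sset_act_comp[OF assms(1) assms(3), of "cst m 0" 0 x] assms
  by (simp add: compose_cst_left[OF assms(3)])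

text \<open>A simplex is the total degeneracy of its vertex \<open>j\<close>, and every vertex of a
  totally degenerate simplex is the one it came from.\<close>

lemma constant_vertex_unique:
  assumes X: "constant_sset X" and x: "x \<in> simp X n" and i: "i \<le> n" "j \<le> n"
  shows "act X 0 n (cst 0 i) x = act X 0 n (cst 0 j) x"
proof -
  note Xs = constant_sset_sset[OF X]
  have "act X 0 n (cst 0 i) x = act X 0 n (cst 0 i) (act X n 0 (cst n 0) (act X 0 n (cst 0 j) x))"
    using constant_degenerate[OF X i(2) x] by simp
  also have "\<dots> = act X 0 n (cst 0 j) x"
    using vertex_degenerate[OF Xs sset_act_closed[OF Xs _ x] i(1)] i(2) by simp
  finally show ?thesis .
qed

lemma disc_sset_constant: "constant_sset (disc_sset S)"
  using disc_sset_sset by (auto simp: constant_sset_def disc_sset_def)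

lemma sset_pullback_constant:
  assumes "sset_map X Z f" "sset_map Y Z g" "constant_sset X" "constant_sset Y"
  shows "constant_sset (sset_pullback X Y f g)"
  using sset_pullback_sset[OF assms(1,2)] constant_degenerate[OF assms(3)]
    constant_degenerate[OF assms(4)]
  by (auto simp: constant_sset_def sset_pullback_def sset_prod_def)

lemma map_to_constant:
  assumes f: "sset_map A X f" and X: "constant_sset X" and a: "a \<in> simp A n" and i: "i \<le> n"
  shows "f n a = act X n 0 (cst n 0) (f 0 (act A 0 n (cst 0 i) a))"
  using constant_degenerate[OF X i sset_map_closed[OF f a]] sset_map_act[OF f _ a, of "cst 0 i" 0] i
  by simp

lemma map_to_constant_edge:
  assumes f: "sset_map A X f" and X: "constant_sset X" and e: "e \<in> simp A 1"
  shows "f 0 (act A 0 1 (cst 0 0) e) = f 0 (act A 0 1 (cst 0 1) e)"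
  using constant_vertex_unique[OF X sset_map_closed[OF f e], of 0 1] sset_map_act[OF f _ e, of _ 0]
  by simp

text \<open>In a constant simplicial set, taking a vertex and total degeneracy are mutually inverse.
  Both commute with \<open>f\<close>, so bijectivity passes from degree 0 to all degrees.\<close>

lemma constant_bijective:
  assumes f: "sset_map X Y f" and X: "constant_sset X" and Y: "constant_sset Y"
    and bij: "bij_betw (f 0) (simp X 0) (simp Y 0)"
  shows "bij_betw (f n) (simp X n) (simp Y n)"
proof (rule bij_betwI')
  note Xs = constant_sset_sset[OF X] and Ys = constant_sset_sset[OF Y]
  note v = sset_act_closed[OF Xs cst_Delta[of 0 n 0]] sset_act_closed[OF Ys cst_Delta[of 0 n 0]]
  show "f n x \<in> simp Y n" if "x \<in> simp X n" for x using sset_map_closed[OF f that] .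
  show "f n x = f n y \<longleftrightarrow> x = y" if x: "x \<in> simp X n" and y: "y \<in> simp X n" for x y
  proof
    assume "f n x = f n y"
    then have "f 0 (act X 0 n (cst 0 0) x) = f 0 (act X 0 n (cst 0 0) y)"
      using sset_map_act[OF f _ x, of "cst 0 0" 0] sset_map_act[OF f _ y, of "cst 0 0" 0] by simp
    then have "act X 0 n (cst 0 0) x = act X 0 n (cst 0 0) y"
      using bij v(1) x y by (auto simp: bij_betw_def inj_on_def)
    then show "x = y" using constant_degenerate[OF X, of 0 n] x y by (metis le0)
  qed simp
  show "\<exists>x\<in>simp X n. y = f n x" if y: "y \<in> simp Y n" for y
  proof -
    obtain x where x: "x \<in> simp X 0" "f 0 x = act Y 0 n (cst 0 0) y"
      using bij v(2)[OF _ y] unfolding bij_betw_def by (metis imageE le0)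
    have "y = f n (act X n 0 (cst n 0) x)"
      using constant_degenerate[OF Y, of 0 n y] y sset_map_act[OF f _ x(1), of "cst n 0" n] x(2) by simp
    moreover have "act X n 0 (cst n 0) x \<in> simp X n" using sset_act_closed[OF Xs _ x(1)] by simp
    ultimately show ?thesis by blast
  qed
qed

lemma constant_weak_equivalence:
  assumes "sset_map X Y f" "constant_sset X" "constant_sset Y"
    and "bij_betw (f 0) (simp X 0) (simp Y 0)"
  shows "weak_equivalence X Y f"
  using bijective_weak_equivalence[OF assms(1)] constant_bijective[OF assms] by blast

text \<open>A map to a constant simplicial set takes equal values at the ends of an edge. Any two
  vertices of the standard simplex are joined by an edge, so the map is constant.\<close>

lemma std_map_constant:
  assumes f: "sset_map (std m) X f" and X: "constant_sset X" and \<theta>: "\<theta> \<in> Delta n m" and k: "k \<le> m"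
  shows "f n \<theta> = act X n 0 (cst n 0) (f 0 (cst 0 k))"
proof -
  let ?i = "\<theta> 0"
  have i: "?i \<le> m" using Delta_le[OF \<theta>] by simp
  have "f 0 (cst 0 a) = f 0 (cst 0 b)" if "a \<le> b" "b \<le> m" for a b
    using map_to_constant_edge[OF f X, of "edge a b"] edge_Delta[OF that] compose_edge
    by (simp add: std_def)
  then have "f 0 (cst 0 ?i) = f 0 (cst 0 k)" using i k by (metis nle_le)
  moreover have "f n \<theta> = act X n 0 (cst n 0) (f 0 (cst 0 ?i))"
    using map_to_constant[OF f X, of \<theta> n 0] \<theta> by (simp add: std_def)
  ultimately show ?thesis by simp
qed

text \<open>The vertex \<open>k\<close> is joined inside the horn to the vertex
  \<open>\<theta> 0\<close> of any simplex \<open>\<theta>\<close> of the horn: the edge and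
  \<open>k\<close> together cover no more than \<open>\<theta>\<close> and \<open>k\<close> do. The
  two ends can come in either order, whence the auxiliary \<open>a\<close> and
  \<open>b\<close>.\<close>

lemma horn_map_constant:
  assumes f: "sset_map (horn m k) X f" and X: "constant_sset X" and \<theta>: "\<theta> \<in> simp (horn m k) n"
    and k: "k \<le> m"
  shows "f n \<theta> = act X n 0 (cst n 0) (f 0 (cst 0 k))"
proof -
  let ?i = "\<theta> 0"
  have \<theta>': "\<theta> \<in> Delta n m" "\<theta> ` {..n} \<union> {k} \<noteq> {..m}" using \<theta> by (auto simp: horn_def)
  have i: "?i \<le> m" using Delta_le[OF \<theta>'(1)] by simp
  have sub: "\<theta> ` {..n} \<union> {k} \<subset> {..m}" using \<theta>' k Delta_le[OF \<theta>'(1)] by auto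
  have e: "edge a b \<in> simp (horn m k) 1" if "a \<le> b" "{a, b} = {?i, k}" for a b
  proof -
    have "edge a b ` {..1} = {a, b}" by (auto simp: edge_def atMost_Suc)
    then have "edge a b ` {..1} \<union> {k} \<subseteq> \<theta> ` {..n} \<union> {k}" using that(2) by auto
    then have "edge a b ` {..1} \<union> {k} \<noteq> {..m}" using sub by blast
    moreover have "b \<le> m" using that(2) i k by (metis insertCI insertE singletonD)
    ultimately show ?thesis using edge_Delta[OF that(1)] by (simp add: horn_def)
  qed
  have "f 0 (cst 0 a) = f 0 (cst 0 b)" if "a \<le> b" "{a, b} = {?i, k}" for a b
    using map_to_constant_edge[OF f X e[OF that]] compose_edge
    by (simp add: horn_def std_def)
  then have "f 0 (cst 0 ?i) = f 0 (cst 0 k)" by (metis insert_commute nle_le)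
  moreover have "f n \<theta> = act X n 0 (cst n 0) (f 0 (cst 0 ?i))"
    using map_to_constant[OF f X \<theta>, of 0] by (simp add: horn_def std_def)
  ultimately show ?thesis by simp
qed

text \<open>The horn in \<open>X\<close> and the simplex in \<open>Y\<close> are both constant by
  the two preceding lemmas, so the constant simplex at the value of the horn on vertex
  \<open>k\<close> solves the lifting problem.\<close>

lemma constant_kan_fibration:
  assumes p: "sset_map X Y p" and X: "constant_sset X" and Y: "constant_sset Y"
  shows "kan_fibration X Y p"
  unfolding kan_fibration_def
proof (intro conjI allI impI p)
  fix m k u v
  assume "1 \<le> m" and k: "k \<le> m" and "sset_map (horn m k) X u \<and> sset_map (std m) Y v \<and>
    (\<forall>n. \<forall>\<theta>\<in>simp (horn m k) n. p n (u n \<theta>) = v n \<theta>)"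
  then have u: "sset_map (horn m k) X u" and v: "sset_map (std m) Y v"
    and uv: "\<And>n \<theta>. \<theta> \<in> simp (horn m k) n \<Longrightarrow> p n (u n \<theta>) = v n \<theta>" by auto
  note Xs = constant_sset_sset[OF X]
  \<comment> \<open>The vertex \<open>k\<close> lies in the horn because \<open>1 \<le> m\<close>
    leaves some other vertex uncovered.\<close>
  have "cst 0 k ` {..0} \<union> {k} = {k}" by (auto simp: cst_def)
  moreover have "{k} \<noteq> {..m}"
  proof
    assume "{k} = {..m}"
    then have "0 \<in> {k}" "m \<in> {k}" by simp_all
    with \<open>1 \<le> m\<close> show False by simp
  qed
  ultimately have "cst 0 k ` {..0} \<union> {k} \<noteq> {..m}" by simp
  then have c: "cst 0 k \<in> simp (horn m k) 0" using k by (simp add: horn_def)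
  define x where "x = u 0 (cst 0 k)"
  have x: "x \<in> simp X 0" unfolding x_def using sset_map_closed[OF u c] .
  define w where "w n = (\<lambda>\<theta>\<in>Delta n m. act X n 0 (cst n 0) x)" for n
  have "sset_map (std m) X w"
    using x sset_act_closed[OF Xs] act_degenerate[OF Xs x]
    by (intro sset_mapI[OF std_sset Xs]) (auto simp: w_def std_def Delta_comp)
  moreover have "w n \<theta> = u n \<theta>" if "\<theta> \<in> simp (horn m k) n" for n \<theta>
    using horn_map_constant[OF u X that k] that by (simp add: w_def x_def horn_def)
  moreover have "p n (w n \<theta>) = v n \<theta>" if "\<theta> \<in> simp (std m) n" for n \<theta>
  proof -
    have \<theta>: "\<theta> \<in> Delta n m" using that by (simp add: std_def)
    then have "p n (w n \<theta>) = act Y n 0 (cst n 0) (v 0 (cst 0 k))"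
      using sset_map_act[OF p _ x, of "cst n 0" n] uv[OF c] by (simp add: w_def x_def)
    then show ?thesis using std_map_constant[OF v Y \<theta> k] by simp
  qed
  ultimately show "\<exists>w. sset_map (std m) X w \<and> (\<forall>n. \<forall>\<theta>\<in>simp (horn m k) n. w n \<theta> = u n \<theta>) \<and>
     (\<forall>n. \<forall>\<theta>\<in>simp (std m) n. p n (w n \<theta>) = v n \<theta>)" by blast
qed


section \<open>Mapping spaces and Reedy fibrations between levelwise constant simplicial spaces\<close>

lemma sspace_level:
  assumes "is_sspace X"
  shows "is_sset (level X m)"
proof -
  have "sset_map (level X m) (level X m) (\<lambda>k. restrict (hact X m m (\<lambda>j\<in>{..m}. j) k) (pts X m k))"
    using assms Delta_id unfolding is_sspace_def by blast
  then show ?thesis by (rule sset_map_ssets)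
qed

lemma hact_sset_map:
  "is_sspace X \<Longrightarrow> \<theta> \<in> Delta n m \<Longrightarrow>
     sset_map (level X m) (level X n) (\<lambda>k. restrict (hact X n m \<theta> k) (pts X m k))"
  unfolding is_sspace_def by blast

lemma hact_closed:
  "is_sspace X \<Longrightarrow> \<theta> \<in> Delta n m \<Longrightarrow> x \<in> pts X m k \<Longrightarrow> hact X n m \<theta> k x \<in> pts X n k"
  using sset_map_closed[OF hact_sset_map, of X \<theta> n m x k] by (simp add: pts_def)

lemma level_act_closed:
  "is_sspace X \<Longrightarrow> \<tau> \<in> Delta k l \<Longrightarrow> x \<in> pts X m l \<Longrightarrow> act (level X m) k l \<tau> x \<in> pts X m k"
  unfolding pts_def using sspace_level sset_act_closed by metis

lemma hact_natural:
  assumes X: "is_sspace X" and \<theta>: "\<theta> \<in> Delta n m" and \<tau>: "\<tau> \<in> Delta k l" and x: "x \<in> pts X m l"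
  shows "hact X n m \<theta> k (act (level X m) k l \<tau> x) = act (level X n) k l \<tau> (hact X n m \<theta> l x)"
  using sset_map_act[OF hact_sset_map[OF X \<theta>] \<tau>, of x] x level_act_closed[OF X \<tau> x]
  by (simp add: pts_def)

lemma hact_id: "is_sspace X \<Longrightarrow> x \<in> pts X n k \<Longrightarrow> hact X n n (\<lambda>j\<in>{..n}. j) k x = x"
  unfolding is_sspace_def by blast

lemma hact_comp:
  "is_sspace X \<Longrightarrow> \<phi> \<in> Delta l n \<Longrightarrow> \<theta> \<in> Delta n m \<Longrightarrow> x \<in> pts X m k \<Longrightarrow>
    hact X l n \<phi> k (hact X n m \<theta> k x) = hact X l m (compose {..l} \<theta> \<phi>) k x"
  unfolding is_sspace_def by metis

lemma is_sspaceI: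
  assumes "\<And>m. is_sset (level X m)"
    and "\<And>n m \<theta> x k. \<theta> \<in> Delta n m \<Longrightarrow> x \<in> pts X m k \<Longrightarrow> hact X n m \<theta> k x \<in> pts X n k"
    and "\<And>n m k l \<theta> \<tau> x. \<theta> \<in> Delta n m \<Longrightarrow> \<tau> \<in> Delta k l \<Longrightarrow> x \<in> pts X m l \<Longrightarrow>
      hact X n m \<theta> k (act (level X m) k l \<tau> x) = act (level X n) k l \<tau> (hact X n m \<theta> l x)"
    and "\<And>n k x. x \<in> pts X n k \<Longrightarrow> hact X n n (\<lambda>j\<in>{..n}. j) k x = x"
    and "\<And>l n m k \<phi> \<theta> x. \<phi> \<in> Delta l n \<Longrightarrow> \<theta> \<in> Delta n m \<Longrightarrow> x \<in> pts X m k \<Longrightarrow>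
      hact X l m (compose {..l} \<theta> \<phi>) k x = hact X l n \<phi> k (hact X n m \<theta> k x)"
  shows "is_sspace X"
  unfolding is_sspace_def
proof (intro conjI allI ballI)
  fix n m \<theta> assume \<theta>: "\<theta> \<in> Delta n m"
  show "sset_map (level X m) (level X n) (\<lambda>k. restrict (hact X n m \<theta> k) (pts X m k))"
    using assms(2,3)[OF \<theta>] sset_act_closed[OF assms(1)]
    by (intro sset_mapI assms(1)) (auto simp: pts_def)
qed (use assms in auto)

lemma sspace_map_sspaces: "sspace_map X Y f \<Longrightarrow> is_sspace X" "sspace_map X Y f \<Longrightarrow> is_sspace Y"
  unfolding sspace_map_def by auto

lemma sspace_map_level: "sspace_map X Y f \<Longrightarrow> sset_map (level X m) (level Y m) (f m)"
  unfolding sspace_map_def by auto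

lemma sspace_map_ext: "sspace_map X Y f \<Longrightarrow> f m n \<in> pts X m n \<rightarrow>\<^sub>E pts Y m n"
  unfolding pts_def using sset_map_ext sspace_map_level by metis

lemma sspace_map_closed: "sspace_map X Y f \<Longrightarrow> x \<in> pts X m n \<Longrightarrow> f m n x \<in> pts Y m n"
  using sspace_map_ext by blast

lemma sspace_map_act:
  "sspace_map X Y f \<Longrightarrow> \<tau> \<in> Delta k l \<Longrightarrow> x \<in> pts X m l \<Longrightarrow>
     f m k (act (level X m) k l \<tau> x) = act (level Y m) k l \<tau> (f m l x)"
  unfolding pts_def using sset_map_act sspace_map_level by metis

lemma sspace_map_hact:
  "sspace_map X Y f \<Longrightarrow> \<theta> \<in> Delta n m \<Longrightarrow> x \<in> pts X m k \<Longrightarrow>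
     f n k (hact X n m \<theta> k x) = hact Y n m \<theta> k (f m k x)"
  unfolding sspace_map_def by auto

lemma sspace_mapI:
  assumes "is_sspace X" "is_sspace Y" "\<And>m n. f m n \<in> pts X m n \<rightarrow>\<^sub>E pts Y m n"
    and "\<And>k l m \<tau> x. \<tau> \<in> Delta k l \<Longrightarrow> x \<in> pts X m l \<Longrightarrow>
      f m k (act (level X m) k l \<tau> x) = act (level Y m) k l \<tau> (f m l x)"
    and "\<And>n m k \<theta> x. \<theta> \<in> Delta n m \<Longrightarrow> x \<in> pts X m k \<Longrightarrow>
      f n k (hact X n m \<theta> k x) = hact Y n m \<theta> k (f m k x)"
  shows "sspace_map X Y f"
  unfolding sspace_map_def
proof (intro conjI allI ballI assms)
  show "sset_map (level X m) (level Y m) (f m)" for m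
    using assms(3,4)[unfolded pts_def] by (intro sset_mapI sspace_level assms(1,2))
qed

lemma sspace_comp_map:
  assumes f: "sspace_map X Y f" and g: "sspace_map Y Z g"
  shows "sspace_map X Z (sspace_comp X g f)"
  using sspace_map_sspaces(1)[OF f] sspace_map_sspaces(2)[OF g]
  by (intro sspace_mapI) (auto simp: sspace_comp_def compose_def level_act_closed hact_closed
      sspace_map_closed[OF f] sspace_map_closed[OF g] sspace_map_act[OF f] sspace_map_act[OF g]
      sspace_map_hact[OF f] sspace_map_hact[OF g])

lemma pts_simps [simp]:
  "pts (hdisc A) m n = simp A m" "pts (const_sspace A) m n = simp A n"
  "pts (sspace_prod X Y) m n = pts X m n \<times> pts Y m n"
  by (auto simp: pts_def hdisc_def const_sspace_def sspace_prod_def disc_sset_def sset_prod_def)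

lemma hdisc_sspace: "is_sset A \<Longrightarrow> is_sspace (hdisc A)"
proof (rule is_sspaceI, goal_cases)
  case (1 m) then show ?case by (simp add: hdisc_def disc_sset_sset)
next
  case 3 then show ?case by (simp add: hdisc_def disc_sset_def)
qed (auto simp: sset_act_closed sset_act_id sset_act_comp hdisc_def[THEN arg_cong[of _ _ hact]])

lemma const_sspace_sspace: "is_sset A \<Longrightarrow> is_sspace (const_sspace A)"
proof (rule is_sspaceI, goal_cases)
  case (1 m) then show ?case by (simp add: const_sspace_def)
qed (auto simp: const_sspace_def[THEN arg_cong[of _ _ hact]] const_sspace_def[THEN arg_cong[of _ _ level]])

lemma sspace_prod_acts:
  "act (level (sspace_prod X Y) m) k l \<tau> (x, y) = (act (level X m) k l \<tau> x, act (level Y m) k l \<tau> y)"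
  "hact (sspace_prod X Y) n m \<theta> k (x, y) = (hact X n m \<theta> k x, hact Y n m \<theta> k y)"
  by (auto simp: sspace_prod_def sset_prod_def)

lemma sspace_prod_sspace: "is_sspace X \<Longrightarrow> is_sspace Y \<Longrightarrow> is_sspace (sspace_prod X Y)"
proof (rule is_sspaceI, goal_cases)
  case (1 m) then show ?case by (simp add: sspace_prod_def sset_prod_sset sspace_level)
qed (auto simp: sspace_prod_acts hact_closed hact_natural hact_id hact_comp)

text \<open>Spells out naturality on pairs. The simplex factor is constant in the category
  direction, so \<open>hact\<close> leaves \<open>\<tau>\<close> fixed, while the space direction
  acts on both entries.\<close>

lemma prod_std_map_iff:
  assumes K: "is_sspace K" and X: "is_sspace X"
  shows "sspace_map (sspace_prod K (const_sspace (std n))) X \<phi> \<longleftrightarrow>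
    (\<forall>k l. \<phi> k l \<in> pts K k l \<times> Delta l n \<rightarrow>\<^sub>E pts X k l) \<and>
    (\<forall>k l p \<sigma> x \<tau>. \<sigma> \<in> Delta l p \<longrightarrow> x \<in> pts K k p \<longrightarrow> \<tau> \<in> Delta p n \<longrightarrow>
       \<phi> k l (act (level K k) l p \<sigma> x, compose {..l} \<tau> \<sigma>) = act (level X k) l p \<sigma> (\<phi> k p (x, \<tau>))) \<and>
    (\<forall>j k l \<theta> x \<tau>. \<theta> \<in> Delta j k \<longrightarrow> x \<in> pts K k l \<longrightarrow> \<tau> \<in> Delta l n \<longrightarrow>
       \<phi> j l (hact K j k \<theta> l x, \<tau>) = hact X j k \<theta> l (\<phi> k l (x, \<tau>)))"
  (is "?L \<longleftrightarrow> ?A \<and> ?B \<and> ?C")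
proof -
  let ?P = "sspace_prod K (const_sspace (std n))"
  have P: "is_sspace ?P" by (intro sspace_prod_sspace K const_sspace_sspace std_sset)
  have pts: "pts ?P k l = pts K k l \<times> Delta l n" for k l by (simp add: std_def)
  have act: "act (level ?P k) l p \<sigma> (x, \<tau>) = (act (level K k) l p \<sigma> x, compose {..l} \<tau> \<sigma>)"
    for k l p \<sigma> x \<tau> by (simp add: sspace_prod_def sset_prod_def const_sspace_def std_def)
  have hact: "hact ?P j k \<theta> l (x, \<tau>) = (hact K j k \<theta> l x, \<tau>)"
    for j k l \<theta> x \<tau> by (simp add: sspace_prod_def const_sspace_def)
  show ?thesis
  proof
    assume \<phi>: ?L
    show "?A \<and> ?B \<and> ?C"
    proof (intro conjI allI impI)
      show "\<phi> k l \<in> pts K k l \<times> Delta l n \<rightarrow>\<^sub>E pts X k l" for k l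
        using sspace_map_ext[OF \<phi>, of k l] unfolding pts .
      show "\<phi> k l (act (level K k) l p \<sigma> x, compose {..l} \<tau> \<sigma>) = act (level X k) l p \<sigma> (\<phi> k p (x, \<tau>))"
        if "\<sigma> \<in> Delta l p" "x \<in> pts K k p" "\<tau> \<in> Delta p n" for k l p \<sigma> x \<tau>
        using sspace_map_act[OF \<phi> that(1), of "(x, \<tau>)" k] that by (simp add: pts act)
      show "\<phi> j l (hact K j k \<theta> l x, \<tau>) = hact X j k \<theta> l (\<phi> k l (x, \<tau>))"
        if "\<theta> \<in> Delta j k" "x \<in> pts K k l" "\<tau> \<in> Delta l n" for j k l \<theta> x \<tau>
        using sspace_map_hact[OF \<phi> that(1), of "(x, \<tau>)" l] that by (simp add: pts hact)
    qed
  next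
    assume R: "?A \<and> ?B \<and> ?C"
    show ?L
    proof (rule sspace_mapI[OF P X])
      show "\<phi> k l \<in> pts ?P k l \<rightarrow>\<^sub>E pts X k l" for k l using R unfolding pts by blast
    qed (use R in \<open>auto simp: act hact\<close>)
  qed
qed

section \<open>Simplices and structure maps of mapping spaces\<close>

lemma MapS_simps:
  "simp (MapS K X) n = {\<phi>. sspace_map (sspace_prod K (const_sspace (std n))) X \<phi>}"
  "act (MapS K X) n m \<theta> \<phi> = (\<lambda>k l. \<lambda>(x, \<tau>)\<in>pts K k l \<times> Delta l n. \<phi> k l (x, compose {..l} \<theta> \<tau>))"
  by (auto simp: MapS_def)

lemma MapS_point_closed:
  "is_sspace K \<Longrightarrow> is_sspace X \<Longrightarrow> \<phi> \<in> simp (MapS K X) n \<Longrightarrow> x \<in> pts K k l \<Longrightarrow> \<tau> \<in> Delta l n \<Longrightarrow>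
     \<phi> k l (x, \<tau>) \<in> pts X k l"
  by (simp add: MapS_simps prod_std_map_iff) blast

lemma MapS_act:
  "is_sspace K \<Longrightarrow> is_sspace X \<Longrightarrow> \<phi> \<in> simp (MapS K X) n \<Longrightarrow> \<sigma> \<in> Delta l p \<Longrightarrow> x \<in> pts K k p \<Longrightarrow>
     \<tau> \<in> Delta p n \<Longrightarrow>
     \<phi> k l (act (level K k) l p \<sigma> x, compose {..l} \<tau> \<sigma>) = act (level X k) l p \<sigma> (\<phi> k p (x, \<tau>))"
  by (simp add: MapS_simps prod_std_map_iff)

lemma MapS_hact:
  "is_sspace K \<Longrightarrow> is_sspace X \<Longrightarrow> \<phi> \<in> simp (MapS K X) n \<Longrightarrow> \<theta> \<in> Delta j k \<Longrightarrow> x \<in> pts K k l \<Longrightarrow>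
     \<tau> \<in> Delta l n \<Longrightarrow> \<phi> j l (hact K j k \<theta> l x, \<tau>) = hact X j k \<theta> l (\<phi> k l (x, \<tau>))"
  by (simp add: MapS_simps prod_std_map_iff)

lemma MapS_eqI:
  assumes K: "is_sspace K" and X: "is_sspace X"
    and \<phi>: "\<phi> \<in> simp (MapS K X) n" and \<psi>: "\<psi> \<in> simp (MapS K X) n"
    and eq: "\<And>k l x \<tau>. x \<in> pts K k l \<Longrightarrow> \<tau> \<in> Delta l n \<Longrightarrow> \<phi> k l (x, \<tau>) = \<psi> k l (x, \<tau>)"
  shows "\<phi> = \<psi>"
proof (intro ext)
  fix k l z
  show "\<phi> k l z = \<psi> k l z"
  proof (cases "z \<in> pts K k l \<times> Delta l n")
    case True
    then show ?thesis using eq[of "fst z" k l "snd z"] by auto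
  next
    case False
    have "\<phi> k l \<in> extensional (pts K k l \<times> Delta l n)" "\<psi> k l \<in> extensional (pts K k l \<times> Delta l n)"
      using \<phi> \<psi> by (auto simp: MapS_simps prod_std_map_iff[OF K X] PiE_def)
    then show ?thesis using extensional_arb[OF _ False] by metis
  qed
qed

lemma MapS_sset:
  assumes K: "is_sspace K" and X: "is_sspace X"
  shows "is_sset (MapS K X)"
proof (rule is_ssetI)
  fix n m \<theta> \<phi> assume \<theta>: "\<theta> \<in> Delta n m" and \<phi>: "\<phi> \<in> simp (MapS K X) m"
  show "act (MapS K X) n m \<theta> \<phi> \<in> simp (MapS K X) n"
    unfolding MapS_simps(1) mem_Collect_eq prod_std_map_iff[OF K X] MapS_simps(2)
  proof (intro conjI allI impI)
    fix k l p \<sigma> x \<tau> assume h: "\<sigma> \<in> Delta l p" "x \<in> pts K k p" "\<tau> \<in> Delta p n"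
    show "(\<lambda>(x, \<tau>)\<in>pts K k l \<times> Delta l n. \<phi> k l (x, compose {..l} \<theta> \<tau>))
          (act (level K k) l p \<sigma> x, compose {..l} \<tau> \<sigma>) =
        act (level X k) l p \<sigma> ((\<lambda>(x, \<tau>)\<in>pts K k p \<times> Delta p n. \<phi> k p (x, compose {..p} \<theta> \<tau>)) (x, \<tau>))"
      using h MapS_act[OF K X \<phi> h(1,2) Delta_comp[OF h(3) \<theta>]]
      by (simp add: level_act_closed[OF K] Delta_comp compose_compose[OF h(1)])
  qed (auto simp: MapS_point_closed[OF K X \<phi>] MapS_hact[OF K X \<phi>] hact_closed[OF K] Delta_comp[OF _ \<theta>])
next
  fix n \<phi> assume \<phi>: "\<phi> \<in> simp (MapS K X) n"
  have "act (MapS K X) n n (\<lambda>j\<in>{..n}. j) \<phi> k l z = \<phi> k l z" for k l z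
  proof (cases "z \<in> pts K k l \<times> Delta l n")
    case True
    then show ?thesis by (auto simp: MapS_simps compose_id_left)
  next
    case False
    have "\<phi> k l \<in> extensional (pts K k l \<times> Delta l n)"
      using \<phi> by (auto simp: MapS_simps prod_std_map_iff[OF K X] PiE_def)
    then have "\<phi> k l z = undefined" using False by (rule extensional_arb)
    moreover have "act (MapS K X) n n (\<lambda>j\<in>{..n}. j) \<phi> k l z = undefined"
      using False unfolding MapS_simps(2) by (rule restrict_apply[THEN trans, OF if_not_P])
    ultimately show ?thesis by (rule trans[OF _ sym, rotated])
  qed
  then show "act (MapS K X) n n (\<lambda>j\<in>{..n}. j) \<phi> = \<phi>" by (intro ext)
next
  fix l n m \<phi> \<theta> \<psi> assume \<phi>: "\<phi> \<in> Delta l n" and \<theta>: "\<theta> \<in> Delta n m"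
  show "act (MapS K X) l m (compose {..l} \<theta> \<phi>) \<psi> = act (MapS K X) l n \<phi> (act (MapS K X) n m \<theta> \<psi>)"
    by (auto simp: MapS_simps fun_eq_iff restrict_def Delta_comp[OF _ \<phi>] compose_compose)
qed

text \<open>As \<open>hdisc A\<close> is discrete in the space direction, for fixed \<open>x\<close>
  the assignment of \<open>\<phi> k l (x, \<tau>)\<close> to \<open>\<tau>\<close> is a simplicial
  map from a standard simplex to \<open>level X k\<close>. Such a map is constant, so precomposing
  with the collapse to the vertex \<open>i\<close> does not change \<open>\<phi>\<close>.\<close>

lemma MapS_constant:
  assumes A: "is_sset A" and X: "is_sspace X" and const: "\<And>m. constant_sset (level X m)"
  shows "constant_sset (MapS (hdisc A) X)"
  unfolding constant_sset_def
proof (intro conjI allI impI ballI)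
  let ?K = "hdisc A"
  have K: "is_sspace ?K" using hdisc_sspace[OF A] .
  show S: "is_sset (MapS ?K X)" using MapS_sset[OF K X] .
  fix n i \<phi> assume i: "i \<le> n" and \<phi>: "\<phi> \<in> simp (MapS ?K X) n"
  let ?\<psi> = "act (MapS ?K X) n 0 (cst n 0) (act (MapS ?K X) 0 n (cst 0 i) \<phi>)"
  have "?\<psi> \<in> simp (MapS ?K X) n" using sset_act_closed[OF S] \<phi> i by simp
  then show "?\<psi> = \<phi>"
  proof (rule MapS_eqI[OF K X _ \<phi>])
    fix k l x \<tau> assume x: "x \<in> pts ?K k l" and \<tau>: "\<tau> \<in> Delta l n"
    have xA: "x \<in> simp A k" using x by simp
    have act: "act (level ?K k) l' p \<sigma> x = x" for l' p \<sigma> by (simp add: hdisc_def disc_sset_def)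
    define f where "f p = (\<lambda>\<tau>\<in>Delta p n. \<phi> k p (x, \<tau>))" for p
    have f: "sset_map (std n) (level X k) f"
    proof (rule sset_mapI[OF std_sset sspace_level[OF X]])
      show "f p \<in> simp (std n) p \<rightarrow>\<^sub>E simp (level X k) p" for p
        using MapS_point_closed[OF K X \<phi>, of x k p] xA by (auto simp: f_def std_def pts_def[of X])
      show "f l (act (std n) l p \<sigma> \<tau>) = act (level X k) l p \<sigma> (f p \<tau>)"
        if "\<sigma> \<in> Delta l p" "\<tau> \<in> simp (std n) p" for l p \<sigma> \<tau>
        using that MapS_act[OF K X \<phi> that(1), of x k \<tau>] xA by (simp add: f_def std_def act Delta_comp)
    qed
    have "cst l i \<in> Delta l n" using i by simp
    then have "f l \<tau> = f l (cst l i)"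
      using std_map_constant[OF f const \<tau> i] std_map_constant[OF f const _ i] by metis
    moreover have "?\<psi> k l (x, \<tau>) = \<phi> k l (x, cst l i)"
      using xA \<tau> i by (simp add: MapS_simps compose_cst_left[OF \<tau>] compose_cst_right compose_cst_left[of "cst l 0" l 0])
    ultimately show "?\<psi> k l (x, \<tau>) = \<phi> k l (x, \<tau>)" using \<tau> i by (simp add: f_def)
  qed
qed

text \<open>\<open>sset_map\<close> demands functions that are extensional on simplices, hence the
  \<open>restrict\<close>.\<close>

lemma MapS_postcomp:
  assumes K: "is_sspace K" and f: "sspace_map X Y f"
  shows "sset_map (MapS K X) (MapS K Y)
    (\<lambda>n. restrict (sspace_comp (sspace_prod K (const_sspace (std n))) f) (simp (MapS K X) n))"
proof -
  note X = sspace_map_sspaces(1)[OF f] and Y = sspace_map_sspaces(2)[OF f]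
  have pts: "pts (sspace_prod K (const_sspace (std n))) k l = pts K k l \<times> Delta l n" for n k l
    by (simp add: std_def)
  have c: "sspace_comp (sspace_prod K (const_sspace (std n))) f \<phi> k l
      = (\<lambda>z\<in>pts K k l \<times> Delta l n. f k l (\<phi> k l z))" for n \<phi> k l
    unfolding sspace_comp_def compose_def pts by simp
  show ?thesis
  proof (rule sset_mapI[OF MapS_sset[OF K X] MapS_sset[OF K Y]])
    fix n
    show "restrict (sspace_comp (sspace_prod K (const_sspace (std n))) f) (simp (MapS K X) n)
      \<in> simp (MapS K X) n \<rightarrow>\<^sub>E simp (MapS K Y) n"
      using sspace_comp_map[OF _ f] by (auto simp: MapS_simps)
  next
    fix n m \<theta> \<phi> assume \<theta>: "\<theta> \<in> Delta n m" and \<phi>: "\<phi> \<in> simp (MapS K X) m"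
    have "sspace_comp (sspace_prod K (const_sspace (std n))) f (act (MapS K X) n m \<theta> \<phi>) k l z
      = act (MapS K Y) n m \<theta> (sspace_comp (sspace_prod K (const_sspace (std m))) f \<phi>) k l z" for k l z
      by (cases z, cases "z \<in> pts K k l \<times> Delta l n")
        (auto simp: MapS_simps(2) c Delta_comp[OF _ \<theta>])
    then show "restrict (sspace_comp (sspace_prod K (const_sspace (std n))) f) (simp (MapS K X) n)
        (act (MapS K X) n m \<theta> \<phi>) =
      act (MapS K Y) n m \<theta> (restrict (sspace_comp (sspace_prod K (const_sspace (std m))) f) (simp (MapS K X) m) \<phi>)"
      using sset_act_closed[OF MapS_sset[OF K X] \<theta> \<phi>] \<phi> by (simp add: ext)
  qed
qed

section \<open>Restriction along subcomplexes of a standard simplex, covering boundaries and spines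
  at once\<close>

definition subcomplex_std :: "(nat \<Rightarrow> nat) sset \<Rightarrow> nat \<Rightarrow> bool" where
  "subcomplex_std A m \<longleftrightarrow> is_sset A \<and> act A = act (std m) \<and> (\<forall>n. simp A n \<subseteq> Delta n m)"

lemma bdry_subcomplex: "subcomplex_std (bdry m) m"
  unfolding subcomplex_std_def
proof (intro conjI allI is_ssetI)
  fix n l \<phi> \<theta> assume \<phi>: "\<phi> \<in> Delta n l" and \<theta>: "\<theta> \<in> simp (bdry m) l"
  have "compose {..n} \<theta> \<phi> ` {..n} \<subseteq> \<theta> ` {..l}" "\<theta> ` {..l} \<subset> {..m}"
    using \<phi> \<theta> by (auto simp: compose_def Delta_le bdry_def)
  then have "compose {..n} \<theta> \<phi> ` {..n} \<noteq> {..m}" by blast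
  then show "act (bdry m) n l \<phi> \<theta> \<in> simp (bdry m) n"
    using \<phi> \<theta> by (simp add: bdry_def std_def Delta_comp)
qed (auto simp: bdry_def std_def compose_id_right compose_compose)

lemma spine_subcomplex: "subcomplex_std (spine m) m"
  unfolding subcomplex_std_def
proof (intro conjI allI is_ssetI)
  fix n l \<phi> \<theta> assume \<phi>: "\<phi> \<in> Delta n l" and \<theta>: "\<theta> \<in> simp (spine m) l"
  have "compose {..n} \<theta> \<phi> ` {..n} \<subseteq> \<theta> ` {..l}"
    using \<phi> by (auto simp: compose_def Delta_le)
  then show "act (spine m) n l \<phi> \<theta> \<in> simp (spine m) n"
    using \<phi> \<theta> by (fastforce simp: spine_def std_def Delta_comp)
qed (auto simp: spine_def std_def compose_id_right compose_compose)

lemma restr_to_sset_map: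
  assumes A: "subcomplex_std A m" and X: "is_sspace X"
  shows "sset_map (level X m) (MapS (hdisc A) X) (restr_to (hdisc A) X m)"
proof -
  have As: "is_sset A" and sub: "\<And>n \<theta>. \<theta> \<in> simp A n \<Longrightarrow> \<theta> \<in> Delta n m"
    and actA: "act A = act (std m)" using A by (auto simp: subcomplex_std_def)
  let ?K = "hdisc A"
  have K: "is_sspace ?K" using hdisc_sspace[OF As] .
  note L = sspace_level[OF X]
  have r: "restr_to ?K X m n x k l (\<theta>, \<tau>) = hact X k m \<theta> l (act (level X m) l n \<tau> x)"
    if "x \<in> pts X m n" "\<theta> \<in> simp A k" "\<tau> \<in> Delta l n" for n x k l \<theta> \<tau>
    using that by (simp add: restr_to_def)
  have closed: "restr_to ?K X m n x \<in> simp (MapS ?K X) n" if x: "x \<in> pts X m n" for n x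
    unfolding MapS_simps mem_Collect_eq prod_std_map_iff[OF K X]
  proof (intro conjI allI impI)
    show "restr_to ?K X m n x k l \<in> pts ?K k l \<times> Delta l n \<rightarrow>\<^sub>E pts X k l" for k l
      using x hact_closed[OF X sub level_act_closed[OF X]] by (auto simp: restr_to_def)
    fix k l p \<sigma> \<theta> \<tau> assume h: "\<sigma> \<in> Delta l p" "\<theta> \<in> pts ?K k p" "\<tau> \<in> Delta p n"
    have "act (level ?K k) l p \<sigma> \<theta> = \<theta>" by (simp add: hdisc_def disc_sset_def)
    moreover have "act (level X m) l n (compose {..l} \<tau> \<sigma>) x = act (level X m) l p \<sigma> (act (level X m) p n \<tau> x)"
      using sset_act_comp[OF L h(1,3)] x by (simp add: pts_def)
    ultimately show "restr_to ?K X m n x k l (act (level ?K k) l p \<sigma> \<theta>, compose {..l} \<tau> \<sigma>) =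
        act (level X k) l p \<sigma> (restr_to ?K X m n x k p (\<theta>, \<tau>))"
      using h x r hact_natural[OF X sub h(1) level_act_closed[OF X h(3) x]] by (simp add: Delta_comp)
  next
    fix j k l \<phi> \<theta> \<tau> assume h: "\<phi> \<in> Delta j k" "\<theta> \<in> pts ?K k l" "\<tau> \<in> Delta l n"
    have "hact ?K j k \<phi> l \<theta> = act A j k \<phi> \<theta>" by (simp add: hdisc_def)
    moreover have "act A j k \<phi> \<theta> = compose {..j} \<theta> \<phi>" by (simp add: actA std_def)
    moreover have "act A j k \<phi> \<theta> \<in> simp A j" using sset_act_closed[OF As h(1)] h(2) by simp
    ultimately show "restr_to ?K X m n x j l (hact ?K j k \<phi> l \<theta>, \<tau>) =
        hact X j k \<phi> l (restr_to ?K X m n x k l (\<theta>, \<tau>))"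
      using h r x hact_comp[OF X h(1) sub level_act_closed[OF X h(3) x]] by simp
  qed
  show ?thesis
  proof (rule sset_mapI[OF L MapS_sset[OF K X]])
    show "restr_to ?K X m n \<in> simp (level X m) n \<rightarrow>\<^sub>E simp (MapS ?K X) n" for n
      using closed by (auto simp: pts_def[symmetric]) (simp add: restr_to_def)
    fix n p \<sigma> x assume \<sigma>: "\<sigma> \<in> Delta n p" and x: "x \<in> simp (level X m) p"
    then have x': "x \<in> pts X m p" by (simp add: pts_def)
    show "restr_to ?K X m n (act (level X m) n p \<sigma> x) = act (MapS ?K X) n p \<sigma> (restr_to ?K X m p x)"
      using level_act_closed[OF X \<sigma> x'] x' Delta_comp[OF _ \<sigma>] sset_act_comp[OF L _ \<sigma> x]
      by (auto simp: MapS_simps(2) restr_to_def fun_eq_iff restrict_def)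
  qed
qed

lemma restr_to_natural:
  assumes A: "subcomplex_std A m" and f: "sspace_map X Y f" and x: "x \<in> pts X m n"
  shows "restr_to (hdisc A) Y m n (f m n x)
    = sspace_comp (sspace_prod (hdisc A) (const_sspace (std n))) f (restr_to (hdisc A) X m n x)"
proof (intro ext)
  fix k l z
  note X = sspace_map_sspaces(1)[OF f]
  have sub: "\<And>n \<theta>. \<theta> \<in> simp A n \<Longrightarrow> \<theta> \<in> Delta n m" using A by (auto simp: subcomplex_std_def)
  have "hact Y k m \<theta> l (act (level Y m) l n \<tau> (f m n x)) = f k l (hact X k m \<theta> l (act (level X m) l n \<tau> x))"
    if "\<theta> \<in> simp A k" "\<tau> \<in> Delta l n" for \<theta> \<tau>
    using sspace_map_hact[OF f sub[OF that(1)] level_act_closed[OF X that(2) x]]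
      sspace_map_act[OF f that(2) x] by simp
  then show "restr_to (hdisc A) Y m n (f m n x) k l z
    = sspace_comp (sspace_prod (hdisc A) (const_sspace (std n))) f (restr_to (hdisc A) X m n x) k l z"
    using x sspace_map_closed[OF f x]
    by (auto simp: restr_to_def sspace_comp_def compose_def restrict_def std_def)
qed

text \<open>The matching object is a pullback of a level of \<open>Y\<close> and a mapping space,
  both constant, over another mapping space, so it is constant. The relative matching map is
  therefore a map of constant simplicial sets, hence a Kan fibration.\<close>

lemma constant_reedy_fibration:
  assumes f: "sspace_map X Y f"
    and X: "\<And>m. constant_sset (level X m)" and Y: "\<And>m. constant_sset (level Y m)"
  shows "reedy_fibration X Y f"
  unfolding reedy_fibration_def Let_def
proof (intro conjI allI f)
  fix m
  note Xs = sspace_map_sspaces(1)[OF f] and Ys = sspace_map_sspaces(2)[OF f]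
  let ?K = "hdisc (bdry m)"
  let ?r = "\<lambda>n. sspace_comp (sspace_prod ?K (const_sspace (std n))) f"
  let ?r' = "\<lambda>n. restrict (?r n) (simp (MapS ?K X) n)"
  let ?P = "sset_pullback (level Y m) (MapS ?K X) (restr_to ?K Y m) ?r"
  have B: "is_sset (bdry m)" using bdry_subcomplex by (simp add: subcomplex_std_def)
  have K: "is_sspace ?K" using hdisc_sspace[OF B] .
  \<comment> \<open>A pullback sees only values on simplices, so the restricted and the unrestricted
    postcomposition map define the same one.\<close>
  have P: "?P = sset_pullback (level Y m) (MapS ?K X) (restr_to ?K Y m) ?r'"
    by (auto simp: sset_pullback_def)
  note m1 = restr_to_sset_map[OF bdry_subcomplex Ys] and m2 = MapS_postcomp[OF K f]
  have cP: "constant_sset ?P"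
    unfolding P by (rule sset_pullback_constant[OF m1 m2 Y MapS_constant[OF B Xs X]])
  note rX = restr_to_sset_map[OF bdry_subcomplex[of m] Xs]
  show "kan_fibration (level X m) ?P (\<lambda>n. \<lambda>x\<in>pts X m n. (f m n x, restr_to ?K X m n x))"
  proof (rule constant_kan_fibration[OF _ X cP], rule sset_mapI[OF sspace_level[OF Xs]])
    show "is_sset ?P" using cP by (rule constant_sset_sset)
    show "(\<lambda>x\<in>pts X m n. (f m n x, restr_to ?K X m n x)) \<in> simp (level X m) n \<rightarrow>\<^sub>E simp ?P n" for n
      using sspace_map_closed[OF f] sset_map_closed[OF rX] restr_to_natural[OF bdry_subcomplex f]
      by (auto simp: sset_pullback_def pts_def)
    show "(\<lambda>x\<in>pts X m n. (f m n x, restr_to ?K X m n x)) (act (level X m) n p \<sigma> x) =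
        act ?P n p \<sigma> ((\<lambda>x\<in>pts X m p. (f m p x, restr_to ?K X m p x)) x)"
      if "\<sigma> \<in> Delta n p" "x \<in> simp (level X m) p" for n p \<sigma> x
      using that level_act_closed[OF Xs that(1), of x m] sspace_map_act[OF f that(1), of x m]
        sset_map_act[OF rX that]
      by (simp add: sset_pullback_def sset_prod_def pts_def)
  qed
qed

section \<open>Functors on finite ordinals\<close>

lemma functorsD:
  assumes "F \<in> functors C D"
  shows "is_functor F" "FDom F = C" "FCod F = D"
  using assms by (auto simp: functors_def)

lemma functorsI: "is_functor F \<Longrightarrow> FDom F = C \<Longrightarrow> FCod F = D \<Longrightarrow> F \<in> functors C D"
  by (simp add: functors_def)

lemma is_functorI:
  assumes "is_category (FDom F)" "is_category (FCod F)"
    and "FObj F \<in> extensional (Obj (FDom F))" "FArr F \<in> extensional (Arr (FDom F))"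
    and "\<And>x. x \<in> Obj (FDom F) \<Longrightarrow> FObj F x \<in> Obj (FCod F)"
    and "\<And>f x y. f \<in> Hom (FDom F) x y \<Longrightarrow> FArr F f \<in> Hom (FCod F) (FObj F x) (FObj F y)"
    and "\<And>x. x \<in> Obj (FDom F) \<Longrightarrow> FArr F (Ident (FDom F) x) = Ident (FCod F) (FObj F x)"
    and "\<And>f g x y z. f \<in> Hom (FDom F) x y \<Longrightarrow> g \<in> Hom (FDom F) y z \<Longrightarrow>
      FArr F (Comp (FDom F) g f) = Comp (FCod F) (FArr F g) (FArr F f)"
  shows "is_functor F"
proof -
  have "FArr F f \<in> Arr (FCod F) \<and> Dom (FCod F) (FArr F f) = FObj F (Dom (FDom F) f) \<and>
      Cod (FCod F) (FArr F f) = FObj F (Cod (FDom F) f)" if "f \<in> Arr (FDom F)" for f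
    using assms(6)[of f "Dom (FDom F) f" "Cod (FDom F) f"] that by (auto simp: Hom_def)
  moreover have "FArr F (Comp (FDom F) g f) = Comp (FCod F) (FArr F g) (FArr F f)"
    if "f \<in> Arr (FDom F)" "g \<in> Arr (FDom F)" "Cod (FDom F) f = Dom (FDom F) g" for f g
    using assms(8)[of f "Dom (FDom F) f" "Cod (FDom F) f" g "Cod (FDom F) g"] that by (auto simp: Hom_def)
  ultimately show ?thesis unfolding is_functor_def using assms(1-5,7) by (auto simp: PiE_def)
qed

lemma functor_ext:
  assumes F: "F \<in> functors C D" and G: "G \<in> functors C D"
    and "\<And>x. x \<in> Obj C \<Longrightarrow> FObj F x = FObj G x" "\<And>f. f \<in> Arr C \<Longrightarrow> FArr F f = FArr G f"
  shows "F = G"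
proof -
  have "FObj F \<in> extensional (Obj C)" "FObj G \<in> extensional (Obj C)"
    "FArr F \<in> extensional (Arr C)" "FArr G \<in> extensional (Arr C)"
    using F G by (auto simp: functors_def is_functor_def PiE_def)
  then have "FObj F = FObj G" "FArr F = FArr G" using assms(3,4) extensionalityI by metis+
  then show ?thesis using functorsD[OF F] functorsD[OF G] by (intro fctr.equality) auto
qed

lemma functor_comp_functors:
  assumes F: "F \<in> functors C D" and G: "G \<in> functors D E"
  shows "functor_comp G F \<in> functors C E"
proof (rule functorsI)
  note f = functorsD[OF F] and g = functorsD[OF G]
  show "is_functor (functor_comp G F)"
  proof (rule is_functorI, simp_all only: functor_comp_simps(1,2) f g)
    show "is_category C" "is_category E" using functor_cats f g by metis+
    note C = this(1)
    show "FObj (functor_comp G F) \<in> extensional (Obj C)" "FArr (functor_comp G F) \<in> extensional (Arr C)"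
      using f by (auto simp: functor_comp_def)
    show ob: "FObj (functor_comp G F) x \<in> Obj E" if "x \<in> Obj C" for x
      using that functor_Obj[OF f(1)] functor_Obj[OF g(1)] f g by simp
    show "FArr (functor_comp G F) h \<in> Hom E (FObj (functor_comp G F) x) (FObj (functor_comp G F) y)"
      if h: "h \<in> Hom C x y" for h x y
      using functor_Hom[OF g(1), unfolded g(2,3), OF functor_Hom[OF f(1), unfolded f(2,3), OF h]]
        Hom_Obj[OF C h] HomD(1)[OF h] f by simp
    show "FArr (functor_comp G F) (Ident C x) = Ident E (FObj (functor_comp G F) x)"
      if x: "x \<in> Obj C" for x
      using functor_pres_ident[OF f(1), of x] functor_pres_ident[OF g(1), of "FObj F x"]
        functor_Obj[OF f(1), of x] HomD(1)[OF ident_Hom[OF C x]] x f g by simp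
    show "FArr (functor_comp G F) (Comp C k h)
        = Comp E (FArr (functor_comp G F) k) (FArr (functor_comp G F) h)"
      if h: "h \<in> Hom C x y" and k: "k \<in> Hom C y z" for h k x y z
      using functor_pres_comp[OF f(1), unfolded f(2,3), OF h k]
        functor_pres_comp[OF g(1), unfolded g(2,3), OF functor_Hom[OF f(1), unfolded f(2,3), OF h]
          functor_Hom[OF f(1), unfolded f(2,3), OF k]]
        HomD(1)[OF h] HomD(1)[OF k] HomD(1)[OF comp_Hom[OF C h k]] f by simp
  qed
qed (use functorsD[OF F] functorsD[OF G] in auto)

section \<open>Finite ordinals as categories, and functors out of them\<close>

lemma ord_cat_simps [simp]:
  "Obj (ord_cat m) = {..m}" "Arr (ord_cat m) = {(i, j). i \<le> j \<and> j \<le> m}"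
  "Dom (ord_cat m) = fst" "Cod (ord_cat m) = snd" "Ident (ord_cat m) i = (i, i)"
  "Comp (ord_cat m) g f = (fst f, snd g)"
  by (auto simp: ord_cat_def)

lemma ord_cat_Hom: "f \<in> Hom (ord_cat m) i j \<longleftrightarrow> f = (i, j) \<and> i \<le> j \<and> j \<le> m"
  by (auto simp: Hom_def)

lemma ord_cat_category: "is_category (ord_cat m)"
  unfolding is_category_def ord_cat_Hom by auto

lemma ord_fctr_simps [simp]:
  "FDom (ord_fctr n m \<theta>) = ord_cat n" "FCod (ord_fctr n m \<theta>) = ord_cat m"
  "FObj (ord_fctr n m \<theta>) i = \<theta> i"
  "i \<le> j \<Longrightarrow> j \<le> n \<Longrightarrow> FArr (ord_fctr n m \<theta>) (i, j) = (\<theta> i, \<theta> j)"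
  by (auto simp: ord_fctr_def)

lemma ord_fctr_functors:
  assumes \<theta>: "\<theta> \<in> Delta n m"
  shows "ord_fctr n m \<theta> \<in> functors (ord_cat n) (ord_cat m)"
proof (rule functorsI)
  show "is_functor (ord_fctr n m \<theta>)"
  proof (rule is_functorI, simp_all only: ord_fctr_simps(1,2) ord_cat_category)
    show "FObj (ord_fctr n m \<theta>) \<in> extensional (Obj (ord_cat n))"
      using Delta_ext[OF \<theta>] by (simp add: ord_fctr_def)
    show "FArr (ord_fctr n m \<theta>) \<in> extensional (Arr (ord_cat n))" by (simp add: ord_fctr_def)
  qed (auto simp: ord_cat_Hom Delta_le[OF \<theta>] Delta_mono[OF \<theta>])
qed auto

lemma ord_functor_arr:
  assumes x: "x \<in> functors (ord_cat m) C" and ij: "i \<le> j" "j \<le> m"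
  shows "FArr x (i, j) \<in> Hom C (FObj x i) (FObj x j)"
  using functor_Hom[OF functorsD(1)[OF x], of "(i, j)" i j] functorsD[OF x] ij by (simp add: ord_cat_Hom)

lemma ord_functor_obj: "x \<in> functors (ord_cat m) C \<Longrightarrow> i \<le> m \<Longrightarrow> FObj x i \<in> Obj C"
  using functor_Obj[of x i] functorsD[of x "ord_cat m" C] by simp

lemma ord_functor_ident: "x \<in> functors (ord_cat m) C \<Longrightarrow> i \<le> m \<Longrightarrow> FArr x (i, i) = Ident C (FObj x i)"
  using functor_pres_ident[of x i] functorsD[of x "ord_cat m" C] by simp

lemma ord_functor_comp:
  assumes x: "x \<in> functors (ord_cat m) C" and "i \<le> j" "j \<le> k" "k \<le> m"
  shows "FArr x (i, k) = Comp C (FArr x (j, k)) (FArr x (i, j))"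
  using functor_pres_comp[OF functorsD(1)[OF x], of "(i, j)" i j "(j, k)" k] functorsD[OF x] assms
  by (simp add: ord_cat_Hom)

text \<open>Every arrow of the ordinal is an identity or a composite of arrows from \<open>i\<close>
  to \<open>Suc i\<close>; induction on the target of the arrow.\<close>

lemma ord_functor_eqI:
  assumes x: "x \<in> functors (ord_cat m) C" and y: "y \<in> functors (ord_cat m) C"
    and ob: "\<And>i. i \<le> m \<Longrightarrow> FObj x i = FObj y i"
    and ar: "\<And>i. i < m \<Longrightarrow> FArr x (i, Suc i) = FArr y (i, Suc i)"
  shows "x = y"
proof (rule functor_ext[OF x y])
  have "FArr x (i, j) = FArr y (i, j)" if "i \<le> j" "j \<le> m" for i j
    using that
  proof (induction j rule: dec_induct)
    case base then show ?case using ord_functor_ident[OF x] ord_functor_ident[OF y] ob by simp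
  next
    case (step j)
    then show ?case
      using ord_functor_comp[OF x, of i j "Suc j"] ord_functor_comp[OF y, of i j "Suc j"] ar[of j] by simp
  qed
  then show "FArr x f = FArr y f" if "f \<in> Arr (ord_cat m)" for f using that by auto
qed (use ob in simp)

text \<open>For \<open>i \<le> j\<close> this is the composite of \<open>f i\<close>, ...,
  \<open>f (j - 1)\<close> from \<open>a i\<close> to \<open>a j\<close>. The test
  \<open>i = Suc j\<close> stops the recursion at an identity; the values for \<open>j < i\<close>
  carry no meaning.\<close>

primrec path_arr :: "('o, 'a) category \<Rightarrow> (nat \<Rightarrow> 'o) \<Rightarrow> (nat \<Rightarrow> 'a) \<Rightarrow> nat \<Rightarrow> nat \<Rightarrow> 'a" where
  "path_arr C a f i 0 = Ident C (a 0)"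
| "path_arr C a f i (Suc j) =
     (if i = Suc j then Ident C (a (Suc j)) else Comp C (f j) (path_arr C a f i j))"

definition path_functor ::
    "('o, 'a) category \<Rightarrow> nat \<Rightarrow> (nat \<Rightarrow> 'o) \<Rightarrow> (nat \<Rightarrow> 'a) \<Rightarrow> (nat, nat \<times> nat, 'o, 'a) fctr" where
  "path_functor C m a f = \<lparr>FDom = ord_cat m, FCod = C, FObj = (\<lambda>i\<in>{..m}. a i),
     FArr = (\<lambda>(i, j)\<in>Arr (ord_cat m). path_arr C a f i j)\<rparr>"

lemma path_arr_refl: "path_arr C a f i i = Ident C (a i)"
  by (cases i) auto

context
  fixes C :: "('o, 'a) category" and m a f
  assumes C: "is_category C" and a: "\<And>i. i \<le> m \<Longrightarrow> a i \<in> Obj C"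
    and f: "\<And>i. i < m \<Longrightarrow> f i \<in> Hom C (a i) (a (Suc i))"
begin

lemma path_arr_Hom: "i \<le> j \<Longrightarrow> j \<le> m \<Longrightarrow> path_arr C a f i j \<in> Hom C (a i) (a j)"
proof (induction j rule: dec_induct)
  case base then show ?case using ident_Hom[OF C a] by (simp add: path_arr_refl)
next
  case (step j) then show ?case using comp_Hom[OF C _ f, of _ _ j] by auto
qed

lemma path_arr_comp:
  "j \<le> k \<Longrightarrow> i \<le> j \<Longrightarrow> k \<le> m \<Longrightarrow>
     Comp C (path_arr C a f j k) (path_arr C a f i j) = path_arr C a f i k"
proof (induction k rule: dec_induct)
  case base
  then show ?case using comp_ident_left[OF C path_arr_Hom[of i j]] by (simp add: path_arr_refl)
next
  case (step k)
  then show ?case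
    using comp_assoc[OF C path_arr_Hom[of i j] path_arr_Hom[of j k] f[of k]] by auto
qed

lemma path_functor_functors: "path_functor C m a f \<in> functors (ord_cat m) C"
proof (rule functorsI)
  let ?F = "path_functor C m a f"
  have s: "FDom ?F = ord_cat m" "FCod ?F = C" by (auto simp: path_functor_def)
  show "is_functor ?F"
  proof (rule is_functorI, simp_all only: s C ord_cat_category)
    show "FObj ?F \<in> extensional (Obj (ord_cat m))" "FArr ?F \<in> extensional (Arr (ord_cat m))"
      by (auto simp: path_functor_def)
  qed (auto simp: path_functor_def ord_cat_Hom a path_arr_Hom path_arr_comp path_arr_refl)
qed (auto simp: path_functor_def)

lemma path_functor_step: "i < m \<Longrightarrow> FArr (path_functor C m a f) (i, Suc i) = f i"
  using comp_ident_right[OF C f, of i] by (simp add: path_functor_def path_arr_refl)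

lemma path_functor_obj: "i \<le> m \<Longrightarrow> FObj (path_functor C m a f) i = a i"
  by (simp add: path_functor_def)

end

lemma source_functor_bij: "is_category C \<Longrightarrow> bij_betw (\<lambda>x. FObj x 0) (functors (ord_cat 0) C) (Obj C)"
proof (rule bij_betwI')
  assume C: "is_category C"
  show "FObj x 0 = FObj y 0 \<longleftrightarrow> x = y"
    if "x \<in> functors (ord_cat 0) C" "y \<in> functors (ord_cat 0) C" for x y
    using ord_functor_eqI[OF that] by auto
  show "FObj x 0 \<in> Obj C" if "x \<in> functors (ord_cat 0) C" for x using ord_functor_obj[OF that] by simp
  show "\<exists>x\<in>functors (ord_cat 0) C. c = FObj x 0" if "c \<in> Obj C" for c
    using path_functor_functors[OF C, of 0 "\<lambda>_. c"] path_functor_obj[OF C, of 0 "\<lambda>_. c"] that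
    by (metis le0 less_zeroE)
qed

lemma arrow_functor_bij: "is_category C \<Longrightarrow> bij_betw (\<lambda>x. FArr x (0, 1)) (functors (ord_cat 1) C) (Arr C)"
proof (rule bij_betwI')
  assume C: "is_category C"
  show "FArr x (0, 1) = FArr y (0, 1) \<longleftrightarrow> x = y"
    if "x \<in> functors (ord_cat 1) C" "y \<in> functors (ord_cat 1) C" for x y
  proof
    assume eq: "FArr x (0, 1) = FArr y (0, 1)"
    \<comment> \<open>Domain and codomain of the arrow recover the values on the two
      objects.\<close>
    note h = ord_functor_arr[OF that(1), of 0 1] ord_functor_arr[OF that(2), of 0 1]
    show "x = y"
    proof (rule ord_functor_eqI[OF that])
      fix i :: nat assume "i \<le> 1"
      then have "i = 0 \<or> i = 1" by auto
      then show "FObj x i = FObj y i" using h eq by (auto simp: Hom_def)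
    qed (use eq in auto)
  qed simp
  show "FArr x (0, 1) \<in> Arr C" if "x \<in> functors (ord_cat 1) C" for x
    using ord_functor_arr[OF that, of 0 1] by (simp add: Hom_def)
  show "\<exists>x\<in>functors (ord_cat 1) C. h = FArr x (0, 1)" if h: "h \<in> Arr C" for h
  proof -
    let ?a = "\<lambda>i::nat. if i = 0 then Dom C h else Cod C h" and ?f = "\<lambda>i::nat. h"
    have a: "\<And>i. i \<le> 1 \<Longrightarrow> ?a i \<in> Obj C" and f: "\<And>i. i < 1 \<Longrightarrow> ?f i \<in> Hom C (?a i) (?a (Suc i))"
      using C h by (auto simp: is_category_def Hom_def)
    show ?thesis
      using path_functor_functors[of C 1 ?a ?f, OF C a f] path_functor_step[of C 1 ?a ?f 0, OF C a f]
      by (intro bexI[of _ "path_functor C 1 ?a ?f"]) auto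
  qed
qed


section \<open>Isomorphic categories\<close>

text \<open>An isomorphism onto \<open>C\<close> in which \<open>H\<close> is only required to be
  closed under its operations. It is meant for \<open>ho X\<close>, whose category axioms are to be
  deduced from it.\<close>

definition cat_bij ::
    "('o, 'a) category \<Rightarrow> ('p, 'b) category \<Rightarrow> ('o \<Rightarrow> 'p) \<Rightarrow> ('a \<Rightarrow> 'b) \<Rightarrow> bool" where
  "cat_bij H C P A \<longleftrightarrow> is_category C \<and> bij_betw P (Obj H) (Obj C) \<and> bij_betw A (Arr H) (Arr C) \<and>
     (\<forall>f\<in>Arr H. Dom H f \<in> Obj H \<and> Cod H f \<in> Obj H \<and>
        Dom C (A f) = P (Dom H f) \<and> Cod C (A f) = P (Cod H f)) \<and>
     (\<forall>x\<in>Obj H. Ident H x \<in> Arr H \<and> A (Ident H x) = Ident C (P x)) \<and>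
     (\<forall>f\<in>Arr H. \<forall>g\<in>Arr H. Cod H f = Dom H g \<longrightarrow>
        Comp H g f \<in> Arr H \<and> A (Comp H g f) = Comp C (A g) (A f))"

context
  fixes H :: "('o, 'a) category" and C :: "('p, 'b) category" and P A
  assumes cb: "cat_bij H C P A"
begin

lemma cat_bij_target: "is_category C"
  using cb by (simp add: cat_bij_def)

lemma cat_bij_obj:
  "x \<in> Obj H \<Longrightarrow> P x \<in> Obj C" "x \<in> Obj H \<Longrightarrow> y \<in> Obj H \<Longrightarrow> P x = P y \<Longrightarrow> x = y"
  "c \<in> Obj C \<Longrightarrow> \<exists>x\<in>Obj H. P x = c"
  using cb by (auto simp: cat_bij_def bij_betw_def dest: inj_onD) (metis imageE)

lemma cat_bij_arr:
  "f \<in> Arr H \<Longrightarrow> A f \<in> Arr C" "f \<in> Arr H \<Longrightarrow> g \<in> Arr H \<Longrightarrow> A f = A g \<Longrightarrow> f = g"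
  "h \<in> Arr C \<Longrightarrow> \<exists>f\<in>Arr H. A f = h"
  using cb by (auto simp: cat_bij_def bij_betw_def dest: inj_onD) (metis imageE)

lemma cat_bij_dom:
  "f \<in> Arr H \<Longrightarrow> Dom H f \<in> Obj H" "f \<in> Arr H \<Longrightarrow> Cod H f \<in> Obj H"
  "f \<in> Arr H \<Longrightarrow> Dom C (A f) = P (Dom H f)" "f \<in> Arr H \<Longrightarrow> Cod C (A f) = P (Cod H f)"
  using cb unfolding cat_bij_def by blast+

lemma cat_bij_ident:
  "x \<in> Obj H \<Longrightarrow> Ident H x \<in> Arr H" "x \<in> Obj H \<Longrightarrow> A (Ident H x) = Ident C (P x)"
  using cb unfolding cat_bij_def by blast+

lemma cat_bij_comp:
  "f \<in> Arr H \<Longrightarrow> g \<in> Arr H \<Longrightarrow> Cod H f = Dom H g \<Longrightarrow> Comp H g f \<in> Arr H"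
  "f \<in> Arr H \<Longrightarrow> g \<in> Arr H \<Longrightarrow> Cod H f = Dom H g \<Longrightarrow> A (Comp H g f) = Comp C (A g) (A f)"
  using cb unfolding cat_bij_def by blast+

lemma cat_bij_HomI:
  assumes "f \<in> Arr H" "x \<in> Obj H" "y \<in> Obj H" "A f \<in> Hom C (P x) (P y)"
  shows "f \<in> Hom H x y"
  using assms cat_bij_dom[of f] cat_bij_obj(2) by (auto simp: Hom_def)

lemma cat_bij_HomD:
  assumes "f \<in> Hom H x y"
  shows "A f \<in> Hom C (P x) (P y)"
  using HomD[OF assms] cat_bij_dom[of f] cat_bij_arr(1)[of f] by (auto simp: Hom_def)

text \<open>Each axiom holds after applying \<open>A\<close>, because it holds in \<open>C\<close>,
  and \<open>A\<close> is injective on arrows.\<close>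

lemma cat_bij_category: "is_category H"
proof -
  note C = cat_bij_target
  have aH: "A f \<in> Hom C (P (Dom H f)) (P (Cod H f))" if "f \<in> Arr H" for f
    by (rule cat_bij_HomD) (use that in \<open>simp add: Hom_def\<close>)
  have idH: "Ident H x \<in> Hom H x x" if "x \<in> Obj H" for x
    using cat_bij_HomI[OF cat_bij_ident(1)[OF that] that that] cat_bij_ident(2)[OF that]
      ident_Hom[OF C cat_bij_obj(1)[OF that]] by simp
  have compH: "Comp H g f \<in> Hom H (Dom H f) (Cod H g)"
    if "f \<in> Arr H" "g \<in> Arr H" "Cod H f = Dom H g" for f g
    using cat_bij_HomI[OF cat_bij_comp(1)[OF that] cat_bij_dom(1)[OF that(1)] cat_bij_dom(2)[OF that(2)]]
      comp_Hom[OF C aH[OF that(1)]] aH[OF that(2)] that cat_bij_comp(2)[OF that] by simp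
  show ?thesis
    unfolding is_category_def
  proof (intro conjI ballI impI)
    fix f assume f: "f \<in> Arr H"
    show "Dom H f \<in> Obj H" "Cod H f \<in> Obj H" using cat_bij_dom f by auto
    note d = cat_bij_dom(1,2)[OF f]
    have "A (Comp H f (Ident H (Dom H f))) = A f" "A (Comp H (Ident H (Cod H f)) f) = A f"
      using cat_bij_comp(2)[OF cat_bij_ident(1)[OF d(1)] f] cat_bij_comp(2)[OF f cat_bij_ident(1)[OF d(2)]]
        idH[OF d(1)] idH[OF d(2)] cat_bij_ident(2) d comp_ident_right[OF C aH[OF f]]
        comp_ident_left[OF C aH[OF f]] by (simp_all add: Hom_def)
    then show "Comp H f (Ident H (Dom H f)) = f" "Comp H (Ident H (Cod H f)) f = f"
      using cat_bij_arr(2) cat_bij_comp(1) cat_bij_ident(1) d f idH by (auto simp: Hom_def)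
  next
    fix f g h assume h: "f \<in> Arr H" "g \<in> Arr H" "h \<in> Arr H" "Cod H f = Dom H g" "Cod H g = Dom H h"
    note gf = compH[OF h(1,2,4)] and hg = compH[OF h(2,3,5)]
    have "A (Comp H h (Comp H g f)) = A (Comp H (Comp H h g) f)"
      using cat_bij_comp(2)[OF HomD(1)[OF gf] h(3)] cat_bij_comp(2)[OF h(1) HomD(1)[OF hg]]
        cat_bij_comp(2)[OF h(1,2,4)] cat_bij_comp(2)[OF h(2,3,5)] HomD[OF gf] HomD[OF hg]
        comp_assoc[OF C aH[OF h(1)], of "A g" _ "A h"] aH[OF h(2)] aH[OF h(3)] h by simp
    then show "Comp H h (Comp H g f) = Comp H (Comp H h g) f"
      using cat_bij_arr(2) cat_bij_comp(1) gf hg h by (simp add: Hom_def)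
  qed (use idH compH in auto)
qed

lemma cat_bij_Hom_lift:
  assumes "h \<in> Hom C (P x) (P y)" "x \<in> Obj H" "y \<in> Obj H"
  obtains f where "f \<in> Hom H x y" "A f = h"
proof -
  obtain f where "f \<in> Arr H" "A f = h" using cat_bij_arr(3) HomD(1)[OF assms(1)] by blast
  then show thesis using that[of f] cat_bij_HomI[of f x y] assms by auto
qed

lemma cat_bij_iso:
  assumes f: "f \<in> Arr H"
  shows "is_iso H f \<longleftrightarrow> is_iso C (A f)"
proof
  let ?x = "Dom H f" and ?y = "Cod H f"
  note d = cat_bij_dom(1,2)[OF f]
  have fH: "f \<in> Hom H ?x ?y" using f by (simp add: Hom_def)
  note afH = cat_bij_HomD[OF fH]
  have A_comp: "A (Comp H k h) = Comp C (A k) (A h)" if "h \<in> Hom H u v" "k \<in> Hom H v w" for h k u v w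
    using cat_bij_comp(2) HomD[OF that(1)] HomD[OF that(2)] by simp
  {
    assume "is_iso H f"
    then obtain g where g: "g \<in> Hom H ?y ?x" "Comp H g f = Ident H ?x" "Comp H f g = Ident H ?y"
      using fH by (rule is_isoE)
    show "is_iso C (A f)"
      using A_comp[OF fH g(1)] A_comp[OF g(1) fH] g(2,3) cat_bij_ident(2)[OF d(1)] cat_bij_ident(2)[OF d(2)]
      by (intro is_isoI[OF afH cat_bij_HomD[OF g(1)]]) auto
  next
    assume "is_iso C (A f)"
    then obtain h where h: "h \<in> Hom C (P ?y) (P ?x)" "Comp C h (A f) = Ident C (P ?x)"
      "Comp C (A f) h = Ident C (P ?y)" using afH by (rule is_isoE)
    obtain g where g: "g \<in> Hom H ?y ?x" "A g = h" using cat_bij_Hom_lift[OF h(1) d(2) d(1)] .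
    note H = cat_bij_category
    show "is_iso H f"
    proof (rule is_isoI[OF fH g(1)])
      show "Comp H g f = Ident H ?x"
        using cat_bij_arr(2)[OF HomD(1)[OF comp_Hom[OF H fH g(1)]] cat_bij_ident(1)[OF d(1)]]
          A_comp[OF fH g(1)] g(2) h(2) cat_bij_ident(2)[OF d(1)] by simp
      show "Comp H f g = Ident H ?y"
        using cat_bij_arr(2)[OF HomD(1)[OF comp_Hom[OF H g(1) fH]] cat_bij_ident(1)[OF d(2)]]
          A_comp[OF g(1) fH] g(2) h(3) cat_bij_ident(2)[OF d(2)] by simp
    qed
  }
qed

end

context
  fixes H :: "('o, 'a) category" and C :: "('p, 'b) category" and P A
    and H' :: "('q, 'c) category" and C' :: "('r, 'd) category" and P' A'
    and F :: "('p, 'b, 'r, 'd) fctr" and G :: "('o, 'a, 'q, 'c) fctr"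
  assumes cb: "cat_bij H C P A" and cb': "cat_bij H' C' P' A'" and F: "F \<in> functors C C'"
    and G: "FDom G = H" "FCod G = H'" "FObj G \<in> Obj H \<rightarrow>\<^sub>E Obj H'" "FArr G \<in> Arr H \<rightarrow>\<^sub>E Arr H'"
    and sq_ob: "\<And>x. x \<in> Obj H \<Longrightarrow> P' (FObj G x) = FObj F (P x)"
    and sq_ar: "\<And>f. f \<in> Arr H \<Longrightarrow> A' (FArr G f) = FArr F (A f)"
begin

text \<open>Here \<open>G\<close> is merely a pair of functions lying over the functor
  \<open>F\<close>; injectivity of \<open>A'\<close> carries the functor laws from \<open>F\<close>
  to \<open>G\<close>.\<close>

lemma cat_bij_functor: "is_functor G"
proof (rule is_functorI, simp_all only: G(1,2))
  note f = functorsD[OF F]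
  note H = cat_bij_category[OF cb] and H' = cat_bij_category[OF cb']
  show "is_category H" "is_category H'" by fact+
  show "FObj G \<in> extensional (Obj H)" "FArr G \<in> extensional (Arr H)" using G by (auto simp: PiE_def)
  show ob: "FObj G x \<in> Obj H'" if "x \<in> Obj H" for x using G(3) that by auto
  have ar: "FArr G h \<in> Arr H'" if "h \<in> Arr H" for h using G(4) that by auto
  show hom: "FArr G h \<in> Hom H' (FObj G x) (FObj G y)" if h: "h \<in> Hom H x y" for h x y
    using cat_bij_HomI[OF cb' ar[OF HomD(1)[OF h]] ob ob, of x y] Hom_Obj[OF H h] sq_ob
      sq_ar[OF HomD(1)[OF h]] functor_Hom[OF f(1), of "A h" "P x" "P y"] cat_bij_HomD[OF cb h] f by simp
  show "FArr G (Ident H x) = Ident H' (FObj G x)" if x: "x \<in> Obj H" for x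
    using cat_bij_arr(2)[OF cb' ar[OF cat_bij_ident(1)[OF cb x]] cat_bij_ident(1)[OF cb' ob[OF x]]]
      sq_ar[OF cat_bij_ident(1)[OF cb x]] cat_bij_ident(2)[OF cb x] cat_bij_ident(2)[OF cb' ob[OF x]]
      sq_ob[OF x] functor_pres_ident[OF f(1), of "P x"] cat_bij_obj(1)[OF cb x] f by simp
  show "FArr G (Comp H k h) = Comp H' (FArr G k) (FArr G h)"
    if h: "h \<in> Hom H x y" and k: "k \<in> Hom H y z" for h k x y z
  proof -
    note kh = comp_Hom[OF H h k] and kh' = comp_Hom[OF H' hom[OF h] hom[OF k]]
    have "A' (FArr G (Comp H k h)) = FArr F (Comp C (A k) (A h))"
      using sq_ar[OF HomD(1)[OF kh]] cat_bij_comp(2)[OF cb HomD(1)[OF h] HomD(1)[OF k]] HomD[OF h] HomD[OF k]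
      by simp
    also have "\<dots> = Comp C' (FArr F (A k)) (FArr F (A h))"
      using functor_pres_comp[OF f(1), of "A h" "P x" "P y" "A k" "P z"] cat_bij_HomD[OF cb h]
        cat_bij_HomD[OF cb k] f by simp
    also have "\<dots> = A' (Comp H' (FArr G k) (FArr G h))"
      using cat_bij_comp(2)[OF cb' HomD(1)[OF hom[OF h]] HomD(1)[OF hom[OF k]]] HomD[OF hom[OF h]]
        HomD[OF hom[OF k]] sq_ar[OF HomD(1)[OF h]] sq_ar[OF HomD(1)[OF k]] by simp
    finally show ?thesis
      using cat_bij_arr(2)[OF cb' ar[OF HomD(1)[OF kh]] HomD(1)[OF kh']] by simp
  qed
qed

lemma cat_bij_isofibration:
  assumes iso: "is_isofibration F"
  shows "is_isofibration G"
  unfolding is_isofibration_def G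
proof (intro conjI ballI allI impI cat_bij_functor)
  note f = functorsD[OF F]
  fix x b assume x: "x \<in> Obj H" and b: "is_iso H' b \<and> Dom H' b = FObj G x"
  have bA: "b \<in> Arr H'" using b by (simp add: is_iso_def)
  have "is_iso C' (A' b)" "Dom C' (A' b) = FObj F (P x)"
    using cat_bij_iso[OF cb' bA] cat_bij_dom(3)[OF cb' bA] b sq_ob[OF x] by auto
  then obtain a where a: "is_iso C a" "Dom C a = P x" "FArr F a = A' b"
    using iso cat_bij_obj(1)[OF cb x] f unfolding is_isofibration_def by blast
  then obtain h where h: "h \<in> Arr H" "A h = a" using cat_bij_arr(3)[OF cb] by (auto simp: is_iso_def)
  have "is_iso H h" using cat_bij_iso[OF cb h(1)] a h by simp
  moreover have "Dom H h = x"
    using cat_bij_obj(2)[OF cb cat_bij_dom(1)[OF cb h(1)] x] cat_bij_dom(3)[OF cb h(1)] a h by simp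
  moreover have "FArr G h = b"
    using cat_bij_arr(2)[OF cb' _ bA, of "FArr G h"] sq_ar[OF h(1)] a h G(4) by auto
  ultimately show "\<exists>a. is_iso H a \<and> Dom H a = x \<and> FArr G a = b" by blast
qed

lemma cat_bij_essentially_surjective:
  assumes es: "essentially_surjective F"
  shows "essentially_surjective G"
  unfolding essentially_surjective_def G
proof (intro conjI ballI cat_bij_functor)
  note f = functorsD[OF F]
  fix y assume y: "y \<in> Obj H'"
  then obtain c b where c: "c \<in> Obj C" and b: "b \<in> Hom C' (FObj F c) (P' y)" "is_iso C' b"
    using es f cat_bij_obj(1)[OF cb'] unfolding essentially_surjective_def by blast
  obtain x where x: "x \<in> Obj H" "P x = c" using cat_bij_obj(3)[OF cb c] by blast
  have Gx: "FObj G x \<in> Obj H'" using G(3) x by auto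
  obtain h where h: "h \<in> Hom H' (FObj G x) y" "A' h = b"
    using cat_bij_Hom_lift[OF cb' _ Gx y, of b] b(1) sq_ob[OF x(1)] x(2) by auto
  then have "is_iso H' h" using cat_bij_iso[OF cb' HomD(1)[OF h(1)]] b(2) by simp
  then show "\<exists>x\<in>Obj H. \<exists>b\<in>Hom H' (FObj G x) y. is_iso H' b" using x h by blast
qed

end


section \<open>Equivalences are fully faithful and essentially surjective\<close>

context
  fixes F :: "('o, 'a, 'p, 'b) fctr" and G \<alpha> \<beta>
  assumes F: "is_functor F" and G: "G \<in> functors (FCod F) (FDom F)"
    and \<alpha>: "nat_iso (fid (FDom F)) (functor_comp G F) \<alpha>"
    and \<beta>: "nat_iso (functor_comp F G) (fid (FCod F)) \<beta>"
begin

lemma inverse_unit_Hom: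
  "x \<in> Obj (FDom F) \<Longrightarrow> \<alpha> x \<in> Hom (FDom F) x (FObj G (FObj F x)) \<and> is_iso (FDom F) (\<alpha> x)"
  using \<alpha> nat_transD(1)[of "fid (FDom F)" "functor_comp G F" \<alpha> x] by (auto simp: nat_iso_def)

lemma inverse_counit_Hom:
  "y \<in> Obj (FCod F) \<Longrightarrow> \<beta> y \<in> Hom (FCod F) (FObj F (FObj G y)) y \<and> is_iso (FCod F) (\<beta> y)"
  using \<beta> nat_transD(1)[of "functor_comp F G" "fid (FCod F)" \<beta> y] functorsD[OF G]
  by (auto simp: nat_iso_def)

lemma inverse_unit_natural:
  "f \<in> Hom (FDom F) x y \<Longrightarrow>
     Comp (FDom F) (\<alpha> y) f = Comp (FDom F) (FArr G (FArr F f)) (\<alpha> x)"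
  using \<alpha> nat_transD(2)[of "fid (FDom F)" "functor_comp G F" \<alpha> f x y]
  by (auto simp: nat_iso_def dest: HomD(1))

lemma inverse_counit_natural:
  "f \<in> Hom (FCod F) x y \<Longrightarrow>
     Comp (FCod F) (\<beta> y) (FArr F (FArr G f)) = Comp (FCod F) f (\<beta> x)"
  using \<beta> nat_transD(2)[of "functor_comp F G" "fid (FCod F)" \<beta> f x y] functorsD[OF G]
  by (auto simp: nat_iso_def dest: HomD(1))

lemma inverse_faithful:
  assumes f: "f \<in> Hom (FDom F) x y" and g: "g \<in> Hom (FDom F) x y" and eq: "FArr F f = FArr F g"
  shows "f = g"
proof -
  note C = functor_cats(1)[OF F]
  have "Comp (FDom F) (\<alpha> y) f = Comp (FDom F) (\<alpha> y) g"
    using inverse_unit_natural[OF f] inverse_unit_natural[OF g] eq by simp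
  then show ?thesis using iso_cancel_left[OF C _ _ f g] inverse_unit_Hom Hom_Obj[OF C f] by blast
qed

text \<open>\<open>is_equivalence\<close> asserts no triangle identities, so \<open>\<beta>\<close>
  is used on its own for the faithfulness of \<open>G\<close>, as \<open>\<alpha>\<close> was for
  that of \<open>F\<close>.\<close>

lemma inverse_faithful':
  assumes f: "f \<in> Hom (FCod F) x y" and g: "g \<in> Hom (FCod F) x y" and eq: "FArr G f = FArr G g"
  shows "f = g"
proof -
  note D = functor_cats(2)[OF F]
  have "Comp (FCod F) f (\<beta> x) = Comp (FCod F) g (\<beta> x)"
    using inverse_counit_natural[OF f] inverse_counit_natural[OF g] eq by simp
  then show ?thesis using iso_cancel_right[OF D _ _ f g] inverse_counit_Hom Hom_Obj[OF D f] by blast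
qed

text \<open>The preimage is \<open>FArr G h\<close> conjugated by \<open>\<alpha>\<close>.
  Naturality of \<open>\<alpha>\<close> and cancellation show that \<open>G\<close> sends
  \<open>FArr F f\<close> and \<open>h\<close> to the same arrow, and \<open>G\<close> is
  faithful.\<close>

lemma inverse_full:
  assumes h: "h \<in> Hom (FCod F) (FObj F x) (FObj F y)" and x: "x \<in> Obj (FDom F)" and y: "y \<in> Obj (FDom F)"
  shows "\<exists>f\<in>Hom (FDom F) x y. FArr F f = h"
proof -
  let ?C = "FDom F"
  note C = functor_cats(1)[OF F] and g = functorsD[OF G]
  have Gh: "FArr G h \<in> Hom ?C (FObj G (FObj F x)) (FObj G (FObj F y))"
    using functor_Hom[OF g(1), of h "FObj F x" "FObj F y"] h g by simp
  note a = inverse_unit_Hom[OF x] inverse_unit_Hom[OF y]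
  obtain j where j: "j \<in> Hom ?C (FObj G (FObj F y)) y" "Comp ?C (\<alpha> y) j = Ident ?C (FObj G (FObj F y))"
    using is_isoE a(2) by metis
  define u where "u = Comp ?C (FArr G h) (\<alpha> x)"
  have u: "u \<in> Hom ?C x (FObj G (FObj F y))" unfolding u_def using comp_Hom[OF C _ Gh] a(1) by blast
  define f where "f = Comp ?C j u"
  have f: "f \<in> Hom ?C x y" unfolding f_def using comp_Hom[OF C u j(1)] .
  have "Comp ?C (\<alpha> y) f = u"
    unfolding f_def using comp_assoc[OF C u j(1)] a(2) j(2) comp_ident_left[OF C u] by metis
  then have "Comp ?C (FArr G (FArr F f)) (\<alpha> x) = Comp ?C (FArr G h) (\<alpha> x)"
    using inverse_unit_natural[OF f] by (simp add: u_def)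
  moreover have Ff: "FArr F f \<in> Hom (FCod F) (FObj F x) (FObj F y)" using functor_Hom[OF F f] .
  moreover have "FArr G (FArr F f) \<in> Hom ?C (FObj G (FObj F x)) (FObj G (FObj F y))"
    using functor_Hom[OF g(1), of "FArr F f" "FObj F x" "FObj F y"] Ff g by simp
  ultimately have "FArr G (FArr F f) = FArr G h" using iso_cancel_right[OF C _ _ _ Gh] a(1) by blast
  then show ?thesis using inverse_faithful'[OF Ff h] f by blast
qed

lemma inverse_essentially_surjective: "essentially_surjective F"
  unfolding essentially_surjective_def
  using F inverse_counit_Hom functor_Obj[OF functorsD(1)[OF G]] functorsD[OF G] by metis

end

section \<open>Simplicial spaces isomorphic to a nerve\<close>

lemma compose_edge_map:
  "\<theta> \<in> Delta k m \<Longrightarrow> compose {..1} \<theta> (edge i j) = edge (\<theta> i) (\<theta> j)"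
  by (auto simp: compose_def edge_def fun_eq_iff)

lemma edge_refl: "edge i i = cst 1 i"
  by (auto simp: edge_def cst_def fun_eq_iff)

lemma coface_1 [simp]:
  "coface 1 0 = edge 1 2" "coface 1 1 = edge 0 2" "coface 1 2 = edge 0 1"
  "coface (Suc 0) 0 = edge 1 2" "coface (Suc 0) (Suc 0) = edge 0 2" "coface (Suc 0) 2 = edge 0 1"
  by (auto simp: coface_def edge_def fun_eq_iff numeral_2_eq_2)

section \<open>Components and mapping spaces in the levelwise constant case\<close>

lemma rtrancl_sym_Id:
  assumes "R \<subseteq> Id"
  shows "(R \<union> R\<inverse>)\<^sup>* = Id"
proof -
  have "R \<union> R\<inverse> \<subseteq> Id" using assms by auto
  then have "(R \<union> R\<inverse>)\<^sup>* \<subseteq> Id\<^sup>*" by (rule rtrancl_mono)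
  moreover have "Id\<^sup>* = (Id :: ('a \<times> 'a) set)" using rtrancl_reflcl[of "{}"] by simp
  ultimately show ?thesis by auto
qed

text \<open>Edges of a constant simplicial set have equal ends, so the relation generating
  \<open>pi0_rel\<close> lies in the identity and components are single vertices.\<close>

lemma constant_pi0_rel:
  assumes "constant_sset X"
  shows "pi0_rel X = Id"
  unfolding pi0_rel_def Let_def
proof (rule rtrancl_sym_Id, clarify)
  fix e assume "e \<in> simp X 1"
  then show "act X 0 1 (coface 0 1) e = act X 0 1 (coface 0 0) e"
    using constant_vertex_unique[OF assms, of e 1 0 1] by simp
qed

lemma constant_pi0: "constant_sset X \<Longrightarrow> pi0 X = (\<lambda>x. {x}) ` simp X 0"
  using constant_pi0_rel[of X] by (auto simp: pi0_def quotient_def)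

lemma map_space_sset:
  assumes X: "is_sspace X" and x: "x \<in> pts X 0 0" and y: "y \<in> pts X 0 0"
  shows "is_sset (map_space X x y)"
proof (rule is_ssetI)
  note L = sspace_level[OF X]
  fix n m \<theta> f assume \<theta>: "\<theta> \<in> Delta n m" and f: "f \<in> simp (map_space X x y) m"
  then have f': "f \<in> pts X 1 m" by (simp add: map_space_def)
  have "hact X 0 1 \<delta> n (act (level X 1) n m \<theta> f) = act (level X 0) n 0 (cst n 0) z"
    if "\<delta> \<in> Delta 0 1" "hact X 0 1 \<delta> m f = act (level X 0) m 0 (cst m 0) z" "z \<in> pts X 0 0" for \<delta> z
    using hact_natural[OF X that(1) \<theta> f'] act_degenerate[OF L _ \<theta>, of z 0] that by (simp add: pts_def)
  then show "act (map_space X x y) n m \<theta> f \<in> simp (map_space X x y) n"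
    using f x y level_act_closed[OF X \<theta> f'] by (simp add: map_space_def const0_cst)
qed (use sset_act_id[OF sspace_level[OF X]] sset_act_comp[OF sspace_level[OF X]] in
    \<open>auto simp: map_space_def pts_def\<close>)

lemma map_space_constant:
  "is_sspace X \<Longrightarrow> constant_sset (level X 1) \<Longrightarrow> x \<in> pts X 0 0 \<Longrightarrow> y \<in> pts X 0 0 \<Longrightarrow>
     constant_sset (map_space X x y)"
  using map_space_sset by (fastforce simp: constant_sset_def map_space_def pts_def)

lemma map_space_points:
  assumes X: "is_sspace X" and x: "x \<in> pts X 0 0" and y: "y \<in> pts X 0 0"
  shows "simp (map_space X x y) 0
    = {f \<in> pts X 1 0. hact X 0 1 (cst 0 0) 0 f = x \<and> hact X 0 1 (cst 0 1) 0 f = y}"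
proof -
  have "act (level X 0) 0 0 (cst 0 0) z = z" if "z \<in> pts X 0 0" for z
    using sset_act_id[OF sspace_level[OF X], of z 0 0] that unfolding id_0 pts_def .
  then show ?thesis using x y by (simp add: map_space_def const0_cst)
qed

lemma map_space_map:
  assumes f: "sspace_map X Y f" and x: "x \<in> pts X 0 0" and y: "y \<in> pts X 0 0"
  shows "sset_map (map_space X x y) (map_space Y (f 0 0 x) (f 0 0 y))
    (\<lambda>n. restrict (f 1 n) (simp (map_space X x y) n))"
proof -
  note X = sspace_map_sspaces(1)[OF f] and Y = sspace_map_sspaces(2)[OF f]
  note XS = map_space_sset[OF X x y]
  note YS = map_space_sset[OF Y sspace_map_closed[OF f x] sspace_map_closed[OF f y]]
  have d: "f 0 n (act (level X 0) n 0 (const0 n) z) = act (level Y 0) n 0 (const0 n) (f 0 0 z)"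
    if "z \<in> pts X 0 0" for n z
    using sspace_map_act[OF f _ that, of "const0 n" n] by (simp add: const0_cst)
  have e: "f 0 n (hact X 0 1 \<delta> n e) = hact Y 0 1 \<delta> n (f 1 n e)"
    if "\<delta> \<in> Delta 0 1" "e \<in> pts X 1 n" for n e \<delta>
    using sspace_map_hact[OF f that] .
  show ?thesis
  proof (rule sset_mapI[OF XS YS])
    show "restrict (f 1 n) (simp (map_space X x y) n)
      \<in> simp (map_space X x y) n \<rightarrow>\<^sub>E simp (map_space Y (f 0 0 x) (f 0 0 y)) n" for n
      using d[OF x] d[OF y] e[of "cst 0 0" _ n] e[of "cst 0 1" _ n] sspace_map_closed[OF f]
      by (auto simp: map_space_def) (metis, metis)
    show "restrict (f 1 n) (simp (map_space X x y) n) (act (map_space X x y) n m \<theta> z) =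
        act (map_space Y (f 0 0 x) (f 0 0 y)) n m \<theta> (restrict (f 1 m) (simp (map_space X x y) m) z)"
      if "\<theta> \<in> Delta n m" "z \<in> simp (map_space X x y) m" for n m \<theta> z
      using that sset_act_closed[OF XS that] sspace_map_act[OF f that(1), of z 1]
      by (simp add: map_space_def)
  qed
qed

text \<open>The encoding of the nerve in a given type depends on both simplicial degrees, so that it is
  levelwise constant rather than levelwise discrete; \<open>T m\<close> identifies \<open>X\<^sub>m\<^sub>,\<^sub>0\<close> with \<open>Cat([m], C)\<close>.\<close>

locale nerve_like =
  fixes X :: "'x sspace" and C :: "('o, 'a) category"
    and T :: "nat \<Rightarrow> 'x \<Rightarrow> (nat, nat \<times> nat, 'o, 'a) fctr"
  assumes X: "is_sspace X" and C: "is_category C"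
    and const: "\<And>m. constant_sset (level X m)"
    and T_bij: "\<And>m. bij_betw (T m) (pts X m 0) (functors (ord_cat m) C)"
    and T_hact: "\<And>n m \<theta> x. \<theta> \<in> Delta n m \<Longrightarrow> x \<in> pts X m 0 \<Longrightarrow>
      T n (hact X n m \<theta> 0 x) = functor_comp (T m x) (ord_fctr n m \<theta>)"
begin

definition ob where "ob x = FObj (T 0 x) 0"
definition ar where "ar f = FArr (T 1 f) (0, 1)"

lemma T_functors: "x \<in> pts X m 0 \<Longrightarrow> T m x \<in> functors (ord_cat m) C"
  using T_bij bij_betw_apply by metis

lemma T_inj: "x \<in> pts X m 0 \<Longrightarrow> y \<in> pts X m 0 \<Longrightarrow> T m x = T m y \<Longrightarrow> x = y"
  using T_bij[of m] by (auto simp: bij_betw_def inj_on_def)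

lemma T_surj:
  assumes "F \<in> functors (ord_cat m) C"
  obtains x where "x \<in> pts X m 0" "T m x = F"
  using T_bij[of m] assms unfolding bij_betw_def by (metis imageE)

lemma ob_bij: "bij_betw ob (pts X 0 0) (Obj C)"
  using bij_betw_trans[OF T_bij source_functor_bij[OF C]] by (simp add: comp_def ob_def[abs_def])

lemma ar_bij: "bij_betw ar (pts X 1 0) (Arr C)"
  using bij_betw_trans[OF T_bij arrow_functor_bij[OF C]] by (simp add: comp_def ar_def[abs_def])

lemma ob_vertex: "x \<in> pts X m 0 \<Longrightarrow> i \<le> m \<Longrightarrow> ob (hact X 0 m (cst 0 i) 0 x) = FObj (T m x) i"
  by (simp add: ob_def T_hact)

lemma ar_edge:
  "x \<in> pts X m 0 \<Longrightarrow> i \<le> j \<Longrightarrow> j \<le> m \<Longrightarrow> ar (hact X 1 m (edge i j) 0 x) = FArr (T m x) (i, j)"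
  using T_hact[OF edge_Delta] by (simp add: ar_def edge_def)

lemma ar_degenerate: "x \<in> pts X 0 0 \<Longrightarrow> ar (hact X 1 0 (cst 1 0) 0 x) = Ident C (ob x)"
  using T_hact[of "cst 1 0" 1 0 x] ord_functor_ident[OF T_functors[of x 0], of 0]
  by (simp add: ar_def ob_def)

lemma ar_Hom:
  assumes f: "f \<in> pts X 1 0"
  shows "ar f \<in> Hom C (ob (hact X 0 1 (cst 0 0) 0 f)) (ob (hact X 0 1 (cst 0 1) 0 f))"
  using ord_functor_arr[OF T_functors[OF f], of 0 1] ob_vertex[OF f, of 0] ob_vertex[OF f, of 1]
  by (simp add: ar_def)

lemma pts_eqI:
  assumes x: "x \<in> pts X m 0" and y: "y \<in> pts X m 0"
    and ob: "\<And>i. i \<le> m \<Longrightarrow> ob (hact X 0 m (cst 0 i) 0 x) = ob (hact X 0 m (cst 0 i) 0 y)"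
    and ar: "\<And>i. i < m \<Longrightarrow> ar (hact X 1 m (edge i (Suc i)) 0 x) = ar (hact X 1 m (edge i (Suc i)) 0 y)"
  shows "x = y"
proof (rule T_inj[OF x y ord_functor_eqI[OF T_functors[OF x] T_functors[OF y]]])
  show "FObj (T m x) i = FObj (T m y) i" if "i \<le> m" for i
    using ob[OF that] ob_vertex[OF x that] ob_vertex[OF y that] by simp
  show "FArr (T m x) (i, Suc i) = FArr (T m y) (i, Suc i)" if "i < m" for i
    using ar[OF that] ar_edge[OF x, of i "Suc i"] ar_edge[OF y, of i "Suc i"] that by simp
qed

lemma ob_inj: "x \<in> pts X 0 0 \<Longrightarrow> y \<in> pts X 0 0 \<Longrightarrow> ob x = ob y \<Longrightarrow> x = y"
  using ob_bij by (auto simp: bij_betw_def inj_on_def)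

lemma ar_inj: "x \<in> pts X 1 0 \<Longrightarrow> y \<in> pts X 1 0 \<Longrightarrow> ar x = ar y \<Longrightarrow> x = y"
  using ar_bij by (auto simp: bij_betw_def inj_on_def)

lemma ob_Obj: "x \<in> pts X 0 0 \<Longrightarrow> ob x \<in> Obj C"
  using ob_bij bij_betw_apply by metis

text \<open>A composable string of length \<open>m\<close> extends to a functor on the ordinal,
  which \<open>T m\<close> identifies with an \<open>m\<close>-simplex. This existence half of the
  strict Segal condition also provides composites in \<open>ho X\<close>.\<close>

lemma path_filler:
  assumes a: "\<And>i. i \<le> m \<Longrightarrow> a i \<in> Obj C" and f: "\<And>i. i < m \<Longrightarrow> f i \<in> Hom C (a i) (a (Suc i))"
  obtains x where "x \<in> pts X m 0" "\<And>i. i \<le> m \<Longrightarrow> ob (hact X 0 m (cst 0 i) 0 x) = a i"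
    "\<And>i. i < m \<Longrightarrow> ar (hact X 1 m (edge i (Suc i)) 0 x) = f i"
proof -
  have P: "path_functor C m a f \<in> functors (ord_cat m) C"
    by (rule path_functor_functors[OF C]) (use a f in auto)
  obtain x where x: "x \<in> pts X m 0" "T m x = path_functor C m a f" using T_surj[OF P] by blast
  have "ob (hact X 0 m (cst 0 i) 0 x) = a i" if "i \<le> m" for i
    using ob_vertex[OF x(1) that] x(2) path_functor_obj[of C m a f i] C a f that by simp
  moreover have "ar (hact X 1 m (edge i (Suc i)) 0 x) = f i" if "i < m" for i
    using ar_edge[OF x(1), of i "Suc i"] x(2) path_functor_step[of C m a f i] C a f that by simp
  ultimately show thesis using that x(1) by blast
qed

text \<open>The strict Segal condition. Injectivity holds because vertices and consecutive edges,
  all of which lie in the spine, determine a simplex; for surjectivity, the string found on the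
  spine is filled by \<open>path_filler\<close>.\<close>

lemma segal_map_bij:
  assumes m: "m \<ge> 1"
  shows "bij_betw (restr_to (hdisc (spine m)) X m 0) (simp (level X m) 0) (simp (MapS (hdisc (spine m)) X) 0)"
proof -
  let ?K = "hdisc (spine m)"
  let ?r = "restr_to ?K X m 0"
  have Ks: "is_sset (spine m)" and sub: "\<And>k \<theta>. \<theta> \<in> simp (spine m) k \<Longrightarrow> \<theta> \<in> Delta k m"
    using spine_subcomplex[of m] by (auto simp: subcomplex_std_def)
  have K: "is_sspace ?K" using hdisc_sspace[OF Ks] .
  note r = restr_to_sset_map[OF spine_subcomplex X, of m]
  have v: "cst 0 i \<in> simp (spine m) 0" if i: "i \<le> m" for i
  proof -
    \<comment> \<open>The last vertex is not the start of an edge of the spine; it lies on the edge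
      starting at \<open>m - 1\<close>, which exists because \<open>m \<ge> 1\<close>.\<close>
    have "\<exists>j<m. cst 0 i ` {..0} \<subseteq> {j, Suc j}"
    proof (cases "i < m")
      case True then show ?thesis by (intro exI[of _ i]) auto
    next
      case False
      then have "i = Suc (m - 1)" "m - 1 < m" using i m by auto
      then show ?thesis by (intro exI[of _ "m - 1"]) (auto simp: cst_def)
    qed
    then show ?thesis using i by (simp add: spine_def)
  qed
  have e: "edge i (Suc i) \<in> simp (spine m) 1" if "i < m" for i
    using that edge_Delta[of i "Suc i" m] by (auto simp: spine_def edge_def)
  have rv: "?r x k 0 (\<theta>, cst 0 0) = hact X k m \<theta> 0 x" if "x \<in> pts X m 0" "\<theta> \<in> simp (spine m) k" for x k \<theta>
  proof -
    have "act (level X m) 0 0 (cst 0 0) x = x"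
      using sset_act_id[OF sspace_level[OF X], of x m 0] that(1) unfolding id_0 pts_def .
    then show ?thesis using that by (simp add: restr_to_def)
  qed
  \<comment> \<open>A vertex of the mapping space is determined in space degree 0: since
    \<open>hdisc\<close> is discrete in that direction, its other values are degeneracies of
    those.\<close>
  have eqI: "\<phi> = \<psi>" if \<phi>: "\<phi> \<in> simp (MapS ?K X) 0" and \<psi>: "\<psi> \<in> simp (MapS ?K X) 0"
    and eq: "\<And>k \<theta>. \<theta> \<in> simp (spine m) k \<Longrightarrow> \<phi> k 0 (\<theta>, cst 0 0) = \<psi> k 0 (\<theta>, cst 0 0)" for \<phi> \<psi>
  proof (rule MapS_eqI[OF K X \<phi> \<psi>])
    fix k l \<theta> \<tau> assume \<theta>: "\<theta> \<in> pts ?K k l" and \<tau>: "\<tau> \<in> Delta l 0"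
    have \<theta>0: "\<theta> \<in> pts ?K k 0" using \<theta> by simp
    have "act (level ?K k) l 0 (cst l 0) \<theta> = \<theta>" by (simp add: hdisc_def disc_sset_def)
    moreover have "compose {..l} (cst 0 0) (cst l 0) = \<tau>"
      using Delta_to_0[OF \<tau>] compose_cst_left[of "cst l 0" l 0 0] by simp
    ultimately have act0: "\<xi> k l (\<theta>, \<tau>) = act (level X k) l 0 (cst l 0) (\<xi> k 0 (\<theta>, cst 0 0))"
      if "\<xi> \<in> simp (MapS ?K X) 0" for \<xi>
      using MapS_act[OF K X that _ \<theta>0, of "cst l 0" l "cst 0 0"] by simp
    then show "\<phi> k l (\<theta>, \<tau>) = \<psi> k l (\<theta>, \<tau>)" using act0[OF \<phi>] act0[OF \<psi>] eq[of \<theta> k] \<theta> by simp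
  qed
  show ?thesis
  proof (rule bij_betwI')
    fix x y assume "x \<in> simp (level X m) 0" "y \<in> simp (level X m) 0"
    then have xy: "x \<in> pts X m 0" "y \<in> pts X m 0" by (auto simp: pts_def)
    show "?r x = ?r y \<longleftrightarrow> x = y"
    proof
      assume eq: "?r x = ?r y"
      then have "hact X k m \<theta> 0 x = hact X k m \<theta> 0 y" if "\<theta> \<in> simp (spine m) k" for k \<theta>
        using rv that xy by metis
      then show "x = y" using pts_eqI[OF xy] v e by metis
    qed simp
  next
    show "?r x \<in> simp (MapS ?K X) 0" if "x \<in> simp (level X m) 0" for x using sset_map_closed[OF r that] .
  next
    fix \<phi> assume \<phi>: "\<phi> \<in> simp (MapS ?K X) 0"
    define g where "g k \<theta> = \<phi> k 0 (\<theta>, cst 0 0)" for k \<theta>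
    have g: "g k \<theta> \<in> pts X k 0" if "\<theta> \<in> simp (spine m) k" for k \<theta>
      unfolding g_def using MapS_point_closed[OF K X \<phi>, of \<theta> k 0 "cst 0 0"] that by simp
    have gh: "g j (compose {..j} \<theta> \<sigma>) = hact X j k \<sigma> 0 (g k \<theta>)"
      if "\<theta> \<in> simp (spine m) k" "\<sigma> \<in> Delta j k" for j k \<theta> \<sigma>
      using MapS_hact[OF K X \<phi> that(2), of \<theta> 0 "cst 0 0"] that(1) unfolding g_def
      by (simp add: hdisc_def[THEN arg_cong[of _ _ hact]] spine_def[THEN arg_cong[of _ _ act]] std_def)
    \<comment> \<open>The string of objects and arrows that \<open>\<phi>\<close> takes along the
      spine; compatibility with vertex operators, in \<open>gh\<close>, makes it composable.\<close>
    define a where "a i = ob (g 0 (cst 0 i))" for i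
    define f where "f i = ar (g 1 (edge i (Suc i)))" for i
    have a: "a i \<in> Obj C" if "i \<le> m" for i unfolding a_def using ob_Obj g v that by blast
    have f: "f i \<in> Hom C (a i) (a (Suc i))" if "i < m" for i
      using ar_Hom[OF g[OF e[OF that]]] gh[OF e[OF that], of "cst 0 0" 0] gh[OF e[OF that], of "cst 0 1" 0]
        compose_edge[of i "Suc i"] unfolding f_def a_def by simp
    obtain x where x: "x \<in> pts X m 0" "\<And>i. i \<le> m \<Longrightarrow> ob (hact X 0 m (cst 0 i) 0 x) = a i"
      "\<And>i. i < m \<Longrightarrow> ar (hact X 1 m (edge i (Suc i)) 0 x) = f i"
      using path_filler[of m a f] a f by blast
    have "?r x = \<phi>"
    proof (rule eqI[OF sset_map_closed[OF r] \<phi>])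
      show "x \<in> simp (level X m) 0" using x(1) by (simp add: pts_def)
      fix k \<theta> assume \<theta>: "\<theta> \<in> simp (spine m) k"
      note \<theta>D = sub[OF \<theta>]
      have "hact X k m \<theta> 0 x = g k \<theta>"
      proof (rule pts_eqI[OF hact_closed[OF X \<theta>D x(1)] g[OF \<theta>]])
        fix i assume i: "i \<le> k"
        then show "ob (hact X 0 k (cst 0 i) 0 (hact X k m \<theta> 0 x)) = ob (hact X 0 k (cst 0 i) 0 (g k \<theta>))"
          using hact_comp[OF X _ \<theta>D x(1), of "cst 0 i" 0] gh[OF \<theta>, of "cst 0 i" 0] x(2)[of "\<theta> i"]
            Delta_le[OF \<theta>D i] by (simp add: a_def)
      next
        fix i assume i: "i < k"
        let ?e = "edge (\<theta> i) (\<theta> (Suc i))"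
        have eD: "edge i (Suc i) \<in> Delta 1 k" using edge_Delta i by simp
        have le: "\<theta> i \<le> \<theta> (Suc i)" "\<theta> (Suc i) \<le> m" using Delta_mono[OF \<theta>D, of i "Suc i"] Delta_le[OF \<theta>D] i by auto
        obtain j where j: "j < m" "\<theta> ` {..k} \<subseteq> {j, Suc j}" using \<theta> by (auto simp: spine_def)
        have "\<theta> i \<in> \<theta> ` {..k}" "\<theta> (Suc i) \<in> \<theta> ` {..k}" using i by auto
        then have "\<theta> i \<in> {j, Suc j}" "\<theta> (Suc i) \<in> {j, Suc j}" using j(2) by blast+
        \<comment> \<open>A simplex of the spine sends a consecutive edge to a point, where both
          sides are identities at the same object, or to a generating edge, where \<open>x\<close>
          was chosen to match.\<close>
        then consider "\<theta> (Suc i) = \<theta> i" | "\<theta> i = j" "\<theta> (Suc i) = Suc j" using le by auto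
        then have "ar (hact X 1 m ?e 0 x) = ar (g 1 ?e)"
        proof cases
          case 1
          let ?i = "\<theta> i"
          have i: "?i \<le> m" using le 1 by simp
          have c: "compose {..1} (cst 0 ?i) (cst 1 0) = cst 1 ?i"
            using compose_cst_right[of 0 0 1 "cst 0 ?i"] by simp
          have "hact X 1 m (cst 1 ?i) 0 x = hact X 1 0 (cst 1 0) 0 (hact X 0 m (cst 0 ?i) 0 x)"
            using hact_comp[OF X, of "cst 1 0" 1 0 "cst 0 ?i" m x 0] c i x(1) by simp
          moreover have "g 1 (cst 1 ?i) = hact X 1 0 (cst 1 0) 0 (g 0 (cst 0 ?i))"
            using gh[OF v[OF i], of "cst 1 0" 1] c by simp
          ultimately show ?thesis
            using ar_degenerate[OF hact_closed[OF X _ x(1)], of "cst 0 ?i"] ar_degenerate[OF g[OF v[OF i]]]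
              x(2)[OF i] i 1 by (simp add: edge_refl a_def)
        next
          case 2
          then show ?thesis using x(3)[OF j(1)] by (simp add: f_def)
        qed
        then show "ar (hact X 1 k (edge i (Suc i)) 0 (hact X k m \<theta> 0 x))
            = ar (hact X 1 k (edge i (Suc i)) 0 (g k \<theta>))"
          using hact_comp[OF X eD \<theta>D x(1)] gh[OF \<theta> eD] compose_edge_map[OF \<theta>D] by simp
      qed
      then show "?r x k 0 (\<theta>, cst 0 0) = \<phi> k 0 (\<theta>, cst 0 0)" using rv[OF x(1) \<theta>] by (simp add: g_def)
    qed
    then show "\<exists>x\<in>simp (level X m) 0. \<phi> = ?r x" using x(1) by (auto simp: pts_def)
  qed
qed

lemma segal: "segal_space X"
  unfolding segal_space_def
proof (intro conjI allI impI X)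
  have P: "is_sspace point" unfolding point_def by (rule const_sspace_sspace[OF disc_sset_sset])
  have "sspace_map X point (\<lambda>m n. \<lambda>x\<in>pts X m n. ())"
    by (rule sspace_mapI[OF X P]) (auto simp: point_def disc_sset_def level_act_closed[OF X] hact_closed[OF X])
  then show "reedy_fibration X point (\<lambda>m n. \<lambda>x\<in>pts X m n. ())"
    by (rule constant_reedy_fibration[OF _ const])
      (simp add: point_def const_sspace_def disc_sset_constant)
  fix m :: nat assume "m \<ge> 2"
  moreover have "is_sset (spine m)" using spine_subcomplex[of m] by (simp add: subcomplex_std_def)
  ultimately show "weak_equivalence (level X m) (MapS (hdisc (spine m)) X) (restr_to (hdisc (spine m)) X m)"
    using segal_map_bij[of m]
    by (intro constant_weak_equivalence restr_to_sset_map spine_subcomplex X const MapS_constant) auto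
qed

lemma map_space_points': "x \<in> pts X 0 0 \<Longrightarrow> y \<in> pts X 0 0 \<Longrightarrow>
    bij_betw ar (simp (map_space X x y) 0) (Hom C (ob x) (ob y))"
proof -
  assume x: "x \<in> pts X 0 0" and y: "y \<in> pts X 0 0"
  note P = map_space_points[OF X x y]
  show ?thesis
  proof (rule bij_betwI')
    show "ar f = ar g \<longleftrightarrow> f = g" if "f \<in> simp (map_space X x y) 0" "g \<in> simp (map_space X x y) 0" for f g
      using that ar_inj unfolding P by blast
    show "ar f \<in> Hom C (ob x) (ob y)" if "f \<in> simp (map_space X x y) 0" for f
      using that ar_Hom[of f] unfolding P by auto
    fix h assume h: "h \<in> Hom C (ob x) (ob y)"
    obtain f where f: "f \<in> pts X 1 0" "ar f = h"
      using ar_bij HomD(1)[OF h] unfolding bij_betw_def by (metis imageE)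
    have "ob (hact X 0 1 (cst 0 0) 0 f) = ob x" "ob (hact X 0 1 (cst 0 1) 0 f) = ob y"
      using ar_Hom[OF f(1)] h f(2) by (auto simp: Hom_def)
    then have "f \<in> simp (map_space X x y) 0"
      unfolding P using ob_inj hact_closed[OF X _ f(1)] x y f(1) by simp
    then show "\<exists>f\<in>simp (map_space X x y) 0. h = ar f" using f(2) by blast
  qed
qed

section \<open>The homotopy category of a nerve\<close>

lemma ho_Arr:
  "Arr (ho X) = {(x, y, {f}) | x y f. x \<in> pts X 0 0 \<and> y \<in> pts X 0 0 \<and> f \<in> simp (map_space X x y) 0}"
  unfolding ho_def using constant_pi0[OF map_space_constant[OF X const]] by auto

lemma ho_simps:
  "Obj (ho X) = pts X 0 0" "Dom (ho X) (x, y, s) = x" "Cod (ho X) (x, y, s) = y"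
  by (auto simp: ho_def)

lemma degenerate_map_space:
  assumes x: "x \<in> pts X 0 0"
  shows "hact X 1 0 (cst 1 0) 0 x \<in> simp (map_space X x x) 0"
proof -
  have "hact X 0 1 (cst 0 i) 0 (hact X 1 0 (cst 1 0) 0 x) = x" if "i \<le> 1" for i
    using hact_comp[OF X, of "cst 0 i" 0 1 "cst 1 0" 0 x 0] that x hact_id[OF X x] unfolding id_0 by simp
  then show ?thesis using map_space_points[OF X x x] hact_closed[OF X _ x, of "cst 1 0" 1] by simp
qed

lemma ho_Ident: "x \<in> pts X 0 0 \<Longrightarrow> Ident (ho X) x = (x, x, {hact X 1 0 (cst 1 0) 0 x})"
  using constant_pi0_rel[OF map_space_constant[OF X const]] degenerate_map_space
  by (simp add: ho_def const0_cst)

lemma composite_filler: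
  assumes a: "a \<in> Hom C x y" and b: "b \<in> Hom C y z"
  obtains \<sigma> where "\<sigma> \<in> pts X 2 0" "ar (hact X 1 2 (edge 0 1) 0 \<sigma>) = a"
    "ar (hact X 1 2 (edge 1 2) 0 \<sigma>) = b"
proof -
  define p where "p i = (if i = 0 then x else if i = 1 then y else z)" for i :: nat
  define k where "k i = (if i = 0 then a else b)" for i :: nat
  have "p i \<in> Obj C" for i using Hom_Obj[OF C a] Hom_Obj[OF C b] by (simp add: p_def)
  moreover have "k i \<in> Hom C (p i) (p (Suc i))" if "i < 2" for i
    using that a b by (auto simp: p_def k_def less_2_cases_iff)
  ultimately obtain \<sigma> where \<sigma>: "\<sigma> \<in> pts X 2 0" "\<And>i. i < 2 \<Longrightarrow> ar (hact X 1 2 (edge i (Suc i)) 0 \<sigma>) = k i"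
    using path_filler[of 2 p k] by metis
  then show thesis using that[OF \<sigma>(1)] \<sigma>(2)[of 0] \<sigma>(2)[of 1] by (auto simp: k_def numeral_2_eq_2)
qed

lemma ar_composite:
  assumes "\<sigma> \<in> pts X 2 0"
  shows "ar (hact X 1 2 (edge 0 2) 0 \<sigma>)
    = Comp C (ar (hact X 1 2 (edge 1 2) 0 \<sigma>)) (ar (hact X 1 2 (edge 0 1) 0 \<sigma>))"
  using ord_functor_comp[OF T_functors[OF assms], of 0 1 2] ar_edge[OF assms, of 0 1]
    ar_edge[OF assms, of 1 2] ar_edge[OF assms, of 0 2] by simp

text \<open>Hom components are singletons, so the set of candidate composites in \<open>ho\<close>
  has to be shown to be a singleton as well: a suitable 2-simplex exists, and its remaining edge is
  forced.\<close>

lemma ho_Comp: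
  assumes x: "x \<in> pts X 0 0" and y: "y \<in> pts X 0 0" and z: "z \<in> pts X 0 0"
    and f: "f \<in> simp (map_space X x y) 0" and g: "g \<in> simp (map_space X y z) 0"
  obtains h where "h \<in> simp (map_space X x z) 0" "ar h = Comp C (ar g) (ar f)"
    "Comp (ho X) (y, z, {g}) (x, y, {f}) = (x, z, {h})"
proof -
  have fp: "f \<in> pts X 1 0" and gp: "g \<in> pts X 1 0"
    using f g map_space_points[OF X x y] map_space_points[OF X y z] by auto
  have fH: "ar f \<in> Hom C (ob x) (ob y)" and gH: "ar g \<in> Hom C (ob y) (ob z)"
    using bij_betw_apply[OF map_space_points'[OF x y] f] bij_betw_apply[OF map_space_points'[OF y z] g] by auto
  have hH: "Comp C (ar g) (ar f) \<in> Hom C (ob x) (ob z)" using comp_Hom[OF C fH gH] .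
  obtain h where h: "h \<in> simp (map_space X x z) 0" "ar h = Comp C (ar g) (ar f)"
    using map_space_points'[OF x z] hH unfolding bij_betw_def by (metis imageE)
  have hp: "h \<in> pts X 1 0" using h(1) map_space_points[OF X x z] by auto
  obtain \<sigma> where \<sigma>: "\<sigma> \<in> pts X 2 0" "ar (hact X 1 2 (edge 0 1) 0 \<sigma>) = ar f"
    "ar (hact X 1 2 (edge 1 2) 0 \<sigma>) = ar g" using composite_filler[OF fH gH] .
  have eD: "edge 0 1 \<in> Delta 1 2" "edge 1 2 \<in> Delta 1 2" "edge 0 2 \<in> Delta 1 2"
    using edge_Delta[of _ _ 2] by auto
  have \<sigma>e: "hact X 1 2 (edge 0 1) 0 \<sigma> = f" "hact X 1 2 (edge 1 2) 0 \<sigma> = g"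
    using ar_inj hact_closed[OF X _ \<sigma>(1)] eD fp gp \<sigma>(2,3) by metis+
  \<comment> \<open>Every 2-simplex over \<open>f\<close> and \<open>g\<close> has the composite in
    \<open>C\<close> as its long edge, and \<open>ar\<close> is injective.\<close>
  have comp: "hact X 1 2 (edge 0 2) 0 \<rho> = h"
    if "\<rho> \<in> pts X 2 0" "hact X 1 2 (edge 0 1) 0 \<rho> = f" "hact X 1 2 (edge 1 2) 0 \<rho> = g" for \<rho>
  proof -
    have "ar (hact X 1 2 (edge 0 2) 0 \<rho>) = ar h" using ar_composite[OF that(1)] that(2,3) h(2) by simp
    then show ?thesis using ar_inj[OF hact_closed[OF X eD(3) that(1)] hp] by simp
  qed
  have "{hact X 1 2 (coface 1 1) 0 \<sigma> | \<sigma>. \<sigma> \<in> pts X 2 0 \<and>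
     hact X 1 2 (coface 1 2) 0 \<sigma> \<in> {f} \<and> hact X 1 2 (coface 1 0) 0 \<sigma> \<in> {g}} = {h}"
    using comp \<sigma>(1) \<sigma>e unfolding coface_1 by blast
  then have "Comp (ho X) (y, z, {g}) (x, y, {f}) = (x, z, pi0_rel (map_space X x z) `` {h})"
    by (simp add: ho_def)
  also have "pi0_rel (map_space X x z) `` {h} = {h}"
    using constant_pi0_rel[OF map_space_constant[OF X const x z]] by simp
  finally show thesis using that[OF h] by blast
qed

text \<open>\<open>the_elem\<close> is meaningful because the component \<open>s\<close> consists of
  one vertex.\<close>

definition ho_ar :: "'x \<times> 'x \<times> 'x set \<Rightarrow> 'a" where
  "ho_ar = (\<lambda>(x, y, s). ar (the_elem s))"

lemma ho_ar [simp]: "ho_ar (x, y, {f}) = ar f"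
  by (simp add: ho_ar_def)

lemma ho_ArrE:
  assumes "u \<in> Arr (ho X)"
  obtains x y f where "u = (x, y, {f})" "x \<in> pts X 0 0" "y \<in> pts X 0 0" "f \<in> simp (map_space X x y) 0"
    "ar f \<in> Hom C (ob x) (ob y)" "f \<in> pts X 1 0"
  using assms map_space_points'[THEN bij_betw_apply] map_space_points[OF X] unfolding ho_Arr by blast

text \<open>Besides the comparison with \<open>C\<close>, this is what shows that
  \<open>ho X\<close> is a category at all.\<close>

lemma ho_cat_bij: "cat_bij (ho X) C ob ho_ar"
  unfolding cat_bij_def
proof (intro conjI ballI impI C)
  show "bij_betw ob (Obj (ho X)) (Obj C)" using ob_bij by (simp add: ho_simps)
  show "bij_betw ho_ar (Arr (ho X)) (Arr C)"
  proof (rule bij_betwI')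
    fix u v assume u: "u \<in> Arr (ho X)" and v: "v \<in> Arr (ho X)"
    obtain x y f where u': "u = (x, y, {f})" "f \<in> pts X 1 0" "f \<in> simp (map_space X x y) 0"
      "x \<in> pts X 0 0" "y \<in> pts X 0 0"
      using ho_ArrE[OF u] by metis
    obtain x' y' g where v': "v = (x', y', {g})" "g \<in> pts X 1 0" "g \<in> simp (map_space X x' y') 0"
      "x' \<in> pts X 0 0" "y' \<in> pts X 0 0"
      using ho_ArrE[OF v] by metis
    \<comment> \<open>The first two entries of an arrow of \<open>ho X\<close> are the end vertices
      of its single representative, so equality of the representatives suffices.\<close>
    show "ho_ar u = ho_ar v \<longleftrightarrow> u = v"
      using ar_inj[OF u'(2) v'(2)] u' v' map_space_points[OF X] by auto
  next
    show "ho_ar u \<in> Arr C" if "u \<in> Arr (ho X)" for u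
      using that by (auto elim!: ho_ArrE dest: HomD(1))
  next
    fix h assume h: "h \<in> Arr C"
    obtain x y where xy: "x \<in> pts X 0 0" "y \<in> pts X 0 0" "ob x = Dom C h" "ob y = Cod C h"
    proof -
      have "Dom C h \<in> Obj C" "Cod C h \<in> Obj C" using h C unfolding is_category_def by blast+
      then have "Dom C h \<in> ob ` pts X 0 0" "Cod C h \<in> ob ` pts X 0 0"
        using ob_bij unfolding bij_betw_def by auto
      then show thesis using that by fastforce
    qed
    then have "h \<in> Hom C (ob x) (ob y)" using h by (simp add: Hom_def)
    then obtain f where "f \<in> simp (map_space X x y) 0" "ar f = h"
      using map_space_points'[OF xy(1,2)] unfolding bij_betw_def by (metis imageE)
    then show "\<exists>u\<in>Arr (ho X). h = ho_ar u"
      using xy by (intro bexI[of _ "(x, y, {f})"]) (auto simp: ho_Arr)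
  qed
  fix u assume u: "u \<in> Arr (ho X)"
  then obtain x y f where uf: "u = (x, y, {f})" "x \<in> pts X 0 0" "y \<in> pts X 0 0" "f \<in> simp (map_space X x y) 0"
    "ar f \<in> Hom C (ob x) (ob y)" by (rule ho_ArrE)
  then show "Dom (ho X) u \<in> Obj (ho X)" "Cod (ho X) u \<in> Obj (ho X)"
    "Dom C (ho_ar u) = ob (Dom (ho X) u)" "Cod C (ho_ar u) = ob (Cod (ho X) u)"
    by (auto simp: ho_simps Hom_def)
  fix v assume v: "v \<in> Arr (ho X)" "Cod (ho X) u = Dom (ho X) v"
  then obtain z g where vg: "v = (y, z, {g})" "z \<in> pts X 0 0" "g \<in> simp (map_space X y z) 0"
    using uf(1) by (auto elim!: ho_ArrE simp: ho_simps)
  obtain h where "h \<in> simp (map_space X x z) 0" "ar h = Comp C (ar g) (ar f)" "Comp (ho X) v u = (x, z, {h})"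
    using ho_Comp[OF uf(2,3) vg(2) uf(4) vg(3)] vg(1) uf(1) by metis
  then show "Comp (ho X) v u \<in> Arr (ho X)" "ho_ar (Comp (ho X) v u) = Comp C (ho_ar v) (ho_ar u)"
    using uf vg by (auto simp: ho_Arr)
next
  fix x assume "x \<in> Obj (ho X)"
  then show "Ident (ho X) x \<in> Arr (ho X)" "ho_ar (Ident (ho X) x) = Ident C (ob x)"
    using degenerate_map_space ar_degenerate by (auto simp: ho_simps ho_Ident ho_Arr)
qed

end

text \<open>Compatibility of \<open>f\<close> with \<open>F\<close> is stated in space degree 0,
  where \<open>T\<close> and \<open>S\<close> are defined; constancy of the levels settles the other
  degrees.\<close>

locale nerve_like_map = D: nerve_like X C T + E: nerve_like Y D S
  for X :: "'x sspace" and C :: "('o, 'a) category" and T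
    and Y :: "'y sspace" and D :: "('p, 'b) category" and S +
  fixes F :: "('o, 'a, 'p, 'b) fctr" and f :: "nat \<Rightarrow> nat \<Rightarrow> 'x \<Rightarrow> 'y"
  assumes F: "F \<in> functors C D" and f: "sspace_map X Y f"
    and S_f: "\<And>m x. x \<in> pts X m 0 \<Longrightarrow> S m (f m 0 x) = functor_comp F (T m x)"
begin

lemma ob_f: "x \<in> pts X 0 0 \<Longrightarrow> E.ob (f 0 0 x) = FObj F (D.ob x)"
  using functorsD[OF D.T_functors[of x 0]] by (simp add: D.ob_def E.ob_def S_f)

lemma ar_f: "e \<in> pts X 1 0 \<Longrightarrow> E.ar (f 1 0 e) = FArr F (D.ar e)"
  using functorsD[OF D.T_functors[of e 1]] by (simp add: D.ar_def E.ar_def S_f)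

lemma map_space_f:
  assumes "x \<in> pts X 0 0" "y \<in> pts X 0 0" "e \<in> simp (map_space X x y) 0"
  shows "f 1 0 e \<in> simp (map_space Y (f 0 0 x) (f 0 0 y)) 0"
  using sset_map_closed[OF map_space_map[OF f assms(1,2)] assms(3)] assms(3) by simp

lemma ho_map_arr:
  assumes "x \<in> pts X 0 0" "y \<in> pts X 0 0" "e \<in> simp (map_space X x y) 0"
  shows "FArr (ho_map X Y f) (x, y, {e}) = (f 0 0 x, f 0 0 y, {f 1 0 e})"
proof -
  have "pi0_rel (map_space Y (f 0 0 x) (f 0 0 y)) `` {f 1 0 e} = {f 1 0 e}"
    using constant_pi0_rel[OF map_space_constant[OF E.X E.const]] sspace_map_closed[OF f] assms by simp
  then show ?thesis using assms by (auto simp: ho_map_def D.ho_Arr)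
qed

lemma ho_map_square:
  shows "FDom (ho_map X Y f) = ho X" "FCod (ho_map X Y f) = ho Y"
    and "FObj (ho_map X Y f) \<in> Obj (ho X) \<rightarrow>\<^sub>E Obj (ho Y)"
    and "FArr (ho_map X Y f) \<in> Arr (ho X) \<rightarrow>\<^sub>E Arr (ho Y)"
    and "\<And>x. x \<in> Obj (ho X) \<Longrightarrow> E.ob (FObj (ho_map X Y f) x) = FObj F (D.ob x)"
    and "\<And>u. u \<in> Arr (ho X) \<Longrightarrow> E.ho_ar (FArr (ho_map X Y f) u) = FArr F (D.ho_ar u)"
proof -
  show "FDom (ho_map X Y f) = ho X" "FCod (ho_map X Y f) = ho Y" by (auto simp: ho_map_def)
  show "FObj (ho_map X Y f) \<in> Obj (ho X) \<rightarrow>\<^sub>E Obj (ho Y)"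
    using sspace_map_ext[OF f, of 0 0] by (simp add: ho_map_def D.ho_simps E.ho_simps)
  show "E.ob (FObj (ho_map X Y f) x) = FObj F (D.ob x)" if "x \<in> Obj (ho X)" for x
    using ob_f that by (simp add: ho_map_def D.ho_simps)
  show "E.ho_ar (FArr (ho_map X Y f) u) = FArr F (D.ho_ar u)" if "u \<in> Arr (ho X)" for u
    using that by (auto elim!: D.ho_ArrE simp: ho_map_arr ar_f[unfolded One_nat_def])
  have "FArr (ho_map X Y f) u \<in> Arr (ho Y)" if "u \<in> Arr (ho X)" for u
    using that by (auto elim!: D.ho_ArrE simp: ho_map_arr E.ho_Arr map_space_f[unfolded One_nat_def] sspace_map_closed[OF f])
  then show "FArr (ho_map X Y f) \<in> Arr (ho X) \<rightarrow>\<^sub>E Arr (ho Y)"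
    by (auto simp: ho_map_def)
qed

lemma isofibration:
  assumes "is_isofibration F"
  shows "segal_isofibration X Y f"
  unfolding segal_isofibration_def
  using D.segal E.segal constant_reedy_fibration[OF f D.const E.const]
    cat_bij_isofibration[OF D.ho_cat_bij E.ho_cat_bij F ho_map_square assms] by blast

text \<open>The mapping spaces are constant with the hom sets as vertices, so on them the condition
  is bijectivity on hom sets, that is, full faithfulness of \<open>F\<close>.\<close>

lemma equivalence:
  assumes eq: "is_equivalence F"
  shows "dk_equivalence X Y f"
  unfolding dk_equivalence_def
proof (intro conjI ballI D.segal E.segal f)
  note F' = functorsD[OF F]
  obtain G \<alpha> \<beta> where inverse: "is_functor F" "G \<in> functors (FCod F) (FDom F)"
    "nat_iso (fid (FDom F)) (functor_comp G F) \<alpha>" "nat_iso (functor_comp F G) (fid (FCod F)) \<beta>"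
    using eq unfolding is_equivalence_def by blast
  show "essentially_surjective (ho_map X Y f)"
    by (rule cat_bij_essentially_surjective[OF D.ho_cat_bij E.ho_cat_bij F ho_map_square
          inverse_essentially_surjective[OF inverse]])
  fix x y assume x: "x \<in> pts X 0 0" and y: "y \<in> pts X 0 0"
  let ?M = "map_space X x y" and ?N = "map_space Y (f 0 0 x) (f 0 0 y)"
  note fx = sspace_map_closed[OF f x] and fy = sspace_map_closed[OF f y]
  have M1: "e \<in> pts X 1 0" if "e \<in> simp ?M 0" for e using that map_space_points[OF D.X x y] by simp
  have bM: "bij_betw D.ar (simp ?M 0) (Hom C (D.ob x) (D.ob y))" using D.map_space_points'[OF x y] .
  have bN: "bij_betw E.ar (simp ?N 0) (Hom D (FObj F (D.ob x)) (FObj F (D.ob y)))"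
    using E.map_space_points'[OF fx fy] ob_f[OF x] ob_f[OF y] by simp
  have "bij_betw (restrict (f 1 0) (simp ?M 0)) (simp ?M 0) (simp ?N 0)"
  proof (rule bij_betwI')
    fix e e' assume e: "e \<in> simp ?M 0" "e' \<in> simp ?M 0"
    have "e = e'" if "f 1 0 e = f 1 0 e'"
    proof -
      have "FArr F (D.ar e) = FArr F (D.ar e')" using ar_f[OF M1] e that by metis
      then have "D.ar e = D.ar e'"
        using inverse_faithful[OF inverse, of "D.ar e" "D.ob x" "D.ob y" "D.ar e'"]
          bij_betw_apply[OF bM] e F' by simp
      then show ?thesis using D.ar_inj M1 e by blast
    qed
    then show "(restrict (f 1 0) (simp ?M 0) e = restrict (f 1 0) (simp ?M 0) e') = (e = e')"
      using e by auto
    show "restrict (f 1 0) (simp ?M 0) e \<in> simp ?N 0" using e map_space_f[OF x y] by simp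
  next
    fix g assume g: "g \<in> simp ?N 0"
    have gp: "g \<in> pts Y 1 0" using g map_space_points[OF E.X fx fy] by simp
    obtain h where h: "h \<in> Hom C (D.ob x) (D.ob y)" "FArr F h = E.ar g"
      using inverse_full[OF inverse, of "E.ar g" "D.ob x" "D.ob y"] bij_betw_apply[OF bN g]
        D.ob_Obj[OF x] D.ob_Obj[OF y] F' by auto
    obtain e where e: "e \<in> simp ?M 0" "D.ar e = h" using bM h(1) unfolding bij_betw_def by (metis imageE)
    have "E.ar (f 1 0 e) = E.ar g" using ar_f[OF M1[OF e(1)]] e(2) h(2) by simp
    then have "f 1 0 e = g" using E.ar_inj[OF sspace_map_closed[OF f M1[OF e(1)]] gp] by simp
    then show "\<exists>e\<in>simp ?M 0. g = restrict (f 1 0) (simp ?M 0) e" using e(1) by auto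
  qed
  then show "weak_equivalence ?M ?N (\<lambda>n. restrict (f 1 n) (simp ?M n))"
    by (intro constant_weak_equivalence map_space_map[OF f x y] map_space_constant D.X E.X D.const
        E.const x y fx fy)
qed

end

section \<open>Full faithfulness of the nerve\<close>

locale nerve_like_pair = D: nerve_like X C T + E: nerve_like Y D S
  for X :: "'x sspace" and C :: "('o, 'a) category" and T
    and Y :: "'y sspace" and D :: "('p, 'b) category" and S +
  fixes f :: "nat \<Rightarrow> nat \<Rightarrow> 'x \<Rightarrow> 'y"
  assumes f: "sspace_map X Y f"
begin

text \<open>Read off from the effect of \<open>f\<close> on vertices and edges, through the
  bijections of these with objects and arrows. Nothing is presupposed about \<open>f\<close> coming
  from a functor.\<close>

definition induced :: "('o, 'a, 'p, 'b) fctr" where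
  "induced = \<lparr>FDom = C, FCod = D,
     FObj = (\<lambda>c\<in>Obj C. E.ob (f 0 0 (inv_into (pts X 0 0) D.ob c))),
     FArr = (\<lambda>a\<in>Arr C. E.ar (f 1 0 (inv_into (pts X 1 0) D.ar a)))\<rparr>"

lemma induced_ob: "x \<in> pts X 0 0 \<Longrightarrow> FObj induced (D.ob x) = E.ob (f 0 0 x)"
  using D.ob_bij D.ob_Obj by (simp add: induced_def bij_betw_def inv_into_f_f)

lemma induced_ar: "e \<in> pts X 1 0 \<Longrightarrow> FArr induced (D.ar e) = E.ar (f 1 0 e)"
  using D.ar_bij HomD(1)[OF D.ar_Hom] by (simp add: induced_def bij_betw_def inv_into_f_f)

lemma ob_cases:
  assumes "c \<in> Obj C"
  obtains x where "x \<in> pts X 0 0" "c = D.ob x"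
  using assms D.ob_bij unfolding bij_betw_def by (metis imageE)

lemma ar_cases:
  assumes "a \<in> Hom C c c'"
  obtains e where "e \<in> pts X 1 0" "a = D.ar e"
    "c = D.ob (hact X 0 1 (cst 0 0) 0 e)" "c' = D.ob (hact X 0 1 (cst 0 1) 0 e)"
proof -
  obtain e where e: "e \<in> pts X 1 0" "a = D.ar e"
    using HomD(1)[OF assms] D.ar_bij unfolding bij_betw_def by (metis imageE)
  then show thesis using that[OF e] D.ar_Hom[OF e(1)] assms by (auto simp: Hom_def)
qed

lemma induced_functors: "induced \<in> functors C D"
proof (rule functorsI)
  have s: "FDom induced = C" "FCod induced = D" by (auto simp: induced_def)
  show "is_functor induced"
  proof (rule is_functorI, simp_all only: s)
    show "is_category C" "is_category D" using D.C E.C by auto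
    show "FObj induced \<in> extensional (Obj C)" "FArr induced \<in> extensional (Arr C)"
      by (auto simp: induced_def)
    show "FObj induced c \<in> Obj D" if "c \<in> Obj C" for c
      using that by (rule ob_cases) (simp add: induced_ob E.ob_Obj sspace_map_closed[OF f])
    show "FArr induced a \<in> Hom D (FObj induced c) (FObj induced c')" if a: "a \<in> Hom C c c'" for a c c'
    proof -
      obtain e where e: "e \<in> pts X 1 0" "a = D.ar e"
        "c = D.ob (hact X 0 1 (cst 0 0) 0 e)" "c' = D.ob (hact X 0 1 (cst 0 1) 0 e)"
        using a by (rule ar_cases)
      have v: "hact X 0 1 (cst 0 i) 0 e \<in> pts X 0 0" if "i \<le> 1" for i
        using hact_closed[OF D.X _ e(1)] that by simp
      show ?thesis
        using E.ar_Hom[OF sspace_map_closed[OF f e(1)]] induced_ar[OF e(1)] induced_ob[OF v, of 0]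
          induced_ob[OF v, of 1] sspace_map_hact[OF f _ e(1), of "cst 0 0"]
          sspace_map_hact[OF f _ e(1), of "cst 0 1"] e by simp
    qed
    show "FArr induced (Ident C c) = Ident D (FObj induced c)" if c: "c \<in> Obj C" for c
    proof -
      obtain x where x: "x \<in> pts X 0 0" "c = D.ob x" using c by (rule ob_cases)
      have s: "hact X 1 0 (cst 1 0) 0 x \<in> pts X 1 0" using hact_closed[OF D.X _ x(1)] by simp
      show ?thesis
        using D.ar_degenerate[OF x(1)] E.ar_degenerate[OF sspace_map_closed[OF f x(1)]] induced_ar[OF s]
          induced_ob[OF x(1)] sspace_map_hact[OF f _ x(1), of "cst 1 0" 1] x(2) by simp
    qed
    show "FArr induced (Comp C b a) = Comp D (FArr induced b) (FArr induced a)"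
      if a: "a \<in> Hom C x y" and b: "b \<in> Hom C y z" for a b x y z
    proof -
      \<comment> \<open>Composition is encoded by 2-simplices: \<open>f\<close> sends one witnessing
        the composite of \<open>a\<close> and \<open>b\<close> to one witnessing the composite of
        their images.\<close>
      obtain \<sigma> where \<sigma>: "\<sigma> \<in> pts X 2 0" "D.ar (hact X 1 2 (edge 0 1) 0 \<sigma>) = a"
        "D.ar (hact X 1 2 (edge 1 2) 0 \<sigma>) = b" using D.composite_filler[OF a b] .
      have "FArr induced (D.ar (hact X 1 2 (edge i j) 0 \<sigma>)) = E.ar (hact Y 1 2 (edge i j) 0 (f 2 0 \<sigma>))"
        if "i \<le> j" "j \<le> 2" for i j
        using induced_ar[OF hact_closed[OF D.X edge_Delta[OF that] \<sigma>(1)]]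
          sspace_map_hact[OF f edge_Delta[OF that] \<sigma>(1)] by simp
      from this[of 0 1] this[of 1 2] this[of 0 2] show ?thesis
        using D.ar_composite[OF \<sigma>(1)] E.ar_composite[OF sspace_map_closed[OF f \<sigma>(1)]] \<sigma>(2,3) by simp
    qed
  qed
qed (auto simp: induced_def)

text \<open>Fullness in degree \<open>m\<close>: both sides are functors on the ordinal, and these
  are determined by vertices and consecutive edges, where \<open>induced\<close> was defined to
  agree with \<open>f\<close>.\<close>

lemma induced_T:
  assumes x: "x \<in> pts X m 0"
  shows "S m (f m 0 x) = functor_comp induced (T m x)"
proof (rule ord_functor_eqI)
  note fx = sspace_map_closed[OF f x]
  note t = functorsD[OF D.T_functors[OF x]]
  show "S m (f m 0 x) \<in> functors (ord_cat m) D" by (rule E.T_functors[OF fx])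
  show "functor_comp induced (T m x) \<in> functors (ord_cat m) D"
    by (rule functor_comp_functors[OF D.T_functors[OF x] induced_functors])
  show "FObj (S m (f m 0 x)) i = FObj (functor_comp induced (T m x)) i" if i: "i \<le> m" for i
    using E.ob_vertex[OF fx i] D.ob_vertex[OF x i] induced_ob[OF hact_closed[OF D.X _ x], of "cst 0 i"]
      sspace_map_hact[OF f _ x, of "cst 0 i" 0] i t by simp
  show "FArr (S m (f m 0 x)) (i, Suc i) = FArr (functor_comp induced (T m x)) (i, Suc i)"
    if i: "i < m" for i
    using E.ar_edge[OF fx, of i "Suc i"] D.ar_edge[OF x, of i "Suc i"] edge_Delta[of i "Suc i" m]
      induced_ar[OF hact_closed[OF D.X _ x], of "edge i (Suc i)"]
      sspace_map_hact[OF f _ x, of "edge i (Suc i)" 1] i t by simp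
qed

end

text \<open>Faithfulness: the vertices and edges of \<open>X\<close> exhaust the objects and arrows
  of \<open>C\<close>, so \<open>f\<close> leaves no choice for the functor.\<close>

lemma (in nerve_like_map) functor_determined:
  assumes "nerve_like_map X C T Y D S F' f"
  shows "F' = F"
proof -
  interpret N: nerve_like_map X C T Y D S F' f by fact
  show ?thesis
  proof (rule functor_ext[OF N.F F])
    show "FObj F' c = FObj F c" if "c \<in> Obj C" for c
      using that D.ob_bij ob_f N.ob_f unfolding bij_betw_def by (metis imageE)
    show "FArr F' a = FArr F a" if "a \<in> Arr C" for a
      using that D.ar_bij ar_f N.ar_f unfolding bij_betw_def by (metis imageE)
  qed
qed

text \<open>In a constant target the image of a simplex is the total degeneracy of the image of its
  vertex 0, so space degree 0 decides.\<close>

lemma map_to_constant_ext: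
  assumes f: "sspace_map X Y f" and g: "sspace_map X Y g" and Y: "\<And>m. constant_sset (level Y m)"
    and eq: "\<And>m x. x \<in> pts X m 0 \<Longrightarrow> f m 0 x = g m 0 x"
  shows "f = g"
proof (intro ext)
  fix m n x
  show "f m n x = g m n x"
  proof (cases "x \<in> pts X m n")
    case True
    have "act (level X m) 0 n (cst 0 0) x \<in> pts X m 0"
      using level_act_closed[OF sspace_map_sspaces(1)[OF f] _ True] by simp
    then show ?thesis
      using map_to_constant[OF sspace_map_level[OF f] Y, of x m n 0]
        map_to_constant[OF sspace_map_level[OF g] Y, of x m n 0] True eq by (simp add: pts_def)
  next
    case False
    then show ?thesis using sspace_map_ext[OF f, of m n] sspace_map_ext[OF g, of m n]
      by (auto simp: PiE_def extensional_def)
  qed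
qed


section \<open>The encoded nerve\<close>

lemma infinite_pairing:
  assumes "infinite (UNIV :: 'u set)"
  obtains p :: "'u \<times> 'u \<Rightarrow> 'u" where "inj p"
proof -
  have "|UNIV :: ('u \<times> 'u) set| \<le>o |UNIV :: 'u set|"
    using card_of_Times_same_infinite[OF assms] ordIso_iff_ordLeq by (metis UNIV_Times_UNIV)
  then show thesis using that card_of_ordLeq[of "UNIV :: ('u \<times> 'u) set" "UNIV :: 'u set"] by blast
qed

text \<open>Pairing with one of two distinct tags; this makes room in the universe for coproducts of
  simplicial spaces.\<close>

lemma infinite_sum_injection:
  assumes "infinite (UNIV :: 'u set)"
  obtains e :: "'u + 'u \<Rightarrow> 'u" where "inj e"
proof -
  obtain p :: "'u \<times> 'u \<Rightarrow> 'u" where p: "inj p" using infinite_pairing[OF assms] .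
  obtain a b :: 'u where ab: "a \<noteq> b" using ex_new_if_finite[OF assms, of "{undefined}"] by auto
  have "inj (case_sum (\<lambda>x. p (a, x)) (\<lambda>x. p (b, x)))"
  proof (rule injI)
    fix x y :: "'u + 'u"
    assume "case_sum (\<lambda>x. p (a, x)) (\<lambda>x. p (b, x)) x = case_sum (\<lambda>x. p (a, x)) (\<lambda>x. p (b, x)) y"
    then show "x = y" using ab by (cases x; cases y) (auto dest: injD[OF p])
  qed
  then show thesis by (rule that)
qed

lemma list_injection:
  assumes "infinite (UNIV :: 'u set)"
  shows "\<exists>e :: 'u list \<Rightarrow> 'u. inj_on e {xs. length xs = n}"
proof -
  obtain p :: "'u \<times> 'u \<Rightarrow> 'u" where p: "inj p" using infinite_pairing[OF assms] .
  show ?thesis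
  proof (induction n)
    case 0
    show ?case by (intro exI[of _ "\<lambda>_. undefined"]) simp
  next
    case (Suc n)
    then obtain e :: "'u list \<Rightarrow> 'u" where e: "inj_on e {xs. length xs = n}" by blast
    have "inj_on (\<lambda>xs. p (hd xs, e (tl xs))) {xs. length xs = Suc n}"
    proof (rule inj_onI)
      fix xs ys assume xs: "xs \<in> {xs. length xs = Suc n}" and ys: "ys \<in> {xs. length xs = Suc n}"
        and eq: "p (hd xs, e (tl xs)) = p (hd ys, e (tl ys))"
      obtain x xs' where x: "xs = x # xs'" "length xs' = n" using xs by (cases xs) auto
      obtain y ys' where y: "ys = y # ys'" "length ys' = n" using ys by (cases ys) auto
      have "(x, e xs') = (y, e ys')" using injD[OF p eq] x y by simp
      then have "x = y" "e xs' = e ys'" by auto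
      then show "xs = ys" using inj_onD[OF e, of xs' ys'] x y by blast
    qed
    then show ?case by blast
  qed
qed

text \<open>\<open>encode\<close> is a choice, so a family of injections has to be exhibited. A
  functor on the ordinal with \<open>m + 1\<close> elements is coded by the list of its
  \<open>m + 1\<close> objects and \<open>m\<close> consecutive arrows, and lists of fixed length
  inject into the infinite type.\<close>

lemma encode_inj:
  fixes C :: "'u cat"
  assumes "infinite (UNIV :: 'u set)"
  shows "inj_on (encode (nerve C) m n :: _ \<Rightarrow> 'u) (pts (nerve C) m n)"
proof -
  have "\<exists>e :: _ \<Rightarrow> 'u. inj_on e (functors (ord_cat m) C)" for m
  proof -
    let ?l = "\<lambda>x :: (nat, nat \<times> nat, 'u, 'u) fctr. map (FObj x) [0..<Suc m] @ map (\<lambda>i. FArr x (i, Suc i)) [0..<m]"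
    have "inj_on ?l (functors (ord_cat m) C)"
    proof (rule inj_onI)
      fix x y assume xy: "x \<in> functors (ord_cat m) C" "y \<in> functors (ord_cat m) C" and eq: "?l x = ?l y"
      have "map (FObj x) [0..<Suc m] = map (FObj y) [0..<Suc m]"
        "map (\<lambda>i. FArr x (i, Suc i)) [0..<m] = map (\<lambda>i. FArr y (i, Suc i)) [0..<m]"
        using eq by (auto simp del: upt_Suc)
      then show "x = y" by (intro ord_functor_eqI[OF xy]) (auto simp del: upt_Suc)
    qed
    moreover obtain e :: "'u list \<Rightarrow> 'u" where e: "inj_on e {xs. length xs = Suc m + m}"
      using list_injection[OF assms] by blast
    ultimately have "inj_on (e \<circ> ?l) (functors (ord_cat m) C)"
      by (intro comp_inj_on inj_on_subset[OF e]) auto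
    then show ?thesis by blast
  qed
  then have "\<exists>e. \<forall>m. inj_on (e m :: _ \<Rightarrow> 'u) (functors (ord_cat m) C)" by (intro choice allI)
  then have "\<exists>e. \<forall>m n. inj_on (e m n :: _ \<Rightarrow> 'u) (pts (nerve C) m n)" by (auto simp: nerve_def)
  then have "\<forall>m n. inj_on (encode (nerve C) m n :: _ \<Rightarrow> 'u) (pts (nerve C) m n)"
    unfolding encode_def by (rule someI_ex)
  then show ?thesis by blast
qed

lemma nerve_simps:
  "pts (nerve C) m n = functors (ord_cat m) C"
  "act (level (nerve C) m) k n \<tau> x = x"
  "hact (nerve C) n m \<theta> k x = functor_comp x (ord_fctr n m \<theta>)"
  by (auto simp: nerve_def) (auto simp: hdisc_def disc_sset_def)

context
  assumes inf: "infinite (UNIV :: 'u set)"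
begin

lemma decode_encode:
  fixes C :: "'u cat"
  assumes "x \<in> functors (ord_cat m) C"
  shows "decode (nerve C) m n (encode (nerve C) m n x :: 'u) = x"
  using assms encode_inj[OF inf, of C m n] by (simp add: decode_def nerve_simps inv_into_f_f)

lemma small_copy_pts:
  "pts (small_copy X) m n = encode X m n ` pts X m n"
  by (simp add: small_copy_def pts_def[of "\<lparr>level = _, hact = _\<rparr>"])

abbreviation enc_nerve :: "'u cat \<Rightarrow> 'u sspace" where
  "enc_nerve C \<equiv> small_copy (nerve C)"

lemma encode_decode:
  fixes C :: "'u cat" and u :: 'u
  assumes "u \<in> pts (enc_nerve C) m n"
  shows "encode (nerve C) m n (decode (nerve C) m n u) = u"
    "decode (nerve C) m n u \<in> functors (ord_cat m) C"
  using assms by (auto simp: small_copy_pts decode_encode nerve_simps)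

text \<open>Decoding in space degree 0 serves as \<open>T\<close>.\<close>

lemma encoded_nerve_like:
  fixes C :: "'u cat"
  assumes C: "is_category C" and N: "is_sspace (enc_nerve C)"
  shows "nerve_like (enc_nerve C) C (\<lambda>m. decode (nerve C) m 0)"
proof
  note ed = encode_decode[of _ C]
  show "is_sspace (enc_nerve C)" "is_category C" by fact+
  show "constant_sset (level (enc_nerve C) m)" for m
    unfolding constant_sset_def
  proof (intro conjI allI impI ballI sspace_level[OF N])
    fix n i u assume "u \<in> simp (level (enc_nerve C) m) n"
    then have u: "u \<in> pts (enc_nerve C) m n" by (simp add: pts_def)
    \<comment> \<open>The space direction of the nerve is trivial, so its transported action merely
      changes the code from degree \<open>l\<close> to degree \<open>k\<close>; passing to degree 0
      and back returns the same code.\<close>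
    have "act (level (enc_nerve C) m) k l \<tau> v = encode (nerve C) m k (decode (nerve C) m l v)" for k l \<tau> v
      by (simp add: small_copy_def nerve_simps)
    then show "act (level (enc_nerve C) m) n 0 (cst n 0) (act (level (enc_nerve C) m) 0 n (cst 0 i) u) = u"
      using ed[OF u] by (simp add: decode_encode)
  qed
  show "bij_betw (decode (nerve C) m 0) (pts (enc_nerve C) m 0) (functors (ord_cat m) C)" for m
  proof (rule bij_betw_byWitness[where f' = "encode (nerve C) m 0"])
    show "\<forall>u\<in>pts (enc_nerve C) m 0. encode (nerve C) m 0 (decode (nerve C) m 0 u) = u"
      "decode (nerve C) m 0 ` pts (enc_nerve C) m 0 \<subseteq> functors (ord_cat m) C" using ed by blast+
  qed (auto simp: decode_encode small_copy_pts nerve_simps)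
  show "decode (nerve C) n 0 (hact (enc_nerve C) n m \<theta> 0 u) = functor_comp (decode (nerve C) m 0 u) (ord_fctr n m \<theta>)"
    if "\<theta> \<in> Delta n m" "u \<in> pts (enc_nerve C) m 0" for n m \<theta> u
    using functor_comp_functors[OF ord_fctr_functors[OF that(1)] ed(2)[OF that(2)]]
    by (simp add: small_copy_def nerve_simps decode_encode)
qed

lemma encoded_nerve_map:
  fixes F :: "'u cat_arr"
  assumes F: "F \<in> functors C D"
    and NC: "is_sspace (enc_nerve C)" and ND: "is_sspace (enc_nerve D)"
    and f: "sspace_map (enc_nerve C) (enc_nerve D)
      (small_copy_map (nerve C) (nerve D) (nerve_map F) :: _ \<Rightarrow> _ \<Rightarrow> 'u \<Rightarrow> 'u)"
  shows "nerve_like_map (enc_nerve C) C (\<lambda>m. decode (nerve C) m 0)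
    (enc_nerve D) D (\<lambda>m. decode (nerve D) m 0) F
    (small_copy_map (nerve C) (nerve D) (nerve_map F))"
proof -
  note F' = functorsD[OF F]
  have C: "is_category C" "is_category D" using functor_cats[OF F'(1)] F' by auto
  interpret D: nerve_like "enc_nerve C" C "\<lambda>m. decode (nerve C) m 0"
    by (rule encoded_nerve_like[OF C(1) NC])
  interpret E: nerve_like "enc_nerve D" D "\<lambda>m. decode (nerve D) m 0"
    by (rule encoded_nerve_like[OF C(2) ND])
  show ?thesis
  proof (unfold_locales, rule F, rule f)
    fix m u assume u: "u \<in> pts (enc_nerve C) m 0"
    note d = encode_decode(2)[OF u]
    show "decode (nerve D) m 0 (small_copy_map (nerve C) (nerve D) (nerve_map F) m 0 u)
      = functor_comp F (decode (nerve C) m 0 u)"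
      using u d F' functor_comp_functors[OF d F]
      by (simp add: small_copy_map_def nerve_map_def nerve_simps decode_encode)
  qed
qed

end


section \<open>Coproducts and cofibrant objects in the category of simplicial spaces\<close>

lemma SSp_simps [simp]:
  "Obj SSp = {X. is_sspace X}" "(X, Y, f) \<in> Arr SSp \<longleftrightarrow> sspace_map X Y f"
  "Dom SSp (X, Y, f) = X" "Cod SSp (X, Y, f) = Y"
  "Ident SSp X = (X, X, \<lambda>m n. \<lambda>x\<in>pts X m n. x)"
  "Comp SSp (Y', Z, g) (X, Y, f) = (X, Z, sspace_comp X g f)"
  by (auto simp: SSp_def)

lemma SSp_Hom: "u \<in> Hom SSp X Y \<longleftrightarrow> (\<exists>f. u = (X, Y, f) \<and> sspace_map X Y f)"
  by (cases u) (auto simp: Hom_def)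

text \<open>The disjoint union, with its elements recoded by \<open>e\<close> so that it has the
  same element type as an object of \<open>SSp\<close>; \<open>inv_into\<close> undoes the code when
  \<open>e\<close> is injective.\<close>

definition sspace_coprod :: "('a + 'b \<Rightarrow> 'c) \<Rightarrow> 'a sspace \<Rightarrow> 'b sspace \<Rightarrow> 'c sspace" where
  "sspace_coprod e X Y = \<lparr>
     level = (\<lambda>m. \<lparr>simp = (\<lambda>n. e ` (pts X m n <+> pts Y m n)),
       act = (\<lambda>k n \<tau> u. e (map_sum (act (level X m) k n \<tau>) (act (level Y m) k n \<tau>) (inv_into UNIV e u)))\<rparr>),
     hact = (\<lambda>l m \<theta> n u. e (map_sum (hact X l m \<theta> n) (hact Y l m \<theta> n) (inv_into UNIV e u)))\<rparr>"

context
  fixes e :: "'u + 'u \<Rightarrow> 'u" and X Y :: "'u sspace"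
  assumes e: "inj e" and X: "is_sspace X" and Y: "is_sspace Y"
begin

abbreviation "cop \<equiv> sspace_coprod e X Y"

lemma sspace_coprod_pts: "pts cop m n = e ` (pts X m n <+> pts Y m n)"
  by (simp add: sspace_coprod_def pts_def[of "\<lparr>level = _, hact = _\<rparr>"])

lemma sspace_coprod_acts:
  "act (level cop m) k n \<tau> (e z) = e (map_sum (act (level X m) k n \<tau>) (act (level Y m) k n \<tau>) z)"
  "hact cop l m \<theta> n (e z) = e (map_sum (hact X l m \<theta> n) (hact Y l m \<theta> n) z)"
  using e by (auto simp: sspace_coprod_def)

lemma sspace_coprod_sspace: "is_sspace cop"
proof (rule is_sspaceI)
  show "is_sset (level cop m)" for m
    using sspace_level[OF X, of m] sspace_level[OF Y, of m]
    by (intro is_ssetI) (auto simp: pts_def[of "sspace_coprod _ _ _", symmetric] sspace_coprod_pts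
        sspace_coprod_acts level_act_closed[OF X] level_act_closed[OF Y] sset_act_id sset_act_comp pts_def[of X] pts_def[of Y]
        inj_image_mem_iff[OF e] sset_act_closed)
qed (auto simp: sspace_coprod_pts sspace_coprod_acts inj_image_mem_iff[OF e] hact_closed[OF X] hact_closed[OF Y]
    hact_natural[OF X] hact_natural[OF Y] hact_id[OF X] hact_id[OF Y] hact_comp[OF X] hact_comp[OF Y])

definition "cop_inl = (X, cop, \<lambda>m n. \<lambda>x\<in>pts X m n. e (Inl x))"
definition "cop_inr = (Y, cop, \<lambda>m n. \<lambda>y\<in>pts Y m n. e (Inr y))"

lemma cop_Hom:
  "cop_inl \<in> Hom SSp X cop" "cop_inr \<in> Hom SSp Y cop"
  unfolding cop_inl_def cop_inr_def SSp_Hom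
  by (auto intro!: sspace_mapI X Y sspace_coprod_sspace simp: sspace_coprod_pts sspace_coprod_acts
      inj_image_mem_iff[OF e] level_act_closed[OF X] level_act_closed[OF Y] hact_closed[OF X] hact_closed[OF Y])

lemma SSp_coproduct: "coproduct SSp cop_inl cop_inr"
  unfolding coproduct_def HomD[OF cop_Hom(1)] HomD[OF cop_Hom(2)]
proof (intro conjI ballI HomD[OF cop_Hom(1)] HomD[OF cop_Hom(2)] refl)
  fix Z u v assume "u \<in> Hom SSp X Z" "v \<in> Hom SSp Y Z"
  then obtain f g where u: "u = (X, Z, f)" "sspace_map X Z f" and v: "v = (Y, Z, g)" "sspace_map Y Z g"
    by (auto simp: SSp_Hom)
  define h where "h m n = (\<lambda>z\<in>pts cop m n. case_sum (f m n) (g m n) (inv_into UNIV e z))" for m n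
  have h_e: "h m n (e (Inl x)) = f m n x" if "x \<in> pts X m n" for m n x
    using that e by (auto simp: h_def sspace_coprod_pts inj_image_mem_iff[OF e])
  have h_e': "h m n (e (Inr x)) = g m n x" if "x \<in> pts Y m n" for m n x
    using that e by (auto simp: h_def sspace_coprod_pts inj_image_mem_iff[OF e])
  have "sspace_map cop Z h"
  proof (rule sspace_mapI[OF sspace_coprod_sspace sspace_map_sspaces(2)[OF u(2)]])
    show "h m n \<in> pts cop m n \<rightarrow>\<^sub>E pts Z m n" for m n
      using h_e h_e' sspace_map_closed[OF u(2)] sspace_map_closed[OF v(2)]
      by (auto simp: sspace_coprod_pts) (simp add: h_def sspace_coprod_pts)
  qed (auto simp: sspace_coprod_pts sspace_coprod_acts h_e h_e' level_act_closed[OF X] level_act_closed[OF Y]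
      hact_closed[OF X] hact_closed[OF Y] sspace_map_act[OF u(2)] sspace_map_act[OF v(2)]
      sspace_map_hact[OF u(2)] sspace_map_hact[OF v(2)])
  moreover have "sspace_comp X h (\<lambda>m n. \<lambda>x\<in>pts X m n. e (Inl x)) = f"
    using sspace_map_ext[OF u(2)]
    by (intro ext) (auto simp: sspace_comp_def compose_def h_e restrict_def PiE_def extensional_def)
  moreover have "sspace_comp Y h (\<lambda>m n. \<lambda>y\<in>pts Y m n. e (Inr y)) = g"
    using sspace_map_ext[OF v(2)]
    by (intro ext) (auto simp: sspace_comp_def compose_def h_e' restrict_def PiE_def extensional_def)
  ultimately have h: "(cop, Z, h) \<in> Hom SSp cop Z \<and> Comp SSp (cop, Z, h) cop_inl = u \<and> Comp SSp (cop, Z, h) cop_inr = v"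
    by (simp add: SSp_Hom cop_inl_def cop_inr_def u(1) v(1))
  have unique: "k = h" if k: "sspace_map cop Z k"
    and l: "sspace_comp X k (\<lambda>m n. \<lambda>x\<in>pts X m n. e (Inl x)) = f"
    and r: "sspace_comp Y k (\<lambda>m n. \<lambda>y\<in>pts Y m n. e (Inr y)) = g" for k
  proof (intro ext)
    fix m n z
    have "k m n (e (Inl x)) = f m n x" if "x \<in> pts X m n" for x
      using that unfolding l[symmetric] by (simp add: sspace_comp_def compose_def)
    moreover have "k m n (e (Inr x)) = g m n x" if "x \<in> pts Y m n" for x
      using that unfolding r[symmetric] by (simp add: sspace_comp_def compose_def)
    ultimately show "k m n z = h m n z"
      using sspace_map_ext[OF k, of m n] h_e h_e'
      by (cases "z \<in> pts cop m n") (auto simp: sspace_coprod_pts h_def PiE_def extensional_def inv_f_f[OF e])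
  qed
  show "\<exists>!h. h \<in> Hom SSp cop Z \<and> Comp SSp h cop_inl = u \<and> Comp SSp h cop_inr = v"
  proof (rule ex1I, rule h)
    fix w assume w: "w \<in> Hom SSp cop Z \<and> Comp SSp w cop_inl = u \<and> Comp SSp w cop_inr = v"
    then obtain k where k: "w = (cop, Z, k)" "sspace_map cop Z k" by (auto simp: SSp_Hom)
    then have "k = h" using w by (intro unique) (simp_all add: cop_inl_def cop_inr_def u(1) v(1))
    then show "w = (cop, Z, h)" using k by simp
  qed
qed

end

section \<open>The initial simplicial space and cofibrancy of constant objects\<close>

definition empty_sspace :: "'u sspace" where
  "empty_sspace = const_sspace (disc_sset {})"

lemma empty_sspace_pts [simp]: "pts empty_sspace m n = {}"
  by (simp add: empty_sspace_def disc_sset_def)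

lemma empty_sspace_sspace: "is_sspace empty_sspace"
  unfolding empty_sspace_def by (rule const_sspace_sspace[OF disc_sset_sset])

lemma empty_sspace_map: "is_sspace X \<Longrightarrow> sspace_map empty_sspace X f \<longleftrightarrow> f = (\<lambda>m n x. undefined)"
proof
  assume "sspace_map empty_sspace X f"
  then show "f = (\<lambda>m n x. undefined)" using sspace_map_ext[of empty_sspace X f] by (auto simp: fun_eq_iff)
next
  assume "is_sspace X" and "f = (\<lambda>m n x. undefined)"
  then show "sspace_map empty_sspace X f" by (intro sspace_mapI empty_sspace_sspace) auto
qed

lemma empty_sspace_initial: "initial SSp (empty_sspace :: 'u sspace)"
  by (auto simp: initial_def SSp_Hom empty_sspace_map empty_sspace_sspace)

text \<open>A simplicial space that maps to the empty one is empty, so two parallel maps into it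
  coincide already.\<close>

lemma empty_sspace_monic:
  assumes "sspace_map empty_sspace X f"
  shows "monic SSp (empty_sspace, X, f)"
  unfolding monic_def
proof (intro conjI ballI impI)
  fix g h assume gh: "g \<in> Arr SSp" "h \<in> Arr SSp"
    "Cod SSp g = Dom SSp (empty_sspace, X, f)" "Cod SSp h = Dom SSp (empty_sspace, X, f)" "Dom SSp g = Dom SSp h"
  obtain W Z g' where g: "g = (W, Z, g')" by (cases g)
  obtain W' Z' h' where h: "h = (W', Z', h')" by (cases h)
  have "W' = W" "Z = empty_sspace" "Z' = empty_sspace" using gh(3-5) by (simp_all add: g h)
  note g = g[unfolded this] and h = h[unfolded this]
  have g: "g = (W, empty_sspace, g')" "sspace_map W empty_sspace g'" using gh(1) g by simp_all
  have h: "h = (W, empty_sspace, h')" "sspace_map W empty_sspace h'" using gh(2) h by simp_all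
  have "pts W m n = {}" for m n using sspace_map_closed[OF g(2)] by auto
  then have "g' m n = h' m n" for m n
    using sspace_map_ext[OF g(2), of m n] sspace_map_ext[OF h(2), of m n] by simp
  then have "g' = h'" by (intro ext) simp
  then show "g = h" using g h by simp
qed (use assms in simp)

text \<open>The weak equivalence required of a cofibration \<open>\<emptyset> \<rightarrow> X\<close> is the identification of the constant
  simplicial set \<open>X\<^sub>0\<close> with its set of vertices.\<close>

lemma constant_cat_cofibration:
  fixes X :: "'u sspace"
  assumes X: "is_sspace X" and const: "constant_sset (level X 0)"
  shows "cat_cofibration (empty_sspace, X, \<lambda>m n x. undefined)"
proof -
  let ?S = "simp (level X 0) 0"
  let ?A = "sset_coprod (level (empty_sspace :: 'u sspace) 0) (disc_sset ?S)"
  let ?g = "\<lambda>n. \<lambda>z\<in>{} <+> ?S. act (level X 0) n 0 (cst n 0) (projr z)"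
  have simp: "simp ?A n = {} <+> ?S" for n
    by (simp add: sset_coprod_def disc_sset_def empty_sspace_def const_sspace_def)
  have act: "act ?A n m \<theta> (Inr s) = Inr s" for n m \<theta> s by (simp add: sset_coprod_def disc_sset_def)
  have A: "is_sset ?A" by (rule is_ssetI) (auto simp: simp act)
  then have cA: "constant_sset ?A" by (auto simp: constant_sset_def simp act)
  note L = sspace_level[OF X, of 0]
  have g: "sset_map ?A (level X 0) ?g"
    by (rule sset_mapI[OF A L])
      (auto simp: simp act sset_act_closed[OF L] act_degenerate[OF L])
  have "act (level X 0) 0 0 (cst 0 0) s = s" if "s \<in> ?S" for s
    using sset_act_id[OF L that] unfolding id_0 .
  then have "bij_betw (?g 0) (simp ?A 0) (simp (level X 0) 0)"
    unfolding simp by (auto simp: bij_betw_def inj_on_def image_iff Plus_def)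
  then have "weak_equivalence ?A (level X 0) ?g" by (rule constant_weak_equivalence[OF g cA const])
  moreover have "monic SSp (empty_sspace, X, \<lambda>m n x. undefined)"
    by (rule empty_sspace_monic[OF iffD2[OF empty_sspace_map[OF X] refl]])
  ultimately show ?thesis unfolding cat_cofibration_def by (auto intro!: exI[of _ ?S] exI[of _ ?g])
qed


section \<open>The Quillen pair\<close>

theorem proposition6p1:
  fixes M\<^sub>S :: "'u sspace_arr model"
    and M\<^sub>C :: "'u cat_arr model"
    and c :: "('u sspace, 'u sspace_arr, 'u cat, 'u cat_arr) fctr"
    and \<eta> :: "'u sspace \<Rightarrow> 'u sspace_arr"
    and \<epsilon> :: "'u cat \<Rightarrow> 'u cat_arr"
  assumes "infinite (UNIV :: 'u set)"
    and "sspace_Cat_model_structure M\<^sub>S"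
    and "categorical_model_structure M\<^sub>C"
    and "adjunction c Nerve \<eta> \<epsilon>"
  shows "quillen_pair M\<^sub>S M\<^sub>C c Nerve \<eta> \<epsilon> \<and>
    (\<forall>C\<in>Obj CAT. \<forall>K. represents_derived_counit M\<^sub>S M\<^sub>C c Nerve \<epsilon> C K \<longrightarrow> is_equivalence K)"
proof -
  note inf = assms(1) and adj = assms(4)
  let ?N = "\<lambda>C :: 'u cat. enc_nerve C :: 'u sspace"
  let ?n = "\<lambda>F :: 'u cat_arr. small_copy_map (nerve (FDom F)) (nerve (FCod F)) (nerve_map F)
    :: nat \<Rightarrow> nat \<Rightarrow> 'u \<Rightarrow> 'u"
  let ?dec = "\<lambda>(C :: 'u cat) m. decode (nerve C) m 0 :: 'u \<Rightarrow> _"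
  have CAT: "Obj CAT = {C :: 'u cat. is_category C}" "Arr CAT = {F :: 'u cat_arr. is_functor F}"
    "\<And>F :: 'u cat_arr. Dom CAT F = FDom F" "\<And>F :: 'u cat_arr. Cod CAT F = FCod F"
    by (auto simp: CAT_def)
  have CAT_Hom: "Hom CAT C D = functors C D" for C D :: "'u cat"
    by (auto simp: Hom_def CAT functors_def)
  have N: "is_functor (Nerve :: ('u cat, 'u cat_arr, 'u sspace, 'u sspace_arr) fctr)"
    using adjunction_functors(2)[OF adj] .
  have FD: "FDom c = SSp" "FCod c = CAT" using adjunction_functors(3,4)[OF adj] by (auto simp: Nerve_def)
  have Nd: "FDom Nerve = (CAT :: ('u cat, 'u cat_arr) category)" "FCod Nerve = (SSp :: ('u sspace, 'u sspace_arr) category)"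
    by (auto simp: Nerve_def)
  have NO: "FObj Nerve C = ?N C" if "is_category C" for C using that by (simp add: Nerve_def CAT)
  have NA: "FArr Nerve F = (?N (FDom F), ?N (FCod F), ?n F)" if "is_functor F" for F
    using that by (simp add: Nerve_def CAT)
  \<comment> \<open>The functor \<open>Nerve\<close> sends objects of \<open>CAT\<close> to objects
    of \<open>SSp\<close>; this replaces a direct verification on codes.\<close>
  have Ns: "is_sspace (?N C)" if "is_category C" for C
    using functor_Obj[OF N, of C] that NO[OF that] by (simp add: Nd CAT)
  have Nm: "sspace_map (?N C) (?N D) (?n F)" if "F \<in> functors C D" for F C D
  proof -
    note F = functorsD[OF that]
    have "FArr Nerve F \<in> Hom SSp (FObj Nerve C) (FObj Nerve D)"
      using functor_Hom[OF N, of F C D] that by (simp add: Nd CAT_Hom)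
    then show ?thesis using NA[OF F(1)] NO functor_cats[OF F(1)] F by (simp add: SSp_Hom)
  qed
  have nl: "nerve_like (?N C) C (?dec C)" if "is_category C" for C
    by (rule encoded_nerve_like[OF inf that Ns[OF that]])
  have nlm: "nerve_like_map (?N C) C (?dec C) (?N D) D (?dec D) F (?n F)" if "F \<in> functors C D" for F C D
  proof -
    note F = functorsD[OF that]
    show ?thesis
      using encoded_nerve_map[OF inf that Ns Ns Nm[OF that, unfolded F(2,3)]] functor_cats[OF F(1)] F by simp
  qed

  have MS: "model_structure (FDom c) M\<^sub>S" and MC: "model_structure (FCod c) M\<^sub>C"
    using assms(2,3) by (auto simp: FD sspace_Cat_model_structure_def categorical_model_structure_def)
  have segal_arr: "((X, Y, f) \<in> Weq M\<^sub>S \<longleftrightarrow> dk_equivalence X Y f) \<and> ((X, Y, f) \<in> Fib M\<^sub>S \<longleftrightarrow> segal_isofibration X Y f)"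
    if "sspace_map X Y f" "segal_space X" "segal_space Y" for X Y f
    using assms(2) that unfolding sspace_Cat_model_structure_def by simp
  have Nseg: "segal_space (?N C)" if "is_category C" for C by (rule nerve_like.segal[OF nl[OF that]])
  have right: "FArr Nerve p \<in> Fib M\<^sub>S" "p \<in> Weq M\<^sub>C \<Longrightarrow> FArr Nerve p \<in> Weq M\<^sub>S" if "p \<in> Fib M\<^sub>C" for p
  proof -
    have p: "is_functor p" "is_isofibration p"
      using that assms(3) by (auto simp: categorical_model_structure_def CAT)
    have pf: "p \<in> functors (FDom p) (FCod p)" using p by (simp add: functors_def)
    note arr = segal_arr[OF Nm[OF pf] Nseg Nseg, OF functor_cats[OF p(1)]]
    show "FArr Nerve p \<in> Fib M\<^sub>S"
      using arr nerve_like_map.isofibration[OF nlm[OF pf] p(2)] NA[OF p(1)] by simp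
    assume "p \<in> Weq M\<^sub>C"
    then have "is_equivalence p" using assms(3) by (auto simp: categorical_model_structure_def)
    then show "FArr Nerve p \<in> Weq M\<^sub>S"
      using arr nerve_like_map.equivalence[OF nlm[OF pf]] NA[OF p(1)] by simp
  qed

  \<comment> \<open>The disjunction treats both cases at once: trivial cofibrations against
    fibrations, and cofibrations against trivial fibrations.\<close>
  have lift: "has_lifts (FCod c) (FArr c i) p"
    if i: "i \<in> Cof M\<^sub>S" and p: "p \<in> Fib M\<^sub>C" and w: "i \<in> Weq M\<^sub>S \<or> p \<in> Weq M\<^sub>C" for i p
  proof (rule left_adjoint_has_lifts[OF adj])
    show "i \<in> Hom (FDom c) (Dom (FDom c) i) (Cod (FDom c) i)" "p \<in> Hom (FCod c) (Dom (FCod c) p) (Cod (FCod c) p)"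
      using model_Arr[OF MS] model_Arr[OF MC] i p by (auto simp: Hom_def)
    show "has_lifts (FDom c) i (FArr Nerve p)"
      using model_lifts[OF MS i right(1)[OF p]] right(2)[OF p] w by blast
  qed
  have hom: "FArr c i \<in> Hom (FCod c) (FObj c (Dom (FDom c) i)) (FObj c (Cod (FDom c) i))" if "i \<in> Cof M\<^sub>S" for i
    by (rule functor_Hom[OF adjunction_functors(1)[OF adj]]) (use that model_Arr(1)[OF MS] in \<open>auto simp: Hom_def\<close>)
  have cof: "FArr c i \<in> Cof M\<^sub>C" if "i \<in> Cof M\<^sub>S" for i
    using cof_by_lifts[OF MC hom[OF that]] lift[OF that] by blast
  have triv: "FArr c i \<in> Cof M\<^sub>C" "FArr c i \<in> Weq M\<^sub>C" if "i \<in> Cof M\<^sub>S" "i \<in> Weq M\<^sub>S" for i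
    using triv_cof_by_lifts[OF MC hom[OF that(1)]] lift[OF that(1)] that(2) by blast+
  have Q: "quillen_pair M\<^sub>S M\<^sub>C c Nerve \<eta> \<epsilon>"
    unfolding quillen_pair_def using MS MC adj cof triv by blast

  have counit: "is_iso (FCod c) (\<epsilon> D)" if D: "is_category D" for D
  proof (rule counit_iso[OF adj])
    show "D \<in> Obj (FCod c)" using D by (simp add: FD CAT)
  next
    fix E g assume E: "E \<in> Obj (FCod c)" and g: "g \<in> Hom (FDom c) (FObj Nerve D) (FObj Nerve E)"
    have Ec: "is_category E" using E by (simp add: FD CAT)
    obtain f where f: "g = (?N D, ?N E, f)" "sspace_map (?N D) (?N E) f"
      using g NO[OF D] NO[OF Ec] by (auto simp: FD SSp_Hom)
    interpret P: nerve_like_pair "?N D" D "?dec D" "?N E" E "?dec E" f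
      using nl[OF D] nl[OF Ec] f(2) by (intro nerve_like_pair.intro nerve_like_pair_axioms.intro)
    let ?F = "P.induced"
    note F = P.induced_functors and F' = functorsD[OF P.induced_functors]
    interpret M: nerve_like_map "?N D" D "?dec D" "?N E" E "?dec E" ?F "?n ?F" by (rule nlm[OF F])
    \<comment> \<open>Target levels are constant, so comparison in space degree 0 suffices; there
      both maps decode to composition with \<open>?F\<close>, and decoding is injective.\<close>
    have "?n ?F = f"
    proof (rule map_to_constant_ext[OF Nm[OF F] f(2) P.E.const])
      fix m x assume x: "x \<in> pts (?N D) m 0"
      have "?dec E m (?n ?F m 0 x) = ?dec E m (f m 0 x)" using M.S_f[OF x] P.induced_T[OF x] by simp
      then show "?n ?F m 0 x = f m 0 x"
        using P.E.T_inj sspace_map_closed[OF Nm[OF F] x] sspace_map_closed[OF f(2) x] by blast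
    qed
    then show "\<exists>F\<in>Hom (FCod c) D E. FArr Nerve F = g"
      using F F' NA[OF F'(1)] f(1) by (intro bexI[of _ ?F]) (auto simp: FD CAT_Hom)
  next
    fix F G assume "F \<in> Hom (FCod c) D D" "G \<in> Hom (FCod c) D D" and eq: "FArr Nerve F = FArr Nerve G"
    then have F: "F \<in> functors D D" and G: "G \<in> functors D D" by (auto simp: FD CAT_Hom)
    have "?n F = ?n G" using eq NA functorsD(1)[OF F] functorsD(1)[OF G] by simp
    then show "F = G" using nerve_like_map.functor_determined[OF nlm[OF G], of F] nlm[OF F] by simp
  qed

  have Ncof: "cofibrant SSp M\<^sub>S (?N D)" if D: "is_category D" for D
  proof -
    have "cat_cofibration (empty_sspace, ?N D, \<lambda>m n x. undefined)"
      by (rule constant_cat_cofibration[OF Ns[OF D] nerve_like.const[OF nl[OF D]]])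
    moreover have map: "sspace_map (empty_sspace :: 'u sspace) (?N D) (\<lambda>m n x. undefined)"
      by (rule iffD2[OF empty_sspace_map[OF Ns[OF D]] refl])
    ultimately have "(empty_sspace, ?N D, \<lambda>m n x. undefined) \<in> Cof M\<^sub>S"
      using assms(2) unfolding sspace_Cat_model_structure_def by simp
    then show ?thesis
      unfolding cofibrant_def using empty_sspace_initial map by (auto simp: SSp_Hom)
  qed
  have "is_equivalence K" if K: "represents_derived_counit M\<^sub>S M\<^sub>C c Nerve \<epsilon> C K" for C K
  proof -
    obtain D r A q where r: "r \<in> Hom (FCod c) C D" and q: "q \<in> Hom (FDom c) A (FObj Nerve D)" "q \<in> Weq M\<^sub>S"
      and A: "cofibrant (FDom c) M\<^sub>S A" and KD: "K = Comp (FCod c) (\<epsilon> D) (FArr c q)"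
      using K unfolding represents_derived_counit_def by blast
    have D: "is_category D" using Hom_Obj(2)[OF model_category[OF MC] r] by (simp add: FD CAT)
    have q': "q \<in> Hom (FDom c) A (?N D)" using q(1) NO[OF D] by simp
    have As: "is_sspace A" using Hom_Obj(1)[OF model_category[OF MS] q'] by (simp add: FD)
    \<comment> \<open>Supplies the coproduct of \<open>A\<close> and the nerve of \<open>D\<close>
      on which Ken Brown's lemma relies.\<close>
    obtain e :: "'u + 'u \<Rightarrow> 'u" where e: "inj e" using infinite_sum_injection[OF inf] .
    note cop = SSp_coproduct[OF e As Ns[OF D]] cop_Hom[OF e As Ns[OF D]]
    have "FArr c q \<in> Weq M\<^sub>C"
      by (rule Ken_Brown[OF MS MC adjunction_functors(1)[OF adj] triv(2) q' q(2) A])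
        (use cop Ncof[OF D] in \<open>simp_all add: FD\<close>)
    moreover have "\<epsilon> D \<in> Weq M\<^sub>C" using iso_Weq[OF MC counit[OF D]] .
    moreover have "D \<in> Obj (FCod c)" using D by (simp add: FD CAT)
    ultimately have "K \<in> Weq M\<^sub>C"
      unfolding KD using model_two_of_three(1)[OF MC functor_Hom[OF adjunction_functors(1)[OF adj] q(1)]
          counit_Hom[OF adj]] by blast
    then show ?thesis using assms(3) by (auto simp: categorical_model_structure_def)
  qed
  with Q show ?thesis by blast
qed

end
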